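(* Let $K=l_0\,p\,\|b\|_\infty$, let $g\in L^\infty(U)$ satisfy $\|g\|_\infty<\frac1{l_0}\left(\frac1{2^pK}\right)^{\frac1{p-1}}$, choose $0<c_0<1$ and set $\varepsilon_0:=\left(\frac{(1-c_0)^p}{2^pK}\right)^{\frac1{p-1}}$. Let $\{X_j\}_{j\in\mathbb{N}}$ be an independent sequence of random variables $X_j:\Omega\to\mathcal{M}(U)$. Assume that the admissible set $\mathcal{A}_j$ of $X_j$ (defined in the context) equals $\Omega$ for all $j$, and let $u_j(\cdot,\omega)\in L^\infty(U)$ be the corresponding solution with respect to $X_j(\omega)=\mu_{\omega,j}$ and $g$. If $X_j\to X$ a.s. (in $\mathcal{M}(U)$, for some $\mathcal{M}(U)$-valued random variable $X$) and $$L=\sup_{j\in\mathbb{N}}\left(\operatorname*{ess\,sup}_{\omega\in\Omega}|\mu_{\omega,j}|\right)<\frac1{l_0\|f\|_\infty},$$ then $$\sum_{j=1}^k\frac{u_j(x,\omega)-\mathbb{E}_\Omega[u_j(x,\omega)]}{k}\to0$$ and $$\sum_{j=1}^k\frac{\|u_j(\cdot,\omega)\|_\infty-\mathbb{E}_\Omega[\|u_j(\cdot,\omega)\|_\infty]}{k}\to0$$ when $k\to\infty$, where both convergences are in probability (the first as $L^\infty(U)$-valued random variables, the second as real random variables).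
   Context: Let $n\ge3$, $p>1$, and let $U\subset\mathbb{R}^n$ be a bounded domain with diameter $d_U$; put $l_0:=\frac{d_U^2}{2(n-2)}$. $(\Omega,\mathcal{F},\mathbb{P})$ is a complete probability space. $\mathcal{M}(U)$ is the space of (signed) Radon measures on $U$ of finite total variation, with total variation norm denoted $|\mu|$ and its Borel $\sigma$-algebra; $\mathcal{M}(U)$-valued random variables are Borel measurable maps, and convergence in $\mathcal{M}(U)$ is in total variation norm. $f\in BC(\mathbb{R}^n)$ (bounded continuous real functions) and $b\in L^\infty(U)$ are fixed, both nonzero, with $\|f\|_\infty:=\sup_{\mathbb{R}^n}|f|$ and $\|\cdot\|_\infty$ the essential supremum norm on $L^\infty(U)$. For an $\mathcal{M}(U)$-valued random variable $X$ put $\mu_\omega:=X(\omega)$ and $V_\omega(x):=\int_U f(x-y)\,d\mu_\omega(y)$, $x\in U$. The problem considered is $$-\Delta u+V_\omega(x)u=b(x)u|u|^{p-1}+g(x)\ \text{ in }U,\qquad u=0\ \text{ on }\partial U.$$ $G$ is the Green function of $-\Delta$ in $U$ with zero Dirichlet boundary condition, which satisfies $0\le G(x,y)\le\frac{1}{n\alpha_n(n-2)}|x-y|^{2-n}$ ($\alpha_n$ = volume of the unit ball of $\mathbb{R}^n$), and $H(\varphi)(x):=\int_U G(x,y)\varphi(y)\,dy$ for $\varphi\in L^\infty(U)$. An integral solution of the problem is a function $u\in L^\infty(U)$ satisfying $u=H(g)-H(V_\omega u)+H(bu|u|^{p-1})$. Set $\tau_\omega:=l_0\|f\|_\infty|\mu_\omega|$.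 Basic existence result: if $\varepsilon>0$ satisfies $0\le\tau_\omega<1$, $\frac{2^pK\varepsilon^{p-1}}{(1-\tau_\omega)^{p-1}}+\tau_\omega<1$ and $\|g\|_\infty\le\varepsilon/l_0$, then there is a unique integral solution $u_\omega$ with $\|u_\omega\|_\infty\le\frac{2\varepsilon}{1-\tau_\omega}$. The admissible set $\mathcal{A}$ for $X$ is the set of $\omega\in\Omega$ for which the problem has a unique solution $u(\cdot,\omega)$ given by this existence result with $\varepsilon=\varepsilon_0$, i.e. the set of $\omega$ for which its hypotheses hold with $\varepsilon=\varepsilon_0$; $u(\cdot,\omega)$ is then that unique solution. $\mathbb{E}_\Omega[Y]=\int_\Omega Y\,d\mathbb{P}$, understood as a Bochner integral when $Y$ is $L^\infty(U)$-valued. For a Banach space $\mathcal{X}$, $\mathcal{X}$-valued random variables $Y_k$ converge to $Y$ in probability if $\mathbb{P}(\|Y_k-Y\|_{\mathcal{X}}\ge\delta)\to0$ for every $\delta>0$. *)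

theory Defs
  imports "HOL-Probability.Probability"
begin

text \<open>
  Elements of $L^\infty(U)$ are given by representatives; two representatives are identified
  when they agree almost everywhere on \<open>U\<close>.
\<close>

definition Linf :: "'a::euclidean_space set \<Rightarrow> ('a \<Rightarrow> real) set" where
  "Linf U = {\<phi> \<in> borel_measurable (lebesgue_on U).
               esssup (lebesgue_on U) (\<lambda>x. ereal \<bar>\<phi> x\<bar>) < \<infinity>}"

definition Linf_norm :: "'a::euclidean_space set \<Rightarrow> ('a \<Rightarrow> real) \<Rightarrow> real" where
  "Linf_norm U \<phi> = real_of_ereal (esssup (lebesgue_on U) (\<lambda>x. ereal \<bar>\<phi> x\<bar>))"

text \<open>
  The library's Bochner integral is restricted to second countable spaces, which $L^\infty(U)$ is
  not. Hence the usual definition by simple functions that converge almost surely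
  (strong measurability) and in mean.
\<close>

definition has_Linf_bochner_integral ::
  "'w measure \<Rightarrow> 'a::euclidean_space set \<Rightarrow> ('w \<Rightarrow> 'a \<Rightarrow> real) \<Rightarrow> ('a \<Rightarrow> real) \<Rightarrow> bool" where
  "has_Linf_bochner_integral M U Y v \<longleftrightarrow> v \<in> Linf U \<and> (\<forall>\<omega>\<in>space M. Y \<omega> \<in> Linf U) \<and>
     (\<exists>s :: nat \<Rightarrow> 'w \<Rightarrow> 'a \<Rightarrow> real.
        (\<forall>i. simple_function M (s i) \<and> (\<forall>\<omega>\<in>space M. s i \<omega> \<in> Linf U)) \<and>
        (AE \<omega> in M. (\<lambda>i. Linf_norm U (\<lambda>x. Y \<omega> x - s i \<omega> x)) \<longlonglongrightarrow> 0) \<and>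
        (\<lambda>i. \<integral>\<^sup>+\<omega>. ennreal (Linf_norm U (\<lambda>x. Y \<omega> x - s i \<omega> x)) \<partial>M) \<longlonglongrightarrow> 0 \<and>
        (\<lambda>i. Linf_norm U (\<lambda>x. (\<Sum>\<phi>\<in>s i ` space M. measure M (s i -` {\<phi>} \<inter> space M) * \<phi> x) - v x))
          \<longlonglongrightarrow> 0)"

definition Linf_expectation ::
  "'w measure \<Rightarrow> 'a::euclidean_space set \<Rightarrow> ('w \<Rightarrow> 'a \<Rightarrow> real) \<Rightarrow> 'a \<Rightarrow> real" where
  "Linf_expectation M U Y = (SOME v. has_Linf_bochner_integral M U Y v)"

text \<open>
  Since \<^const>\<open>measure\<close> is \<open>0\<close> on non-measurable sets, measurability of the events in question is
  part of the definitions.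
\<close>

definition tendsto_in_prob ::
  "'w measure \<Rightarrow> (nat \<Rightarrow> 'w \<Rightarrow> real) \<Rightarrow> ('w \<Rightarrow> real) \<Rightarrow> bool" where
  "tendsto_in_prob M Y Z \<longleftrightarrow> (\<forall>\<delta>>0.
     (\<forall>k. {\<omega> \<in> space M. \<bar>Y k \<omega> - Z \<omega>\<bar> \<ge> \<delta>} \<in> sets M) \<and>
     (\<lambda>k. measure M {\<omega> \<in> space M. \<bar>Y k \<omega> - Z \<omega>\<bar> \<ge> \<delta>}) \<longlonglongrightarrow> 0)"

definition Linf_tendsto_in_prob ::
  "'w measure \<Rightarrow> 'a::euclidean_space set \<Rightarrow> (nat \<Rightarrow> 'w \<Rightarrow> 'a \<Rightarrow> real) \<Rightarrow> ('w \<Rightarrow> 'a \<Rightarrow> real) \<Rightarrow> bool" where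
  "Linf_tendsto_in_prob M U Y Z \<longleftrightarrow>
     (\<forall>\<omega>\<in>space M. (\<forall>k. Y k \<omega> \<in> Linf U) \<and> Z \<omega> \<in> Linf U) \<and>
     (\<forall>\<delta>>0.
       (\<forall>k. {\<omega> \<in> space M. Linf_norm U (\<lambda>x. Y k \<omega> x - Z \<omega> x) \<ge> \<delta>} \<in> sets M) \<and>
       (\<lambda>k. measure M {\<omega> \<in> space M. Linf_norm U (\<lambda>x. Y k \<omega> x - Z \<omega> x) \<ge> \<delta>}) \<longlonglongrightarrow> 0)"

definition borel_partitions :: "'a::topological_space set \<Rightarrow> 'a set set set" where
  "borel_partitions A = {P. finite P \<and> partition_on A P \<and> P \<subseteq> sets borel}"

definition total_variation :: "('a::topological_space set \<Rightarrow> real) \<Rightarrow> 'a set \<Rightarrow> real" where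
  "total_variation \<mu> A = (SUP P\<in>borel_partitions A. \<Sum>B\<in>P. \<bar>\<mu> B\<bar>)"

text \<open>
  A signed measure on \<open>U\<close> is a countably additive real set function on the Borel subsets of \<open>U\<close>;
  the convention that it vanishes on all other sets makes equality of signed measures equality
  of functions. The last clause is inner regularity.
\<close>

definition radon_measures :: "'a::topological_space set \<Rightarrow> ('a set \<Rightarrow> real) set" where
  "radon_measures U = {\<mu>.
     (\<forall>A. A \<notin> sets (restrict_space borel U) \<longrightarrow> \<mu> A = 0) \<and>
     (\<forall>A :: nat \<Rightarrow> 'a set. range A \<subseteq> sets (restrict_space borel U) \<and> disjoint_family A \<longrightarrow>
        (\<lambda>i. \<mu> (A i)) sums \<mu> (\<Union>i. A i)) \<and>
     bdd_above ((\<lambda>P. \<Sum>B\<in>P. \<bar>\<mu> B\<bar>) ` borel_partitions U) \<and>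
     (\<forall>A \<in> sets (restrict_space borel U). \<forall>e>0.
        \<exists>C. compact C \<and> C \<subseteq> A \<and> total_variation \<mu> (A - C) < e)}"

abbreviation tv_norm :: "'a::topological_space set \<Rightarrow> ('a set \<Rightarrow> real) \<Rightarrow> real" where
  "tv_norm U \<mu> \<equiv> total_variation \<mu> U"

abbreviation tv_dist ::
  "'a::topological_space set \<Rightarrow> ('a set \<Rightarrow> real) \<Rightarrow> ('a set \<Rightarrow> real) \<Rightarrow> real" where
  "tv_dist U \<mu> \<nu> \<equiv> tv_norm U (\<lambda>A. \<mu> A - \<nu> A)"

definition tv_open :: "'a::topological_space set \<Rightarrow> ('a set \<Rightarrow> real) set \<Rightarrow> bool" where
  "tv_open U \<O> \<longleftrightarrow> \<O> \<subseteq> radon_measures U \<and>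
     (\<forall>\<mu>\<in>\<O>. \<exists>r>0. \<forall>\<nu>\<in>radon_measures U. tv_dist U \<mu> \<nu> < r \<longrightarrow> \<nu> \<in> \<O>)"

definition radon_borel :: "'a::topological_space set \<Rightarrow> ('a set \<Rightarrow> real) measure" where
  "radon_borel U = sigma (radon_measures U) {\<O>. tv_open U \<O>}"

text \<open>Jordan decomposition: the positive and negative parts are $(|\mu|\pm\mu)/2$.\<close>

definition pos_part :: "'a::topological_space set \<Rightarrow> ('a set \<Rightarrow> real) \<Rightarrow> 'a measure" where
  "pos_part U \<mu> = measure_of U (sets (restrict_space borel U))
                    (\<lambda>A. ennreal ((total_variation \<mu> A + \<mu> A) / 2))"

definition neg_part :: "'a::topological_space set \<Rightarrow> ('a set \<Rightarrow> real) \<Rightarrow> 'a measure" where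
  "neg_part U \<mu> = measure_of U (sets (restrict_space borel U))
                    (\<lambda>A. ennreal ((total_variation \<mu> A - \<mu> A) / 2))"

definition signed_integral ::
  "'a::topological_space set \<Rightarrow> ('a set \<Rightarrow> real) \<Rightarrow> ('a \<Rightarrow> real) \<Rightarrow> real" where
  "signed_integral U \<mu> \<phi> = (\<integral>y. \<phi> y \<partial>pos_part U \<mu>) - (\<integral>y. \<phi> y \<partial>neg_part U \<mu>)"

text \<open>\<open>D\<close> is the gradient and \<open>D2\<close> the Hessian, so this says that \<open>h\<close> is $C^2$ with $\Delta h=0$.\<close>

definition harmonic_on :: "('a::euclidean_space \<Rightarrow> real) \<Rightarrow> 'a set \<Rightarrow> bool" where
  "harmonic_on h S \<longleftrightarrow> (\<exists>(D :: 'a \<Rightarrow> 'a) (D2 :: 'a \<Rightarrow> 'a \<Rightarrow> 'a).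
     (\<forall>x\<in>S. (h has_derivative (\<lambda>v. D x \<bullet> v)) (at x)) \<and>
     (\<forall>x\<in>S. (D has_derivative D2 x) (at x)) \<and>
     (\<forall>v. continuous_on S (\<lambda>x. D2 x v)) \<and>
     (\<forall>x\<in>S. (\<Sum>i\<in>Basis. D2 x i \<bullet> i) = 0))"

definition subharmonic_on :: "('a::euclidean_space \<Rightarrow> real) \<Rightarrow> 'a set \<Rightarrow> bool" where
  "subharmonic_on v S \<longleftrightarrow> continuous_on S v \<and>
     (\<forall>a r h. r > 0 \<and> cball a r \<subseteq> S \<and> continuous_on (cball a r) h \<and> harmonic_on h (ball a r) \<and>
        (\<forall>y\<in>sphere a r. v y \<le> h y) \<longrightarrow> (\<forall>y\<in>ball a r. v y \<le> h y))"

text \<open>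
  Perron solution of the Dirichlet problem $\Delta w=0$ in \<open>U\<close>, $w=\varphi$ on the boundary. For a
  general bounded domain, where some boundary points may be irregular, this is the standard
  meaning of the solution; it is the classical solution whenever there is one.
\<close>

definition perron_solution ::
  "'a::euclidean_space set \<Rightarrow> ('a \<Rightarrow> real) \<Rightarrow> 'a \<Rightarrow> real" where
  "perron_solution U \<phi> y = Sup {v y | v. continuous_on (closure U) v \<and> subharmonic_on v U \<and>
                                       (\<forall>z\<in>frontier U. v z \<le> \<phi> z)}"

definition fundamental_solution :: "'a::euclidean_space \<Rightarrow> real" where
  "fundamental_solution z =
     1 / (real DIM('a) * measure lborel (ball (0::'a) 1) * real (DIM('a) - 2))
       * (1 / norm z ^ (DIM('a) - 2))"

definition green :: "'a::euclidean_space set \<Rightarrow> 'a \<Rightarrow> 'a \<Rightarrow> real" where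
  "green U x y = fundamental_solution (x - y)
                   - perron_solution U (\<lambda>z. fundamental_solution (x - z)) y"

definition green_op :: "'a::euclidean_space set \<Rightarrow> ('a \<Rightarrow> real) \<Rightarrow> 'a \<Rightarrow> real" where
  "green_op U \<phi> x = (\<integral>y. green U x y * \<phi> y \<partial>lebesgue_on U)"

definition potential ::
  "'a::euclidean_space set \<Rightarrow> ('a \<Rightarrow>\<^sub>C real) \<Rightarrow> ('a set \<Rightarrow> real) \<Rightarrow> 'a \<Rightarrow> real" where
  "potential U f \<mu> x = signed_integral U \<mu> (\<lambda>y. apply_bcontfun f (x - y))"

definition integral_solution ::
  "'a::euclidean_space set \<Rightarrow> real \<Rightarrow> ('a \<Rightarrow>\<^sub>C real) \<Rightarrow> ('a \<Rightarrow> real) \<Rightarrow> ('a \<Rightarrow> real)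
     \<Rightarrow> ('a set \<Rightarrow> real) \<Rightarrow> ('a \<Rightarrow> real) \<Rightarrow> bool" where
  "integral_solution U p f b g \<mu> u \<longleftrightarrow> u \<in> Linf U \<and>
     (AE x in lebesgue_on U.
        u x = green_op U g x - green_op U (\<lambda>y. potential U f \<mu> y * u y) x
              + green_op U (\<lambda>y. b y * u y * \<bar>u y\<bar> powr (p - 1)) x)"

definition l0 :: "'a::euclidean_space set \<Rightarrow> real" where
  "l0 U = (diameter U)\<^sup>2 / (2 * (real DIM('a) - 2))"

definition tau :: "'a::euclidean_space set \<Rightarrow> ('a \<Rightarrow>\<^sub>C real) \<Rightarrow> ('a set \<Rightarrow> real) \<Rightarrow> real" where
  "tau U f \<mu> = l0 U * norm f * tv_norm U \<mu>"

definition Kconst :: "'a::euclidean_space set \<Rightarrow> real \<Rightarrow> ('a \<Rightarrow> real) \<Rightarrow> real" where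
  "Kconst U p b = l0 U * p * Linf_norm U b"

definition existence_conditions ::
  "'a::euclidean_space set \<Rightarrow> real \<Rightarrow> ('a \<Rightarrow>\<^sub>C real) \<Rightarrow> ('a \<Rightarrow> real) \<Rightarrow> ('a \<Rightarrow> real)
     \<Rightarrow> real \<Rightarrow> ('a set \<Rightarrow> real) \<Rightarrow> bool" where
  "existence_conditions U p f b g \<epsilon> \<mu> \<longleftrightarrow>
     \<epsilon> > 0 \<and> 0 \<le> tau U f \<mu> \<and> tau U f \<mu> < 1 \<and>
     2 powr p * Kconst U p b * \<epsilon> powr (p - 1) / (1 - tau U f \<mu>) powr (p - 1) + tau U f \<mu> < 1 \<and>
     Linf_norm U g \<le> \<epsilon> / l0 U"

definition admissible_set ::
  "'w measure \<Rightarrow> 'a::euclidean_space set \<Rightarrow> real \<Rightarrow> ('a \<Rightarrow>\<^sub>C real) \<Rightarrow> ('a \<Rightarrow> real) \<Rightarrow> ('a \<Rightarrow> real)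
     \<Rightarrow> real \<Rightarrow> ('w \<Rightarrow> 'a set \<Rightarrow> real) \<Rightarrow> 'w set" where
  "admissible_set M U p f b g \<epsilon> X = {\<omega> \<in> space M. existence_conditions U p f b g \<epsilon> (X \<omega>)}"

text \<open>
  Under the existence conditions there is, up to equality almost everywhere, exactly one \<open>u\<close>
  with this property.
\<close>

definition small_solution ::
  "'a::euclidean_space set \<Rightarrow> real \<Rightarrow> ('a \<Rightarrow>\<^sub>C real) \<Rightarrow> ('a \<Rightarrow> real) \<Rightarrow> ('a \<Rightarrow> real)
     \<Rightarrow> real \<Rightarrow> ('a set \<Rightarrow> real) \<Rightarrow> ('a \<Rightarrow> real) \<Rightarrow> bool" where
  "small_solution U p f b g \<epsilon> \<mu> u \<longleftrightarrow>
     integral_solution U p f b g \<mu> u \<and> Linf_norm U u \<le> 2 * \<epsilon> / (1 - tau U f \<mu>)"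

end

theory Submission
  imports Defs
begin

text \<open>
  Only the potentials of the measures matter. On the bounded set \<open>U\<close> they form a uniformly bounded,
  equicontinuous family, and the solution depends on the potential in a Lipschitz way: the choice
  of \<open>\<epsilon>0\<close> turns admissibility into \<open>tau < c0\<close>, so that the integral equation is a contraction
  uniformly in the measure. Hence every \<open>u j\<close> is a uniform limit of simple functions of \<open>\<omega>\<close>, and
  its Bochner integral exists.

  An almost sure limit of independent variables is almost surely constant. Applied to the values
  of the potentials on a countable dense set, this gives one \<open>\<omega>0\<close> such that
  \<open>u j \<omega> - u j \<omega>0\<close> tends to \<open>0\<close> in the norm of $L^\infty(U)$ for almost all \<open>\<omega>\<close>, and then in mean by
  boundedness. The averages in question are bounded by Cesaro means of these differences and of
  their expectations, so they tend to \<open>0\<close> in mean, hence in probability.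

  The contraction estimate needs the bounds $0\le G(x,y)\le\Gamma(x-y)$ for the Green function, where
  $\Gamma$ is the fundamental solution; they follow from a maximum principle for the functions
  competing in the Perron supremum.
\<close>

subsection \<open>The seminorm of $L^\infty$ and Bochner integrals\<close>

text \<open>Two of the spaces in play are nonseparable: L^infinity of \<open>U\<close>, and the
  measures under total variation. Strong measurability of \<open>u j\<close> can therefore not be
  read off from a Borel property. It comes from finitely many real numbers: the values of a
  potential on a finite net of \<open>U\<close> determine the potential, and hence the solution, up
  to a small error, and rounding these values produces the simple functions.

  With \<epsilon>0 inserted, the existence condition reads (1 - c0)^p / (1 - tau)^(p-1) < 1 - tau,
  which is (1 - c0)^p < (1 - tau)^p. All solutions are then bounded by R = 2 \<epsilon>0 / (1 - c0),
  a radius with K R^(p-1) = (1 - c0)/2, so the contraction constant is at most c0 + (1 - c0)/2 < 1.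

  Solutions are compared with \<open>u j \<omega>0\<close> and not with a solution for the limit
  measure: the reference may vary with \<open>j\<close>, so no limit equation has to be solved, and
  the expectation of \<open>u j\<close> differs from the reference by at most the mean
  deviation.\<close>

lemma Linf_measurable: "\<phi> \<in> Linf U \<Longrightarrow> \<phi> \<in> borel_measurable (lebesgue_on U)"
  by (simp add: Linf_def)

text \<open>The degenerate cases are harmless because \<open>real_of_ereal\<close> sends both
  infinite values to 0: the essential supremum is minus infinity on a null set \<open>U\<close> and
  plus infinity for a non-measurable function.\<close>

lemma Linf_norm_nonneg: "0 \<le> Linf_norm U \<phi>"
proof (cases "(\<lambda>x. ereal \<bar>\<phi> x\<bar>) \<in> borel_measurable (lebesgue_on U)")
  case True
  show ?thesis
  proof (cases "emeasure (lebesgue_on U) (space (lebesgue_on U)) = 0")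
    case True
    then show ?thesis
      using \<open>_ \<in> borel_measurable _\<close> by (simp add: Linf_norm_def esssup_zero_space)
  next
    case False
    have "esssup (lebesgue_on U) (\<lambda>x. 0) \<le> esssup (lebesgue_on U) (\<lambda>x. ereal \<bar>\<phi> x\<bar>)"
      by (rule esssup_mono) auto
    then show ?thesis
      using esssup_const[OF False, of "0::ereal"] by (simp add: Linf_norm_def real_of_ereal_pos)
  qed
next
  case False
  then show ?thesis
    by (simp add: Linf_norm_def esssup_non_measurable top_ereal_def)
qed

lemma Linf_AE_le:
  assumes "\<phi> \<in> Linf U"
  shows "AE x in lebesgue_on U. \<bar>\<phi> x\<bar> \<le> Linf_norm U \<phi>"
proof -
  have fin: "esssup (lebesgue_on U) (\<lambda>x. ereal \<bar>\<phi> x\<bar>) < \<infinity>"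
    using assms by (simp add: Linf_def)
  show ?thesis
    using esssup_AE[of "\<lambda>x. ereal \<bar>\<phi> x\<bar>" "lebesgue_on U"]
  proof eventually_elim
    case (elim x)
    then show ?case
      using fin unfolding Linf_norm_def
      by (cases "esssup (lebesgue_on U) (\<lambda>x. ereal \<bar>\<phi> x\<bar>)") simp_all
  qed
qed

lemma LinfI:
  assumes "\<phi> \<in> borel_measurable (lebesgue_on U)" "AE x in lebesgue_on U. \<bar>\<phi> x\<bar> \<le> C"
  shows "\<phi> \<in> Linf U"
proof -
  have "esssup (lebesgue_on U) (\<lambda>x. ereal \<bar>\<phi> x\<bar>) \<le> ereal C"
    using assms by (intro esssup_I) auto
  then show ?thesis
    using assms(1) by (auto simp: Linf_def)
qed

text \<open>The condition \<open>0 \<le> C\<close> matters for a null set \<open>U\<close>: there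
  the essential supremum is minus infinity, below every \<open>C\<close>, while the norm is
  0.\<close>

lemma Linf_norm_le:
  assumes "\<phi> \<in> borel_measurable (lebesgue_on U)" "AE x in lebesgue_on U. \<bar>\<phi> x\<bar> \<le> C" "0 \<le> C"
  shows "Linf_norm U \<phi> \<le> C"
proof -
  have "esssup (lebesgue_on U) (\<lambda>x. ereal \<bar>\<phi> x\<bar>) \<le> ereal C"
    using assms by (intro esssup_I) auto
  then show ?thesis
    using assms(3) unfolding Linf_norm_def
    by (cases "esssup (lebesgue_on U) (\<lambda>x. ereal \<bar>\<phi> x\<bar>)") simp_all
qed

lemma
  assumes "\<phi> \<in> Linf U" "\<psi> \<in> Linf U"
  shows Linf_add: "(\<lambda>x. \<phi> x + \<psi> x) \<in> Linf U"
    and Linf_norm_add: "Linf_norm U (\<lambda>x. \<phi> x + \<psi> x) \<le> Linf_norm U \<phi> + Linf_norm U \<psi>"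
proof -
  have m: "(\<lambda>x. \<phi> x + \<psi> x) \<in> borel_measurable (lebesgue_on U)"
    by (intro borel_measurable_add Linf_measurable assms)
  have ae: "AE x in lebesgue_on U. \<bar>\<phi> x + \<psi> x\<bar> \<le> Linf_norm U \<phi> + Linf_norm U \<psi>"
    using Linf_AE_le[OF assms(1)] Linf_AE_le[OF assms(2)] by eventually_elim auto
  show "(\<lambda>x. \<phi> x + \<psi> x) \<in> Linf U" by (rule LinfI[OF m ae])
  show "Linf_norm U (\<lambda>x. \<phi> x + \<psi> x) \<le> Linf_norm U \<phi> + Linf_norm U \<psi>"
    by (rule Linf_norm_le[OF m ae]) (simp add: Linf_norm_nonneg)
qed

lemma
  assumes "\<phi> \<in> Linf U"
  shows Linf_cmult: "(\<lambda>x. c * \<phi> x) \<in> Linf U"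
    and Linf_norm_cmult_le: "Linf_norm U (\<lambda>x. c * \<phi> x) \<le> \<bar>c\<bar> * Linf_norm U \<phi>"
proof -
  have m: "(\<lambda>x. c * \<phi> x) \<in> borel_measurable (lebesgue_on U)"
    by (intro borel_measurable_times borel_measurable_const Linf_measurable assms)
  have ae: "AE x in lebesgue_on U. \<bar>c * \<phi> x\<bar> \<le> \<bar>c\<bar> * Linf_norm U \<phi>"
    using Linf_AE_le[OF assms(1)] by eventually_elim (auto simp: abs_mult mult_left_mono)
  show "(\<lambda>x. c * \<phi> x) \<in> Linf U" by (rule LinfI[OF m ae])
  show "Linf_norm U (\<lambda>x. c * \<phi> x) \<le> \<bar>c\<bar> * Linf_norm U \<phi>"
    by (rule Linf_norm_le[OF m ae]) (simp add: Linf_norm_nonneg)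
qed

lemma Linf_diff: "\<phi> \<in> Linf U \<Longrightarrow> \<psi> \<in> Linf U \<Longrightarrow> (\<lambda>x. \<phi> x - \<psi> x) \<in> Linf U"
  using Linf_add[of \<phi> U "\<lambda>x. -1 * \<psi> x"] Linf_cmult[of \<psi> U "-1"] by simp

lemma Linf_norm_minus_commute: "Linf_norm U (\<lambda>x. \<phi> x - \<psi> x) = Linf_norm U (\<lambda>x. \<psi> x - \<phi> x)"
  by (simp add: Linf_norm_def abs_minus_commute)

lemma Linf_norm_triangle:
  assumes "\<phi> \<in> Linf U" "\<psi> \<in> Linf U" "\<eta> \<in> Linf U"
  shows "Linf_norm U (\<lambda>x. \<phi> x - \<eta> x) \<le> Linf_norm U (\<lambda>x. \<phi> x - \<psi> x) + Linf_norm U (\<lambda>x. \<psi> x - \<eta> x)"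
  using Linf_norm_add[OF Linf_diff[OF assms(1,2)] Linf_diff[OF assms(2,3)]] by simp

lemma Linf_norm_diff_abs:
  assumes "\<phi> \<in> Linf U" "\<psi> \<in> Linf U"
  shows "\<bar>Linf_norm U \<phi> - Linf_norm U \<psi>\<bar> \<le> Linf_norm U (\<lambda>x. \<phi> x - \<psi> x)"
  using Linf_norm_add[OF Linf_diff[OF assms] assms(2)]
    Linf_norm_add[OF Linf_diff[OF assms(2,1)] assms(1)]
  by (simp add: Linf_norm_minus_commute[of U \<psi> \<phi>])

lemma Linf_zero: "(\<lambda>x. 0) \<in> Linf U"
  by (rule LinfI[where C=0]) auto

lemma Linf_norm_zero: "Linf_norm U (\<lambda>x. 0) = 0"
  using Linf_norm_le[of "\<lambda>x. 0" U 0] Linf_norm_nonneg[of U "\<lambda>x. 0"] by simp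

lemma Linf_sum:
  "finite J \<Longrightarrow> (\<And>j. j \<in> J \<Longrightarrow> \<phi> j \<in> Linf U) \<Longrightarrow> (\<lambda>x. \<Sum>j\<in>J. \<phi> j x) \<in> Linf U"
  by (induction J rule: finite_induct) (auto intro: Linf_zero Linf_add)

lemma Linf_norm_sum_le:
  "finite J \<Longrightarrow> (\<And>j. j \<in> J \<Longrightarrow> \<phi> j \<in> Linf U) \<Longrightarrow>
    Linf_norm U (\<lambda>x. \<Sum>j\<in>J. \<phi> j x) \<le> (\<Sum>j\<in>J. Linf_norm U (\<phi> j))"
proof (induction J rule: finite_induct)
  case (insert j J)
  then show ?case
    using Linf_norm_add[of "\<phi> j" U "\<lambda>x. \<Sum>j\<in>J. \<phi> j x"] Linf_sum[of J \<phi> U] by fastforce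
qed (simp add: Linf_norm_zero)

text \<open>Countably many pairs \<open>i\<close>, \<open>k\<close> share one null set, outside
  which the representatives form a Cauchy sequence with explicit errors; letting \<open>k\<close>
  tend to infinity leaves the error \<open>e i\<close>. Where the sequence diverges,
  \<open>lim\<close> is some default value, which keeps \<open>v\<close> measurable and does not
  affect its class.\<close>

lemma Linf_complete:
  fixes \<phi> :: "nat \<Rightarrow> 'a::euclidean_space \<Rightarrow> real"
  assumes \<phi>: "\<And>i. \<phi> i \<in> Linf U" and e: "e \<longlonglongrightarrow> 0"
    and cauchy: "\<And>i k. Linf_norm U (\<lambda>x. \<phi> i x - \<phi> k x) \<le> e i + e k"
  obtains v where "v \<in> Linf U" "\<And>i. Linf_norm U (\<lambda>x. \<phi> i x - v x) \<le> e i"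
proof -
  define v where "v x = lim (\<lambda>i. \<phi> i x)" for x
  have e0: "0 \<le> e i" for i
    using cauchy[of i i] Linf_norm_nonneg[of U "\<lambda>x. \<phi> i x - \<phi> i x"] by simp
  have vm: "v \<in> borel_measurable (lebesgue_on U)"
    unfolding v_def using \<phi> by (intro borel_measurable_lim_metric Linf_measurable)
  have "AE x in lebesgue_on U. \<forall>i k. \<bar>\<phi> i x - \<phi> k x\<bar> \<le> e i + e k"
    unfolding AE_all_countable
  proof (intro allI)
    fix i k
    show "AE x in lebesgue_on U. \<bar>\<phi> i x - \<phi> k x\<bar> \<le> e i + e k"
      using Linf_AE_le[OF Linf_diff[OF \<phi>[of i] \<phi>[of k]]]
      by eventually_elim (use cauchy[of i k] in linarith)
  qed
  then have close: "AE x in lebesgue_on U. \<forall>i. \<bar>\<phi> i x - v x\<bar> \<le> e i"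
  proof eventually_elim
    case (elim x)
    have "Cauchy (\<lambda>i. \<phi> i x)"
    proof (rule metric_CauchyI)
      fix r :: real assume "0 < r"
      then have "eventually (\<lambda>i. e i < r/2) sequentially"
        by (intro order_tendstoD[OF e]) simp
      then obtain n where n: "\<And>i. i \<ge> n \<Longrightarrow> e i < r/2"
        by (auto simp: eventually_sequentially)
      show "\<exists>n. \<forall>i\<ge>n. \<forall>k\<ge>n. dist (\<phi> i x) (\<phi> k x) < r"
      proof (intro exI[of _ n] allI impI)
        fix i k assume "n \<le> i" "n \<le> k"
        then show "dist (\<phi> i x) (\<phi> k x) < r"
          using n[of i] n[of k] elim[rule_format, of i k] by (simp add: dist_real_def)
      qed
    qed
    then have lim: "(\<lambda>i. \<phi> i x) \<longlonglongrightarrow> v x"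
      unfolding v_def by (simp add: Cauchy_convergent_iff convergent_LIMSEQ_iff)
    show ?case
    proof
      fix i
      have "(\<lambda>k. \<bar>\<phi> i x - \<phi> k x\<bar>) \<longlonglongrightarrow> \<bar>\<phi> i x - v x\<bar>"
        by (intro tendsto_intros lim)
      moreover have "(\<lambda>k. e i + e k) \<longlonglongrightarrow> e i + 0"
        by (intro tendsto_intros e)
      ultimately show "\<bar>\<phi> i x - v x\<bar> \<le> e i"
        using LIMSEQ_le[of "\<lambda>k. \<bar>\<phi> i x - \<phi> k x\<bar>" _ "\<lambda>k. e i + e k" "e i + 0"] elim by auto
    qed
  qed
  have dm: "(\<lambda>x. \<phi> i x - v x) \<in> borel_measurable (lebesgue_on U)" for i
    by (intro borel_measurable_diff Linf_measurable \<phi> vm)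
  have dae: "AE x in lebesgue_on U. \<bar>\<phi> i x - v x\<bar> \<le> e i" for i
    using close by eventually_elim auto
  have "(\<lambda>x. \<phi> 0 x - v x) \<in> Linf U"
    by (rule LinfI[OF dm dae])
  from Linf_diff[OF \<phi>[of 0] this] have "v \<in> Linf U" by simp
  then show ?thesis
    using that Linf_norm_le[OF dm dae e0] by blast
qed

section \<open>Simple and uniformly approximable maps into L^infinity\<close>

definition Linf_simple :: "'w measure \<Rightarrow> 'a::euclidean_space set \<Rightarrow> ('w \<Rightarrow> 'a \<Rightarrow> real) \<Rightarrow> bool" where
  "Linf_simple M U s \<longleftrightarrow> simple_function M s \<and> (\<forall>\<omega>\<in>space M. s \<omega> \<in> Linf U)"

text \<open>
  Uniform approximability by simple functions, i.e. measurability with totally bounded range: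
  it stands in for strong measurability here.
\<close>

definition Linf_approximable :: "'w measure \<Rightarrow> 'a::euclidean_space set \<Rightarrow> ('w \<Rightarrow> 'a \<Rightarrow> real) \<Rightarrow> bool" where
  "Linf_approximable M U Y \<longleftrightarrow> (\<forall>\<omega>\<in>space M. Y \<omega> \<in> Linf U) \<and>
     (\<forall>e>0. \<exists>s. Linf_simple M U s \<and> (\<forall>\<omega>\<in>space M. Linf_norm U (\<lambda>x. Y \<omega> x - s \<omega> x) \<le> e))"

lemma Linf_simple_approximable: "Linf_simple M U s \<Longrightarrow> Linf_approximable M U s"
  unfolding Linf_approximable_def
  by (auto simp: Linf_simple_def Linf_norm_zero intro!: exI[of _ s])

lemma Linf_approximable_const: "c \<in> Linf U \<Longrightarrow> Linf_approximable M U (\<lambda>\<omega>. c)"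
  by (rule Linf_simple_approximable) (simp add: Linf_simple_def)

lemma Linf_approximable_add:
  assumes "Linf_approximable M U Y" "Linf_approximable M U Z"
  shows "Linf_approximable M U (\<lambda>\<omega> x. Y \<omega> x + Z \<omega> x)"
  unfolding Linf_approximable_def
proof (intro conjI ballI allI impI)
  show "(\<lambda>x. Y \<omega> x + Z \<omega> x) \<in> Linf U" if "\<omega> \<in> space M" for \<omega>
    using that assms by (auto simp: Linf_approximable_def intro: Linf_add)
  fix e :: real assume "0 < e"
  then obtain s t where s: "Linf_simple M U s" "\<And>\<omega>. \<omega> \<in> space M \<Longrightarrow> Linf_norm U (\<lambda>x. Y \<omega> x - s \<omega> x) \<le> e/2"
    and t: "Linf_simple M U t" "\<And>\<omega>. \<omega> \<in> space M \<Longrightarrow> Linf_norm U (\<lambda>x. Z \<omega> x - t \<omega> x) \<le> e/2"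
    using assms unfolding Linf_approximable_def by (meson half_gt_zero)
  show "\<exists>s. Linf_simple M U s \<and> (\<forall>\<omega>\<in>space M. Linf_norm U (\<lambda>x. (Y \<omega> x + Z \<omega> x) - s \<omega> x) \<le> e)"
  proof (intro exI[of _ "\<lambda>\<omega> x. s \<omega> x + t \<omega> x"] conjI ballI)
    show "Linf_simple M U (\<lambda>\<omega> x. s \<omega> x + t \<omega> x)"
      using s(1) t(1) unfolding Linf_simple_def
      by (auto intro: Linf_add simple_function_compose2[of M s t "\<lambda>a b x. a x + b x"])
    fix \<omega> assume w: "\<omega> \<in> space M"
    have "Linf_norm U (\<lambda>x. (Y \<omega> x - s \<omega> x) + (Z \<omega> x - t \<omega> x))
        \<le> Linf_norm U (\<lambda>x. Y \<omega> x - s \<omega> x) + Linf_norm U (\<lambda>x. Z \<omega> x - t \<omega> x)"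
      using assms w s(1) t(1)
      by (intro Linf_norm_add Linf_diff) (auto simp: Linf_approximable_def Linf_simple_def)
    also have "\<dots> \<le> e" using s(2)[OF w] t(2)[OF w] by simp
    finally show "Linf_norm U (\<lambda>x. (Y \<omega> x + Z \<omega> x) - (s \<omega> x + t \<omega> x)) \<le> e"
      by (simp add: algebra_simps)
  qed
qed

lemma Linf_approximable_cmult:
  assumes "Linf_approximable M U Y"
  shows "Linf_approximable M U (\<lambda>\<omega> x. c * Y \<omega> x)"
  unfolding Linf_approximable_def
proof (intro conjI ballI allI impI)
  show "(\<lambda>x. c * Y \<omega> x) \<in> Linf U" if "\<omega> \<in> space M" for \<omega>
    using that assms by (auto simp: Linf_approximable_def intro: Linf_cmult)
  fix e :: real assume "0 < e"
  then have "0 < e / (\<bar>c\<bar> + 1)" by simp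
  then obtain s where s: "Linf_simple M U s"
      "\<And>\<omega>. \<omega> \<in> space M \<Longrightarrow> Linf_norm U (\<lambda>x. Y \<omega> x - s \<omega> x) \<le> e / (\<bar>c\<bar> + 1)"
    using assms unfolding Linf_approximable_def by blast
  show "\<exists>s. Linf_simple M U s \<and> (\<forall>\<omega>\<in>space M. Linf_norm U (\<lambda>x. c * Y \<omega> x - s \<omega> x) \<le> e)"
  proof (intro exI[of _ "\<lambda>\<omega> x. c * s \<omega> x"] conjI ballI)
    show "Linf_simple M U (\<lambda>\<omega> x. c * s \<omega> x)"
      using s(1) unfolding Linf_simple_def
      by (auto intro: Linf_cmult simple_function_compose1[of M s "\<lambda>a x. c * a x"])
    fix \<omega> assume w: "\<omega> \<in> space M"
    have "Linf_norm U (\<lambda>x. c * (Y \<omega> x - s \<omega> x)) \<le> \<bar>c\<bar> * Linf_norm U (\<lambda>x. Y \<omega> x - s \<omega> x)"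
      using assms w s(1)
      by (intro Linf_norm_cmult_le Linf_diff) (auto simp: Linf_approximable_def Linf_simple_def)
    also have "\<dots> \<le> (\<bar>c\<bar> + 1) * (e / (\<bar>c\<bar> + 1))"
      using s(2)[OF w] by (intro mult_mono) (auto simp: Linf_norm_nonneg)
    also have "\<dots> = e" by simp
    finally show "Linf_norm U (\<lambda>x. c * Y \<omega> x - c * s \<omega> x) \<le> e"
      by (simp add: algebra_simps)
  qed
qed

lemma Linf_approximable_diff:
  assumes "Linf_approximable M U Y" "Linf_approximable M U Z"
  shows "Linf_approximable M U (\<lambda>\<omega> x. Y \<omega> x - Z \<omega> x)"
  using Linf_approximable_add[OF assms(1) Linf_approximable_cmult[OF assms(2), of "-1"]] by simp

lemma Linf_approximable_sum:
  "finite J \<Longrightarrow> (\<And>j. j \<in> J \<Longrightarrow> Linf_approximable M U (Y j)) \<Longrightarrow>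
    Linf_approximable M U (\<lambda>\<omega> x. \<Sum>j\<in>J. Y j \<omega> x)"
  by (induction J rule: finite_induct)
    (auto intro: Linf_approximable_const Linf_zero Linf_approximable_add)

lemma Linf_approximable_sequence:
  assumes "Linf_approximable M U Y"
  obtains s where "\<And>i. Linf_simple M U (s i)"
    "\<And>i \<omega>. \<omega> \<in> space M \<Longrightarrow> Linf_norm U (\<lambda>x. Y \<omega> x - s i \<omega> x) \<le> 1 / real (Suc i)"
proof -
  have "\<forall>i. \<exists>s. Linf_simple M U s \<and> (\<forall>\<omega>\<in>space M. Linf_norm U (\<lambda>x. Y \<omega> x - s \<omega> x) \<le> 1 / real (Suc i))"
    using assms unfolding Linf_approximable_def by simp
  then show ?thesis using that by metis
qed

text \<open>The norm is 1-Lipschitz, so the norms of the simple approximants converge to the norm of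
  \<open>Y\<close>, and each of them is a real simple function.\<close>

lemma Linf_approximable_norm_measurable:
  assumes "Linf_approximable M U Y"
  shows "(\<lambda>\<omega>. Linf_norm U (Y \<omega>)) \<in> borel_measurable M"
proof -
  obtain s where s: "\<And>i. Linf_simple M U (s i)"
    "\<And>i \<omega>. \<omega> \<in> space M \<Longrightarrow> Linf_norm U (\<lambda>x. Y \<omega> x - s i \<omega> x) \<le> 1 / real (Suc i)"
    by (rule Linf_approximable_sequence[OF assms]) blast
  show ?thesis
  proof (rule borel_measurable_LIMSEQ_real)
    show "(\<lambda>\<omega>. Linf_norm U (s i \<omega>)) \<in> borel_measurable M" for i
      using s(1)[of i] unfolding Linf_simple_def
      by (intro borel_measurable_simple_function simple_function_compose1[of M "s i" "Linf_norm U"]) auto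
    fix \<omega> assume w: "\<omega> \<in> space M"
    have "\<bar>Linf_norm U (s i \<omega>) - Linf_norm U (Y \<omega>)\<bar> \<le> 1 / real (Suc i)" for i
      using Linf_norm_diff_abs[of "Y \<omega>" U "s i \<omega>"] s(1)[of i] s(2)[OF w, of i] w assms
      by (force simp: Linf_simple_def Linf_approximable_def abs_minus_commute)
    then have "(\<lambda>i. Linf_norm U (s i \<omega>) - Linf_norm U (Y \<omega>)) \<longlonglongrightarrow> 0"
      by (intro Lim_null_comparison[OF always_eventually LIMSEQ_Suc[OF lim_1_over_n]]) auto
    then show "(\<lambda>i. Linf_norm U (s i \<omega>)) \<longlonglongrightarrow> Linf_norm U (Y \<omega>)"
      by (simp add: LIM_zero_iff)
  qed
qed

lemma Linf_approximable_norm_bounded: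
  assumes "Linf_approximable M U Y"
  obtains B where "\<And>\<omega>. \<omega> \<in> space M \<Longrightarrow> Linf_norm U (Y \<omega>) \<le> B"
proof -
  obtain s where s: "Linf_simple M U s" "\<And>\<omega>. \<omega> \<in> space M \<Longrightarrow> Linf_norm U (\<lambda>x. Y \<omega> x - s \<omega> x) \<le> 1"
    using assms zero_less_one unfolding Linf_approximable_def by blast
  have fin: "finite ((\<lambda>\<omega>. Linf_norm U (s \<omega>)) ` space M)"
    using s(1) by (metis Linf_simple_def simple_functionD(1) finite_imageI image_image)
  show ?thesis
  proof (rule that)
    fix \<omega> assume w: "\<omega> \<in> space M"
    have "Linf_norm U (Y \<omega>) \<le> Linf_norm U (s \<omega>) + 1"
      using Linf_norm_diff_abs[of "Y \<omega>" U "s \<omega>"] s(1) s(2)[OF w] w assms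
      by (force simp: Linf_simple_def Linf_approximable_def)
    also have "\<dots> \<le> Max ((\<lambda>\<omega>. Linf_norm U (s \<omega>)) ` space M) + 1"
      using fin w by simp
    finally show "Linf_norm U (Y \<omega>) \<le> Max ((\<lambda>\<omega>. Linf_norm U (s \<omega>)) ` space M) + 1" .
  qed
qed

lemma (in finite_measure) Linf_approximable_norm_integrable:
  assumes "Linf_approximable M U Y"
  shows "integrable M (\<lambda>\<omega>. Linf_norm U (Y \<omega>))"
proof -
  obtain B where "\<And>\<omega>. \<omega> \<in> space M \<Longrightarrow> Linf_norm U (Y \<omega>) \<le> B"
    using Linf_approximable_norm_bounded[OF assms] by blast
  then show ?thesis
    using Linf_approximable_norm_measurable[OF assms]
    by (intro integrable_const_bound[where B=B]) (auto simp: Linf_norm_nonneg)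
qed

section \<open>Bochner integrals of simple and of approximable maps\<close>

context finite_measure
begin

text \<open>The finite sum in the definition of the Bochner integral is the integral over \<omega>
  at each fixed \<open>x\<close>. Linearity and estimates for simple functions thereby reduce to
  real integrals with \<open>x\<close> as a parameter.\<close>

lemma
  fixes s :: "'a \<Rightarrow> 'b \<Rightarrow> real"
  assumes "simple_function M s"
  shows simple_function_pointwise_integrable: "integrable M (\<lambda>\<omega>. s \<omega> x)"
    and simple_function_pointwise_integral:
      "(\<integral>\<omega>. s \<omega> x \<partial>M) = (\<Sum>\<phi>\<in>s ` space M. measure M (s -` {\<phi>} \<inter> space M) * \<phi> x)"
proof -
  have fin: "finite (s ` space M)" and m: "\<And>\<phi>. s -` {\<phi>} \<inter> space M \<in> sets M"
    using assms by (auto intro: simple_functionD)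
  have eq: "s \<omega> x = (\<Sum>\<phi>\<in>s ` space M. indicat_real (s -` {\<phi>} \<inter> space M) \<omega> * \<phi> x)"
    if "\<omega> \<in> space M" for \<omega>
  proof -
    have "(\<Sum>\<phi>\<in>s ` space M. indicat_real (s -` {\<phi>} \<inter> space M) \<omega> * \<phi> x)
        = (\<Sum>\<phi>\<in>s ` space M. if \<phi> = s \<omega> then \<phi> x else 0)"
      using that by (intro sum.cong) auto
    then show ?thesis using that fin by simp
  qed
  have int: "integrable M (\<lambda>\<omega>. indicat_real (s -` {\<phi>} \<inter> space M) \<omega> * \<phi> x)" for \<phi>
    using m[of \<phi>] by (intro integrable_mult_left) (auto simp: less_top[symmetric])
  show "integrable M (\<lambda>\<omega>. s \<omega> x)"
    using eq int by (subst Bochner_Integration.integrable_cong[OF refl eq]) auto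
  show "(\<integral>\<omega>. s \<omega> x \<partial>M) = (\<Sum>\<phi>\<in>s ` space M. measure M (s -` {\<phi>} \<inter> space M) * \<phi> x)"
  proof (subst Bochner_Integration.integral_cong[OF refl eq])
    show "(\<integral>\<omega>. (\<Sum>\<phi>\<in>s ` space M. indicat_real (s -` {\<phi>} \<inter> space M) \<omega> * \<phi> x) \<partial>M)
        = (\<Sum>\<phi>\<in>s ` space M. measure M (s -` {\<phi>} \<inter> space M) * \<phi> x)"
      using m by (subst Bochner_Integration.integral_sum[OF int]) simp
  qed
qed

text \<open>A simple function takes finitely many values, so one null set of \<open>x\<close> serves
  for all \<omega> at once when \<open>s \<omega> x\<close> is bounded by the norm of
  \<open>s \<omega>\<close>. Uncountably many values could produce uncountably many null sets, which
  confines the argument to simple functions.\<close>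

lemma
  fixes s :: "'a \<Rightarrow> 'b::euclidean_space \<Rightarrow> real"
  assumes s: "Linf_simple M U s"
  shows Linf_simple_integral_in: "(\<lambda>x. \<integral>\<omega>. s \<omega> x \<partial>M) \<in> Linf U"
    and Linf_simple_integral_norm:
      "Linf_norm U (\<lambda>x. \<integral>\<omega>. s \<omega> x \<partial>M) \<le> (\<integral>\<omega>. Linf_norm U (s \<omega>) \<partial>M)"
proof -
  have sf: "simple_function M s" and sU: "\<And>\<omega>. \<omega> \<in> space M \<Longrightarrow> s \<omega> \<in> Linf U"
    using s by (auto simp: Linf_simple_def)
  note int = Linf_approximable_norm_integrable[OF Linf_simple_approximable[OF s]]
  have "(\<lambda>x. \<Sum>\<phi>\<in>s ` space M. measure M (s -` {\<phi>} \<inter> space M) * \<phi> x) \<in> Linf U"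
    using sU simple_functionD(1)[OF sf] by (intro Linf_sum Linf_cmult) auto
  then show in_Linf: "(\<lambda>x. \<integral>\<omega>. s \<omega> x \<partial>M) \<in> Linf U"
    by (simp add: simple_function_pointwise_integral[OF sf])
  have "AE x in lebesgue_on U. \<forall>\<phi>\<in>s ` space M. \<bar>\<phi> x\<bar> \<le> Linf_norm U \<phi>"
    using sU simple_functionD(1)[OF sf] by (intro AE_finite_allI Linf_AE_le) auto
  then have "AE x in lebesgue_on U. \<bar>\<integral>\<omega>. s \<omega> x \<partial>M\<bar> \<le> (\<integral>\<omega>. Linf_norm U (s \<omega>) \<partial>M)"
  proof eventually_elim
    case (elim x)
    then have "(\<integral>\<omega>. \<bar>s \<omega> x\<bar> \<partial>M) \<le> (\<integral>\<omega>. Linf_norm U (s \<omega>) \<partial>M)"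
      using simple_function_pointwise_integrable[OF sf, of x] int
      by (intro integral_mono) auto
    then show ?case
      using integral_abs_bound[of M "\<lambda>\<omega>. s \<omega> x"] by linarith
  qed
  then show "Linf_norm U (\<lambda>x. \<integral>\<omega>. s \<omega> x \<partial>M) \<le> (\<integral>\<omega>. Linf_norm U (s \<omega>) \<partial>M)"
    using in_Linf by (intro Linf_norm_le) (auto intro: Linf_measurable simp: Linf_norm_nonneg)
qed

lemma Linf_simple_diff:
  "Linf_simple M U s \<Longrightarrow> Linf_simple M U t \<Longrightarrow> Linf_simple M U (\<lambda>\<omega> x. s \<omega> x - t \<omega> x)"
  unfolding Linf_simple_def
  by (auto intro: Linf_diff simple_function_compose2[of M s t "\<lambda>a b x. a x - b x"])

end

text \<open>Approximants with uniform error 1/(i+1) have integrals whose distance is at most the sum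
  of the two errors, which is the form of Cauchy condition that \<open>Linf_complete\<close>
  expects.\<close>

lemma (in prob_space) has_Linf_bochner_integral_exists:
  assumes Y: "Linf_approximable M U Y"
  shows "\<exists>v. has_Linf_bochner_integral M U Y v"
proof -
  obtain s where s: "\<And>i. Linf_simple M U (s i)"
    and close: "\<And>i \<omega>. \<omega> \<in> space M \<Longrightarrow> Linf_norm U (\<lambda>x. Y \<omega> x - s i \<omega> x) \<le> 1 / real (Suc i)"
    by (rule Linf_approximable_sequence[OF Y]) blast
  have sf: "simple_function M (s i)" for i
    using s by (auto simp: Linf_simple_def)
  have YU: "Y \<omega> \<in> Linf U" if "\<omega> \<in> space M" for \<omega>
    using Y that by (auto simp: Linf_approximable_def)
  have sU: "s i \<omega> \<in> Linf U" if "\<omega> \<in> space M" for i \<omega>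
    using s that by (auto simp: Linf_simple_def)
  have "Linf_norm U (\<lambda>x. (\<integral>\<omega>. s i \<omega> x \<partial>M) - (\<integral>\<omega>. s k \<omega> x \<partial>M)) \<le> 1 / real (Suc i) + 1 / real (Suc k)"
    for i k
  proof -
    have "Linf_norm U (\<lambda>x. \<integral>\<omega>. s i \<omega> x - s k \<omega> x \<partial>M)
        \<le> (\<integral>\<omega>. Linf_norm U (\<lambda>x. s i \<omega> x - s k \<omega> x) \<partial>M)"
      by (intro Linf_simple_integral_norm Linf_simple_diff s)
    also have "\<dots> \<le> (\<integral>\<omega>. 1 / real (Suc i) + 1 / real (Suc k) \<partial>M)"
    proof (rule integral_mono)
      show "integrable M (\<lambda>\<omega>. Linf_norm U (\<lambda>x. s i \<omega> x - s k \<omega> x))"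
        by (intro Linf_approximable_norm_integrable Linf_simple_approximable Linf_simple_diff s)
      fix \<omega> assume w: "\<omega> \<in> space M"
      show "Linf_norm U (\<lambda>x. s i \<omega> x - s k \<omega> x) \<le> 1 / real (Suc i) + 1 / real (Suc k)"
        using Linf_norm_triangle[OF sU[OF w, of i] YU[OF w] sU[OF w, of k]]
          close[OF w, of i] close[OF w, of k] Linf_norm_minus_commute[of U "s i \<omega>" "Y \<omega>"]
        by linarith
    qed simp
    finally show ?thesis
      using simple_function_pointwise_integrable[OF sf] by (simp add: prob_space)
  qed
  from Linf_complete[OF _ LIMSEQ_Suc[OF lim_1_over_n] this] Linf_simple_integral_in[OF s]
  obtain v where v: "v \<in> Linf U"
    "\<And>i. Linf_norm U (\<lambda>x. (\<integral>\<omega>. s i \<omega> x \<partial>M) - v x) \<le> 1 / real (Suc i)"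
    by metis
  have "has_Linf_bochner_integral M U Y v"
    unfolding has_Linf_bochner_integral_def
  proof (intro conjI ballI exI[of _ s] allI)
    show "v \<in> Linf U" "\<And>\<omega>. \<omega> \<in> space M \<Longrightarrow> Y \<omega> \<in> Linf U" by fact+
    show "simple_function M (s i)" "\<And>\<omega>. \<omega> \<in> space M \<Longrightarrow> s i \<omega> \<in> Linf U" for i by fact+
    show "AE \<omega> in M. (\<lambda>i. Linf_norm U (\<lambda>x. Y \<omega> x - s i \<omega> x)) \<longlonglongrightarrow> 0"
    proof (rule AE_I2)
      fix \<omega> assume "\<omega> \<in> space M"
      then show "(\<lambda>i. Linf_norm U (\<lambda>x. Y \<omega> x - s i \<omega> x)) \<longlonglongrightarrow> 0"
        by (intro Lim_null_comparison[OF always_eventually LIMSEQ_Suc[OF lim_1_over_n]])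
          (use close in \<open>auto simp: Linf_norm_nonneg\<close>)
    qed
    show "(\<lambda>i. \<integral>\<^sup>+\<omega>. ennreal (Linf_norm U (\<lambda>x. Y \<omega> x - s i \<omega> x)) \<partial>M) \<longlonglongrightarrow> 0"
    proof (rule tendsto_sandwich[OF always_eventually always_eventually tendsto_const])
      show "\<forall>i. (\<integral>\<^sup>+\<omega>. ennreal (Linf_norm U (\<lambda>x. Y \<omega> x - s i \<omega> x)) \<partial>M) \<le> ennreal (1 / real (Suc i))"
      proof
        fix i
        have "(\<integral>\<^sup>+\<omega>. ennreal (Linf_norm U (\<lambda>x. Y \<omega> x - s i \<omega> x)) \<partial>M) \<le> (\<integral>\<^sup>+\<omega>. ennreal (1 / real (Suc i)) \<partial>M)"
          using close by (intro nn_integral_mono ennreal_leI) auto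
        then show "(\<integral>\<^sup>+\<omega>. ennreal (Linf_norm U (\<lambda>x. Y \<omega> x - s i \<omega> x)) \<partial>M) \<le> ennreal (1 / real (Suc i))"
          by (simp add: emeasure_space_1)
      qed
      show "(\<lambda>i. ennreal (1 / real (Suc i))) \<longlonglongrightarrow> 0"
        using tendsto_ennrealI[OF LIMSEQ_Suc[OF lim_1_over_n]] by simp
    qed simp
    show "(\<lambda>i. Linf_norm U (\<lambda>x. (\<Sum>\<phi>\<in>s i ` space M. measure M (s i -` {\<phi>} \<inter> space M) * \<phi> x) - v x)) \<longlonglongrightarrow> 0"
      unfolding simple_function_pointwise_integral[OF sf, symmetric]
      by (intro Lim_null_comparison[OF always_eventually LIMSEQ_Suc[OF lim_1_over_n]])
        (use v(2) in \<open>auto simp: Linf_norm_nonneg\<close>)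
  qed
  then show ?thesis by blast
qed

text \<open>The bound holds for every \<open>v\<close> with the defining property, hence for the one
  picked by \<open>SOME\<close>; the approximants are therefore those of the definition, which
  converge in mean and not uniformly. It is the only estimate on the expectation that the theorem
  uses.\<close>

lemma (in prob_space) Linf_bochner_integral_norm_diff:
  assumes Y: "Linf_approximable M U Y" and v: "has_Linf_bochner_integral M U Y v" and c: "c \<in> Linf U"
  shows "Linf_norm U (\<lambda>x. v x - c x) \<le> (\<integral>\<omega>. Linf_norm U (\<lambda>x. Y \<omega> x - c x) \<partial>M)"
proof -
  obtain s where vU: "v \<in> Linf U" and s: "\<And>i. Linf_simple M U (s i)"
    and lim: "(\<lambda>i. \<integral>\<^sup>+\<omega>. ennreal (Linf_norm U (\<lambda>x. Y \<omega> x - s i \<omega> x)) \<partial>M) \<longlonglongrightarrow> 0"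
    and limv: "(\<lambda>i. Linf_norm U (\<lambda>x. (\<Sum>\<phi>\<in>s i ` space M. measure M (s i -` {\<phi>} \<inter> space M) * \<phi> x) - v x)) \<longlonglongrightarrow> 0"
    using v unfolding has_Linf_bochner_integral_def Linf_simple_def by blast
  have sf: "simple_function M (s i)" for i
    using s by (auto simp: Linf_simple_def)
  have sU: "s i \<omega> \<in> Linf U" if "\<omega> \<in> space M" for i \<omega>
    using s that by (auto simp: Linf_simple_def)
  have YU: "Y \<omega> \<in> Linf U" if "\<omega> \<in> space M" for \<omega>
    using Y that by (auto simp: Linf_approximable_def)
  have intd: "integrable M (\<lambda>\<omega>. Linf_norm U (\<lambda>x. Y \<omega> x - s i \<omega> x))" for i
    by (intro Linf_approximable_norm_integrable Linf_approximable_diff Y Linf_simple_approximable s)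
  have intc: "integrable M (\<lambda>\<omega>. Linf_norm U (\<lambda>x. Y \<omega> x - c x))"
    by (intro Linf_approximable_norm_integrable Linf_approximable_diff Y Linf_approximable_const c)
  have "(\<lambda>i. ennreal (\<integral>\<omega>. Linf_norm U (\<lambda>x. Y \<omega> x - s i \<omega> x) \<partial>M)) \<longlonglongrightarrow> ennreal 0"
    using lim intd by (simp add: nn_integral_eq_integral Linf_norm_nonneg)
  then have lim': "(\<lambda>i. \<integral>\<omega>. Linf_norm U (\<lambda>x. Y \<omega> x - s i \<omega> x) \<partial>M) \<longlonglongrightarrow> 0"
    by (subst (asm) tendsto_ennreal_iff) (auto intro!: always_eventually integral_nonneg simp: Linf_norm_nonneg)
  have limv': "(\<lambda>i. Linf_norm U (\<lambda>x. (\<integral>\<omega>. s i \<omega> x \<partial>M) - v x)) \<longlonglongrightarrow> 0"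
    using limv by (simp add: simple_function_pointwise_integral[OF sf])
  have bound: "Linf_norm U (\<lambda>x. v x - c x) \<le> Linf_norm U (\<lambda>x. (\<integral>\<omega>. s i \<omega> x \<partial>M) - v x)
      + ((\<integral>\<omega>. Linf_norm U (\<lambda>x. Y \<omega> x - s i \<omega> x) \<partial>M) + (\<integral>\<omega>. Linf_norm U (\<lambda>x. Y \<omega> x - c x) \<partial>M))" for i
  proof -
    have sc: "Linf_simple M U (\<lambda>\<omega> x. s i \<omega> x - c x)"
      by (intro Linf_simple_diff s) (simp add: Linf_simple_def c)
    have "Linf_norm U (\<lambda>x. (\<integral>\<omega>. s i \<omega> x \<partial>M) - c x) = Linf_norm U (\<lambda>x. \<integral>\<omega>. s i \<omega> x - c x \<partial>M)"
      using simple_function_pointwise_integrable[OF sf] by (simp add: prob_space)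
    also have "\<dots> \<le> (\<integral>\<omega>. Linf_norm U (\<lambda>x. s i \<omega> x - c x) \<partial>M)"
      by (rule Linf_simple_integral_norm[OF sc])
    also have "\<dots> \<le> (\<integral>\<omega>. Linf_norm U (\<lambda>x. Y \<omega> x - s i \<omega> x) + Linf_norm U (\<lambda>x. Y \<omega> x - c x) \<partial>M)"
    proof (rule integral_mono)
      show "integrable M (\<lambda>\<omega>. Linf_norm U (\<lambda>x. s i \<omega> x - c x))"
        by (intro Linf_approximable_norm_integrable Linf_simple_approximable sc)
      fix \<omega> assume w: "\<omega> \<in> space M"
      show "Linf_norm U (\<lambda>x. s i \<omega> x - c x) \<le> Linf_norm U (\<lambda>x. Y \<omega> x - s i \<omega> x) + Linf_norm U (\<lambda>x. Y \<omega> x - c x)"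
        using Linf_norm_triangle[OF sU[OF w] YU[OF w] c] Linf_norm_minus_commute[of U "s i \<omega>" "Y \<omega>"]
        by metis
    qed (intro Bochner_Integration.integrable_add intd intc)
    also have "\<dots> = (\<integral>\<omega>. Linf_norm U (\<lambda>x. Y \<omega> x - s i \<omega> x) \<partial>M) + (\<integral>\<omega>. Linf_norm U (\<lambda>x. Y \<omega> x - c x) \<partial>M)"
      by (intro Bochner_Integration.integral_add intd intc)
    finally show ?thesis
      using Linf_norm_triangle[OF vU Linf_simple_integral_in[OF s[of i]] c]
        Linf_norm_minus_commute[of U v "\<lambda>x. \<integral>\<omega>. s i \<omega> x \<partial>M"] by linarith
  qed
  have "(\<lambda>i. Linf_norm U (\<lambda>x. (\<integral>\<omega>. s i \<omega> x \<partial>M) - v x)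
      + ((\<integral>\<omega>. Linf_norm U (\<lambda>x. Y \<omega> x - s i \<omega> x) \<partial>M) + (\<integral>\<omega>. Linf_norm U (\<lambda>x. Y \<omega> x - c x) \<partial>M)))
      \<longlonglongrightarrow> 0 + (0 + (\<integral>\<omega>. Linf_norm U (\<lambda>x. Y \<omega> x - c x) \<partial>M))"
    by (intro tendsto_intros lim' limv')
  from LIMSEQ_le_const[OF this] bound show ?thesis by auto
qed

lemma (in prob_space)
  assumes "Linf_approximable M U Y"
  shows has_Linf_expectation: "has_Linf_bochner_integral M U Y (Linf_expectation M U Y)"
    and Linf_expectation_in: "Linf_expectation M U Y \<in> Linf U"
proof -
  show *: "has_Linf_bochner_integral M U Y (Linf_expectation M U Y)"
    unfolding Linf_expectation_def
    by (rule someI_ex[OF has_Linf_bochner_integral_exists[OF assms]])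
  then show "Linf_expectation M U Y \<in> Linf U"
    by (simp add: has_Linf_bochner_integral_def)
qed

subsection \<open>Signed measures and potentials\<close>

lemma sets_restrict_borel_open:
  assumes "open U"
  shows "sets (restrict_space borel U) = {A \<in> sets borel. A \<subseteq> U}"
  using assms by (auto simp: sets_restrict_space image_iff intro: sets.Int)

lemma borel_partitions_nonempty:
  assumes "A \<in> sets borel"
  shows "borel_partitions A \<noteq> {}"
proof -
  have "{A} - {{}} \<in> borel_partitions A"
    using assms by (auto simp: borel_partitions_def partition_on_def disjoint_def)
  then show ?thesis by blast
qed

text \<open>The supremum runs over exact partitions into nonempty blocks. A disjoint family becomes
  one by adding the rest of \<open>A\<close> and discarding empty sets. The set function is kept
  general so that the lemma also applies to the difference of two measures.\<close>

lemma sum_abs_le_total_variation: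
  fixes \<mu> :: "'a::topological_space set \<Rightarrow> real"
  assumes bdd: "bdd_above ((\<lambda>P. \<Sum>B\<in>P. \<bar>\<mu> B\<bar>) ` borel_partitions A)"
    and empty: "\<mu> {} = 0" and A: "A \<in> sets borel"
    and I: "finite I" and B: "\<And>i. i \<in> I \<Longrightarrow> B i \<in> sets borel" "\<And>i. i \<in> I \<Longrightarrow> B i \<subseteq> A"
    and disj: "disjoint_family_on B I"
  shows "(\<Sum>i\<in>I. \<bar>\<mu> (B i)\<bar>) \<le> total_variation \<mu> A"
proof -
  define P where "P = insert (A - (\<Union>i\<in>I. B i)) (B ` I) - {{}}"
  have dB: "disjnt (B i) (B j)" if "i \<in> I" "j \<in> I" "B i \<noteq> B j" for i j
    using disjoint_family_onD[OF disj, of i j] that by (auto simp: disjnt_def)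
  have dR: "disjnt (A - (\<Union>i\<in>I. B i)) (B i)" if "i \<in> I" for i
    using that by (auto simp: disjnt_def)
  have P: "P \<in> borel_partitions A"
    unfolding borel_partitions_def mem_Collect_eq
  proof (intro conjI)
    show "finite P" using I by (simp add: P_def)
    show "P \<subseteq> sets borel"
      using A B(1) I by (auto simp: P_def intro!: sets.Diff sets.finite_UN)
    show "partition_on A P"
    proof (rule partition_onI)
      have "\<Union>P = (A - (\<Union>i\<in>I. B i)) \<union> (\<Union>i\<in>I. B i)"
        unfolding P_def by blast
      also have "\<dots> = A" using B(2) by blast
      finally show "\<Union>P = A" .
      fix p q assume pq: "p \<in> P" "q \<in> P" "p \<noteq> q"
      have "p = A - (\<Union>i\<in>I. B i) \<or> (\<exists>i\<in>I. p = B i)" "q = A - (\<Union>i\<in>I. B i) \<or> (\<exists>j\<in>I. q = B j)"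
        using pq(1,2) unfolding P_def by fast+
      then show "disjnt p q"
        using pq(3) by (elim disjE bexE) (simp_all only: dB dR disjnt_sym[OF dR] simp_thms)
    qed (simp add: P_def)
  qed
  \<comment> \<open>\<open>B\<close> need not be injective, but disjointness lets only the empty set
    be repeated, and it contributes 0.\<close>
  have "(\<Sum>i\<in>I. \<bar>\<mu> (B i)\<bar>) = (\<Sum>C\<in>B ` I. \<bar>\<mu> C\<bar>)"
  proof (rule sum.reindex_nontrivial[OF I, symmetric, unfolded o_def])
    fix i j assume "i \<in> I" "j \<in> I" "i \<noteq> j" "B i = B j"
    then have "B i = {}" using disj by (auto simp: disjoint_family_on_def)
    then show "\<bar>\<mu> (B i)\<bar> = 0" using empty by simp
  qed
  also have "\<dots> = (\<Sum>C\<in>B ` I - {{}}. \<bar>\<mu> C\<bar>)"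
    using I empty by (intro sum.mono_neutral_right) auto
  also have "\<dots> \<le> (\<Sum>C\<in>P. \<bar>\<mu> C\<bar>)"
    using I by (intro sum_mono2) (auto simp: P_def)
  also have "\<dots> \<le> total_variation \<mu> A"
    unfolding total_variation_def by (rule cSUP_upper[OF P bdd])
  finally show ?thesis .
qed

context
  fixes U :: "'a::topological_space set" and \<mu> :: "'a set \<Rightarrow> real"
  assumes U: "open U" and \<mu>: "\<mu> \<in> radon_measures U"
begin

lemma radon_sums:
  fixes A :: "nat \<Rightarrow> 'a set"
  assumes "\<And>i. A i \<in> sets borel" "\<And>i. A i \<subseteq> U" "disjoint_family A"
  shows "(\<lambda>i. \<mu> (A i)) sums \<mu> (\<Union>i. A i)"
  using \<mu> assms unfolding radon_measures_def sets_restrict_borel_open[OF U] by blast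

text \<open>The constant sequence of empty sets is disjoint, and a constant series is summable only
  if its term is 0.\<close>

lemma radon_empty: "\<mu> {} = 0"
  using sums_summable[OF radon_sums[of "\<lambda>_. {}"]] by (simp add: disjoint_family_on_def summable_const_iff)

lemma radon_bdd:
  assumes A: "A \<in> sets borel" "A \<subseteq> U"
  shows "bdd_above ((\<lambda>P. \<Sum>B\<in>P. \<bar>\<mu> B\<bar>) ` borel_partitions A)"
proof (rule bdd_aboveI2)
  fix P assume P: "P \<in> borel_partitions A"
  have bU: "bdd_above ((\<lambda>P. \<Sum>B\<in>P. \<bar>\<mu> B\<bar>) ` borel_partitions U)"
    using \<mu> by (simp add: radon_measures_def)
  show "(\<Sum>B\<in>P. \<bar>\<mu> B\<bar>) \<le> total_variation \<mu> U"
    using P A U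
    by (intro sum_abs_le_total_variation[OF bU radon_empty])
      (auto simp: borel_partitions_def partition_on_def disjoint_family_on_def disjoint_def)
qed

lemmas radon_sum_abs_le = sum_abs_le_total_variation[OF radon_bdd radon_empty]

lemma radon_abs_le: "A \<in> sets borel \<Longrightarrow> A \<subseteq> U \<Longrightarrow> \<bar>\<mu> A\<bar> \<le> total_variation \<mu> A"
  using radon_sum_abs_le[of A "{()}" "\<lambda>_. A"] by (auto simp: disjoint_family_on_def)

lemma total_variation_nonneg: "A \<in> sets borel \<Longrightarrow> A \<subseteq> U \<Longrightarrow> 0 \<le> total_variation \<mu> A"
  using radon_abs_le[of A] by linarith

text \<open>A partition of \<open>A\<close> and one of \<open>B\<close> unite to a partition of the
  union. They share no block because blocks are nonempty, so the two sums add without loss.\<close>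

lemma total_variation_superadditive:
  assumes "A \<in> sets borel" "B \<in> sets borel" "A \<subseteq> U" "B \<subseteq> U" "A \<inter> B = {}"
  shows "total_variation \<mu> A + total_variation \<mu> B \<le> total_variation \<mu> (A \<union> B)"
proof -
  have *: "(\<Sum>C\<in>P. \<bar>\<mu> C\<bar>) + (\<Sum>C\<in>Q. \<bar>\<mu> C\<bar>) \<le> total_variation \<mu> (A \<union> B)"
    if P: "P \<in> borel_partitions A" and Q: "Q \<in> borel_partitions B" for P Q
  proof -
    have PQ: "P \<inter> Q = {}"
    proof (rule ccontr)
      assume "P \<inter> Q \<noteq> {}"
      then obtain C where "C \<in> P" "C \<in> Q" by blast
      then have "C \<noteq> {}" "C \<subseteq> A" "C \<subseteq> B"
        using P Q by (auto simp: borel_partitions_def partition_on_def)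
      then show False using assms(5) by blast
    qed
    have "disjoint (P \<union> Q)"
      using P Q assms(5) unfolding borel_partitions_def partition_on_def
      by (intro disjoint_union) auto
    then have "(\<Sum>C\<in>P \<union> Q. \<bar>\<mu> C\<bar>) \<le> total_variation \<mu> (A \<union> B)"
      using P Q assms
      by (intro radon_sum_abs_le) 
        (auto simp: borel_partitions_def partition_on_def disjoint_family_on_def disjoint_def)
    then show ?thesis
      using P Q PQ by (simp add: sum.union_disjoint borel_partitions_def)
  qed
  have "total_variation \<mu> B \<le> total_variation \<mu> (A \<union> B) - (\<Sum>C\<in>P. \<bar>\<mu> C\<bar>)"
    if P: "P \<in> borel_partitions A" for P
    unfolding total_variation_def[of \<mu> B]
    by (rule cSUP_least[OF borel_partitions_nonempty[OF assms(2)]]) (use *[OF P] in force)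
  then have "(\<Sum>C\<in>P. \<bar>\<mu> C\<bar>) \<le> total_variation \<mu> (A \<union> B) - total_variation \<mu> B"
    if P: "P \<in> borel_partitions A" for P
    using that by force
  then have "total_variation \<mu> A \<le> total_variation \<mu> (A \<union> B) - total_variation \<mu> B"
    unfolding total_variation_def[of \<mu> A]
    by (intro cSUP_least[OF borel_partitions_nonempty[OF assms(1)]])
  then show ?thesis by simp
qed

lemma total_variation_mono:
  assumes "A \<in> sets borel" "B \<in> sets borel" "A \<subseteq> B" "B \<subseteq> U"
  shows "total_variation \<mu> A \<le> total_variation \<mu> B"
proof -
  have "total_variation \<mu> A + total_variation \<mu> (B - A) \<le> total_variation \<mu> (A \<union> (B - A))"
    using assms by (intro total_variation_superadditive) auto
  moreover have "0 \<le> total_variation \<mu> (B - A)"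
    using assms by (intro total_variation_nonneg) auto
  moreover have "A \<union> (B - A) = B" using assms by auto
  ultimately show ?thesis by simp
qed

lemma total_variation_empty: "total_variation \<mu> {} = 0"
  using total_variation_superadditive[of "{}" "{}"] total_variation_nonneg[of "{}"] by simp

text \<open>One inequality is finite superadditivity together with monotonicity. For the other,
  every block of a partition of the union is cut by the sets \<open>A i\<close>; the finite sum over
  blocks and the series over \<open>i\<close> are exchanged, and each row is a disjoint family
  inside \<open>A i\<close>.\<close>

lemma total_variation_sums:
  fixes A :: "nat \<Rightarrow> 'a set"
  assumes A: "\<And>i. A i \<in> sets borel" "\<And>i. A i \<subseteq> U" and disj: "disjoint_family A"
  shows "(\<lambda>i. total_variation \<mu> (A i)) sums total_variation \<mu> (\<Union>i. A i)"
proof -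
  have UA: "(\<Union>i. A i) \<in> sets borel" "(\<Union>i. A i) \<subseteq> U"
    using A by auto
  have nonneg: "0 \<le> total_variation \<mu> (A i)" for i
    using A by (intro total_variation_nonneg)
  have part: "(\<Sum>i<n. total_variation \<mu> (A i)) \<le> total_variation \<mu> (\<Union>i<n. A i)" for n
  proof (induction n)
    case (Suc n)
    have "A i \<inter> A n = {}" if "i < n" for i
      using that by (intro disjoint_family_onD[OF disj]) auto
    then have "total_variation \<mu> (\<Union>i<n. A i) + total_variation \<mu> (A n) \<le> total_variation \<mu> ((\<Union>i<n. A i) \<union> A n)"
      using A by (intro total_variation_superadditive sets.finite_UN UN_least) auto
    moreover have "(\<Union>i<n. A i) \<union> A n = (\<Union>i<Suc n. A i)"
      by (auto simp: less_Suc_eq)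
    ultimately show ?case using Suc by simp
  qed (simp add: total_variation_empty)
  have part': "(\<Sum>i<n. total_variation \<mu> (A i)) \<le> total_variation \<mu> (\<Union>i. A i)" for n
    using part[of n] A UA by (intro order_trans[OF part] total_variation_mono) auto
  have sm: "summable (\<lambda>i. total_variation \<mu> (A i))"
    using nonneg part' by (rule summableI_nonneg_bounded)
  have le: "suminf (\<lambda>i. total_variation \<mu> (A i)) \<le> total_variation \<mu> (\<Union>i. A i)"
    by (rule suminf_le_const[OF sm part'])
  have "total_variation \<mu> (\<Union>i. A i) \<le> suminf (\<lambda>i. total_variation \<mu> (A i))"
    unfolding total_variation_def[of \<mu> "\<Union>i. A i"]
  proof (rule cSUP_least[OF borel_partitions_nonempty[OF UA(1)]])
    fix P assume P: "P \<in> borel_partitions (\<Union>i. A i)"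
    then have fin: "finite P" and Pb: "\<And>B. B \<in> P \<Longrightarrow> B \<in> sets borel"
      and PU: "\<Union>P = (\<Union>i. A i)" and Pd: "disjoint P"
      by (auto simp: borel_partitions_def partition_on_def)
    have row: "(\<Sum>B\<in>P. \<bar>\<mu> (B \<inter> A i)\<bar>) \<le> total_variation \<mu> (A i)" for i
    proof (rule radon_sum_abs_le)
      show "disjoint_family_on (\<lambda>B. B \<inter> A i) P"
        using Pd unfolding disjoint_family_on_def disjoint_def by blast
    qed (use A fin Pb in auto)
    have sumB: "summable (\<lambda>i. \<bar>\<mu> (B \<inter> A i)\<bar>)" if "B \<in> P" for B
    proof (rule summable_comparison_test'[OF sm])
      fix i
      have "\<bar>\<mu> (B \<inter> A i)\<bar> \<le> (\<Sum>B\<in>P. \<bar>\<mu> (B \<inter> A i)\<bar>)"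
        using fin that by (intro member_le_sum) auto
      then show "norm \<bar>\<mu> (B \<inter> A i)\<bar> \<le> total_variation \<mu> (A i)"
        using row[of i] by simp
    qed
    have "\<bar>\<mu> B\<bar> \<le> (\<Sum>i. \<bar>\<mu> (B \<inter> A i)\<bar>)" if "B \<in> P" for B
    proof -
      have "(\<Union>i. B \<inter> A i) = B" using that PU by blast
      moreover have "(\<lambda>i. \<mu> (B \<inter> A i)) sums \<mu> (\<Union>i. B \<inter> A i)"
      proof (rule radon_sums)
        show "disjoint_family (\<lambda>i. B \<inter> A i)"
          using disj unfolding disjoint_family_on_def by blast
      qed (use A Pb[OF that] in auto)
      ultimately have "\<mu> B = (\<Sum>i. \<mu> (B \<inter> A i))" by (simp add: sums_iff)
      then show ?thesis using summable_rabs[OF sumB[OF that]] by simp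
    qed
    then have "(\<Sum>B\<in>P. \<bar>\<mu> B\<bar>) \<le> (\<Sum>B\<in>P. \<Sum>i. \<bar>\<mu> (B \<inter> A i)\<bar>)"
      by (intro sum_mono)
    also have "\<dots> = (\<Sum>i. \<Sum>B\<in>P. \<bar>\<mu> (B \<inter> A i)\<bar>)"
      using sumB by (intro suminf_sum[symmetric])
    also have "\<dots> \<le> (\<Sum>i. total_variation \<mu> (A i))"
      using sumB sm row by (intro suminf_le summable_sum) auto
    finally show "(\<Sum>B\<in>P. \<bar>\<mu> B\<bar>) \<le> (\<Sum>i. total_variation \<mu> (A i))" .
  qed
  with le sm show ?thesis by (simp add: sums_iff)
qed

section \<open>Jordan parts and integration against a signed measure\<close>

lemma Jordan_part:
  assumes \<sigma>: "\<sigma> = 1 \<or> \<sigma> = -1"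
    and N: "N = measure_of U (sets (restrict_space borel U)) (\<lambda>A. ennreal ((total_variation \<mu> A + \<sigma> * \<mu> A) / 2))"
  shows "sets N = sets (restrict_space borel U)" "space N = U" "finite_measure N"
    and "\<And>A. A \<in> sets borel \<Longrightarrow> A \<subseteq> U \<Longrightarrow> measure N A = (total_variation \<mu> A + \<sigma> * \<mu> A) / 2"
proof -
  let ?S = "sets (restrict_space borel U)"
  have sp: "space (restrict_space borel U) = U" by (simp add: space_restrict_space)
  have sa: "sigma_algebra U ?S"
    using sets.sigma_algebra_axioms[of "restrict_space borel U"] by (simp add: sp)
  have pow: "?S \<subseteq> Pow U" using sets.space_closed[of "restrict_space borel U"] by (simp add: sp)
  show s: "sets N = ?S"
    unfolding N using sa by (simp add: sigma_algebra.sets_measure_of_eq)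
  show sN: "space N = U"
    unfolding N using pow by simp
  have nonneg: "0 \<le> (total_variation \<mu> A + \<sigma> * \<mu> A) / 2" if "A \<in> ?S" for A
    using radon_abs_le[of A] that \<sigma> by (auto simp: sets_restrict_borel_open[OF U])
  \<comment> \<open>\<open>measure_of\<close> takes the prescribed values only once positivity and
    countable additivity are verified, and \<open>nonneg\<close> ensures that \<open>ennreal\<close>
    truncates nothing.\<close>
  have em: "emeasure N A = ennreal ((total_variation \<mu> A + \<sigma> * \<mu> A) / 2)" if "A \<in> ?S" for A
    unfolding N
  proof (rule emeasure_measure_of_sigma[OF sa _ _ that])
    show "positive ?S (\<lambda>A. ennreal ((total_variation \<mu> A + \<sigma> * \<mu> A) / 2))"
      by (simp add: positive_def total_variation_empty radon_empty)
    show "countably_additive ?S (\<lambda>A. ennreal ((total_variation \<mu> A + \<sigma> * \<mu> A) / 2))"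
    proof (rule countably_additiveI)
      fix A :: "nat \<Rightarrow> 'a set"
      assume A: "range A \<subseteq> ?S" "disjoint_family A"
      then have A': "\<And>i. A i \<in> sets borel" "\<And>i. A i \<subseteq> U"
        by (auto simp: sets_restrict_borel_open[OF U])
      have "(\<lambda>i. (total_variation \<mu> (A i) + \<sigma> * \<mu> (A i)) / 2)
          sums ((total_variation \<mu> (\<Union>i. A i) + \<sigma> * \<mu> (\<Union>i. A i)) / 2)"
        by (intro sums_divide sums_add sums_mult total_variation_sums radon_sums A A')
      then show "(\<Sum>i. ennreal ((total_variation \<mu> (A i) + \<sigma> * \<mu> (A i)) / 2))
          = ennreal ((total_variation \<mu> (\<Union>i. A i) + \<sigma> * \<mu> (\<Union>i. A i)) / 2)"
        using A nonneg by (intro suminf_ennreal_eq) auto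
    qed
  qed
  show "measure N A = (total_variation \<mu> A + \<sigma> * \<mu> A) / 2" if "A \<in> sets borel" "A \<subseteq> U" for A
    using em[of A] nonneg[of A] that by (simp add: measure_def sets_restrict_borel_open[OF U])
  show "finite_measure N"
    using em[of U] U by (intro finite_measureI) (auto simp: sN sets_restrict_borel_open)
qed

lemma pos_part_props:
  shows "sets (pos_part U \<mu>) = sets (restrict_space borel U)" "space (pos_part U \<mu>) = U"
    "finite_measure (pos_part U \<mu>)"
    "\<And>A. A \<in> sets borel \<Longrightarrow> A \<subseteq> U \<Longrightarrow> measure (pos_part U \<mu>) A = (total_variation \<mu> A + \<mu> A) / 2"
proof -
  have *: "pos_part U \<mu> = measure_of U (sets (restrict_space borel U))
      (\<lambda>A. ennreal ((total_variation \<mu> A + 1 * \<mu> A) / 2))"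
    by (simp add: pos_part_def)
  show "sets (pos_part U \<mu>) = sets (restrict_space borel U)" "space (pos_part U \<mu>) = U"
    "finite_measure (pos_part U \<mu>)"
    using Jordan_part(1-3)[OF _ *] by auto
  show "measure (pos_part U \<mu>) A = (total_variation \<mu> A + \<mu> A) / 2"
    if "A \<in> sets borel" "A \<subseteq> U" for A
    using Jordan_part(4)[OF _ * that] by simp
qed

lemma neg_part_props:
  shows "sets (neg_part U \<mu>) = sets (restrict_space borel U)" "space (neg_part U \<mu>) = U"
    "finite_measure (neg_part U \<mu>)"
    "\<And>A. A \<in> sets borel \<Longrightarrow> A \<subseteq> U \<Longrightarrow> measure (neg_part U \<mu>) A = (total_variation \<mu> A - \<mu> A) / 2"
proof -
  have *: "neg_part U \<mu> = measure_of U (sets (restrict_space borel U))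
      (\<lambda>A. ennreal ((total_variation \<mu> A + - 1 * \<mu> A) / 2))"
    by (simp add: neg_part_def)
  show "sets (neg_part U \<mu>) = sets (restrict_space borel U)" "space (neg_part U \<mu>) = U"
    "finite_measure (neg_part U \<mu>)"
    using Jordan_part(1-3)[OF _ *] by auto
  show "measure (neg_part U \<mu>) A = (total_variation \<mu> A - \<mu> A) / 2"
    if "A \<in> sets borel" "A \<subseteq> U" for A
    using Jordan_part(4)[OF _ * that] by simp
qed

lemma Jordan_integrable:
  fixes \<phi> :: "'a \<Rightarrow> real"
  assumes "\<phi> \<in> borel_measurable (restrict_space borel U)" "\<And>y. y \<in> U \<Longrightarrow> \<bar>\<phi> y\<bar> \<le> B"
  shows "integrable (pos_part U \<mu>) \<phi>" "integrable (neg_part U \<mu>) \<phi>"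
proof -
  have "\<phi> \<in> borel_measurable (pos_part U \<mu>)" "\<phi> \<in> borel_measurable (neg_part U \<mu>)"
    using assms(1) by (simp_all only: measurable_cong_sets[OF pos_part_props(1) refl]
        measurable_cong_sets[OF neg_part_props(1) refl])
  then show "integrable (pos_part U \<mu>) \<phi>" "integrable (neg_part U \<mu>) \<phi>"
    using assms(2)
    by (auto intro!: finite_measure.integrable_const_bound[where B=B] pos_part_props(3) neg_part_props(3)
        simp: pos_part_props(2) neg_part_props(2))
qed

text \<open>The masses of the Jordan parts, (|\<mu>| + \<mu>)/2 and (|\<mu>| - \<mu>)/2, add up to
  the total variation, so bounding the two integrals separately loses nothing.\<close>

lemma signed_integral_bound:
  fixes \<phi> :: "'a \<Rightarrow> real"
  assumes \<phi>: "\<phi> \<in> borel_measurable (restrict_space borel U)" "\<And>y. y \<in> U \<Longrightarrow> \<bar>\<phi> y\<bar> \<le> B"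
  shows "\<bar>signed_integral U \<mu> \<phi>\<bar> \<le> B * tv_norm U \<mu>"
proof -
  have Ub: "U \<in> sets borel" using U by simp
  have P: "\<bar>\<integral>y. \<phi> y \<partial>pos_part U \<mu>\<bar> \<le> B * measure (pos_part U \<mu>) U"
  proof -
    interpret finite_measure "pos_part U \<mu>" by (rule pos_part_props(3))
    have "\<bar>\<integral>y. \<phi> y \<partial>pos_part U \<mu>\<bar> \<le> (\<integral>y. \<bar>\<phi> y\<bar> \<partial>pos_part U \<mu>)"
      by (rule integral_abs_bound)
    also have "\<dots> \<le> (\<integral>y. B \<partial>pos_part U \<mu>)"
      using Jordan_integrable[OF \<phi>] \<phi>(2) by (intro integral_mono) (auto simp: pos_part_props(2))
    finally show ?thesis by (simp add: pos_part_props(2) mult.commute)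
  qed
  have N: "\<bar>\<integral>y. \<phi> y \<partial>neg_part U \<mu>\<bar> \<le> B * measure (neg_part U \<mu>) U"
  proof -
    interpret finite_measure "neg_part U \<mu>" by (rule neg_part_props(3))
    have "\<bar>\<integral>y. \<phi> y \<partial>neg_part U \<mu>\<bar> \<le> (\<integral>y. \<bar>\<phi> y\<bar> \<partial>neg_part U \<mu>)"
      by (rule integral_abs_bound)
    also have "\<dots> \<le> (\<integral>y. B \<partial>neg_part U \<mu>)"
      using Jordan_integrable[OF \<phi>] \<phi>(2) by (intro integral_mono) (auto simp: neg_part_props(2))
    finally show ?thesis by (simp add: neg_part_props(2) mult.commute)
  qed
  from P N have "\<bar>signed_integral U \<mu> \<phi>\<bar> \<le> B * measure (pos_part U \<mu>) U + B * measure (neg_part U \<mu>) U"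
    by (simp add: signed_integral_def)
  also have "\<dots> = B * (measure (pos_part U \<mu>) U + measure (neg_part U \<mu>) U)"
    by (rule distrib_left[symmetric])
  also have "measure (pos_part U \<mu>) U + measure (neg_part U \<mu>) U = tv_norm U \<mu>"
    unfolding pos_part_props(4)[OF Ub order_refl] neg_part_props(4)[OF Ub order_refl]
    by (simp add: add_divide_distrib diff_divide_distrib)
  finally show ?thesis .
qed

lemma signed_integral_diff:
  assumes \<phi>: "\<phi> \<in> borel_measurable (restrict_space borel U)" "\<And>y. y \<in> U \<Longrightarrow> \<bar>\<phi> y\<bar> \<le> B"
    and \<psi>: "\<psi> \<in> borel_measurable (restrict_space borel U)" "\<And>y. y \<in> U \<Longrightarrow> \<bar>\<psi> y\<bar> \<le> C"
  shows "signed_integral U \<mu> (\<lambda>y. \<phi> y - \<psi> y) = signed_integral U \<mu> \<phi> - signed_integral U \<mu> \<psi>"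
  using Jordan_integrable[OF \<phi>] Jordan_integrable[OF \<psi>] by (simp add: signed_integral_def)

text \<open>On each level set the positive minus the negative part is \<mu> itself. In this form the
  integral is visibly linear in the measure, which the definition by Jordan parts does not
  show.\<close>

lemma signed_integral_simple:
  fixes s :: "'a \<Rightarrow> real"
  assumes s: "simple_function (restrict_space borel U) s"
  shows "signed_integral U \<mu> s = (\<Sum>c\<in>s ` U. c * \<mu> {y \<in> U. s y = c})"
proof -
  have spU: "space (restrict_space borel U) = U" by (simp add: space_restrict_space)
  have lev: "{y \<in> U. s y = c} \<in> sets borel" for c
  proof -
    have "s -` {c} \<inter> space (restrict_space borel U) \<in> sets (restrict_space borel U)"
      by (rule simple_functionD(2)[OF s])
    moreover have "s -` {c} \<inter> space (restrict_space borel U) = {y \<in> U. s y = c}"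
      by (auto simp: spU)
    ultimately show ?thesis by (simp add: sets_restrict_borel_open[OF U])
  qed
  have int: "(\<integral>y. s y \<partial>N) = (\<Sum>c\<in>s ` U. measure N {y \<in> U. s y = c} * c)"
    if N: "sets N = sets (restrict_space borel U)" "space N = U" "finite_measure N" for N
  proof -
    interpret finite_measure N by (rule that(3))
    have "Bochner_Integration.simple_bochner_integrable N s"
      unfolding simple_bochner_integrable.simps
      using s N(1,2) by (auto simp: simple_function_def spU)
    from simple_bochner_integrable_eq_integral[OF this] show ?thesis
      by (simp add: simple_bochner_integral_def N(2))
  qed
  show ?thesis
    unfolding signed_integral_def int[OF pos_part_props(1-3)] int[OF neg_part_props(1-3)]
      sum_subtractf[symmetric]
  proof (rule sum.cong[OF refl])
    fix c
    show "measure (pos_part U \<mu>) {y \<in> U. s y = c} * c - measure (neg_part U \<mu>) {y \<in> U. s y = c} * c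
        = c * \<mu> {y \<in> U. s y = c}"
      using lev[of c] by (simp add: pos_part_props(4) neg_part_props(4) left_diff_distrib[symmetric] diff_divide_distrib[symmetric])
  qed
qed

end

text \<open>The triangle inequality bounds the variation sums of the difference; without such a
  bound the real supremum behind \<open>tv_dist\<close> would carry no information.\<close>

lemma radon_diff_sum_abs_le:
  assumes U: "open U" and \<mu>: "\<mu> \<in> radon_measures U" and \<nu>: "\<nu> \<in> radon_measures U"
    and I: "finite I" "\<And>i. i \<in> I \<Longrightarrow> B i \<in> sets borel" "\<And>i. i \<in> I \<Longrightarrow> B i \<subseteq> U" "disjoint_family_on B I"
  shows "(\<Sum>i\<in>I. \<bar>\<mu> (B i) - \<nu> (B i)\<bar>) \<le> tv_dist U \<mu> \<nu>"
proof (rule sum_abs_le_total_variation[OF _ _ _ I])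
  show "bdd_above ((\<lambda>P. \<Sum>B\<in>P. \<bar>\<mu> B - \<nu> B\<bar>) ` borel_partitions U)"
  proof (rule bdd_aboveI2)
    fix P assume P: "P \<in> borel_partitions U"
    have "(\<Sum>B\<in>P. \<bar>\<mu> B - \<nu> B\<bar>) \<le> (\<Sum>B\<in>P. \<bar>\<mu> B\<bar> + \<bar>\<nu> B\<bar>)"
      by (intro sum_mono) simp
    also have "\<dots> = (\<Sum>B\<in>P. \<bar>\<mu> B\<bar>) + (\<Sum>B\<in>P. \<bar>\<nu> B\<bar>)"
      by (rule sum.distrib)
    also have "\<dots> \<le> tv_norm U \<mu> + tv_norm U \<nu>"
      using U unfolding total_variation_def
      by (intro add_mono cSUP_upper[OF P] radon_bdd[OF U \<mu>] radon_bdd[OF U \<nu>]) auto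
    finally show "(\<Sum>B\<in>P. \<bar>\<mu> B - \<nu> B\<bar>) \<le> tv_norm U \<mu> + tv_norm U \<nu>" .
  qed
qed (use U radon_empty[OF U \<mu>] radon_empty[OF U \<nu>] in auto)

lemma tv_dist_nonneg:
  assumes "open U" "\<mu> \<in> radon_measures U" "\<nu> \<in> radon_measures U"
  shows "0 \<le> tv_dist U \<mu> \<nu>"
  using radon_diff_sum_abs_le[OF assms, of "{} :: nat set"] by (simp add: disjoint_family_on_def)

text \<open>Jordan parts do not depend linearly on the measure, so the two integrals cannot be
  subtracted directly. Rounding \<phi> down to multiples of \<open>e\<close> gives a simple
  function, whose integral is linear in the measure, and the rounding errors vanish with
  \<open>e\<close>.\<close>

lemma signed_integral_measure_diff:
  fixes U :: "'a::topological_space set"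
  assumes U: "open U" and \<mu>: "\<mu> \<in> radon_measures U" and \<nu>: "\<nu> \<in> radon_measures U"
    and \<phi>: "\<phi> \<in> borel_measurable (restrict_space borel U)" "\<And>y. y \<in> U \<Longrightarrow> \<bar>\<phi> y\<bar> \<le> B" and B: "0 \<le> B"
  shows "\<bar>signed_integral U \<mu> \<phi> - signed_integral U \<nu> \<phi>\<bar> \<le> B * tv_dist U \<mu> \<nu>"
proof (rule field_le_epsilon)
  fix r :: real assume r: "0 < r"
  \<comment> \<open>The total error is at most \<open>e * C\<close>: rounding costs \<open>e\<close>
    times each of the two norms, and the bound \<open>B + e\<close> on the rounded function costs
    \<open>e\<close> times the distance. The summand 1 makes \<open>C\<close> positive.\<close>
  define C where "C = tv_dist U \<mu> \<nu> + tv_norm U \<mu> + tv_norm U \<nu> + 1"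
  have Ub: "U \<in> sets borel" using U by simp
  have nn: "0 \<le> tv_dist U \<mu> \<nu>" "0 \<le> tv_norm U \<mu>" "0 \<le> tv_norm U \<nu>"
    using tv_dist_nonneg[OF U \<mu> \<nu>] total_variation_nonneg[OF U \<mu> Ub] total_variation_nonneg[OF U \<nu> Ub] by auto
  define e where "e = r / C"
  have e: "0 < e" using r nn by (simp add: e_def C_def)
  define s where "s y = e * of_int \<lfloor>\<phi> y / e\<rfloor>" for y
  have close: "\<bar>\<phi> y - s y\<bar> \<le> e" for y
  proof -
    have "\<phi> y - s y = e * (\<phi> y / e - of_int \<lfloor>\<phi> y / e\<rfloor>)"
      using e by (simp add: s_def field_simps)
    also have "\<bar>\<dots>\<bar> \<le> e * 1"
      unfolding abs_mult using e by (intro mult_mono) linarith+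
    finally show ?thesis by simp
  qed
  have sB: "\<bar>s y\<bar> \<le> B + e" if "y \<in> U" for y
    using close[of y] \<phi>(2)[OF that] by linarith
  have sm: "s \<in> borel_measurable (restrict_space borel U)"
    unfolding s_def[abs_def] using \<phi>(1) by measurable
  have "s ` U \<subseteq> (\<lambda>k. e * of_int k) ` {\<lfloor>- B / e\<rfloor>..\<lfloor>B / e\<rfloor>}"
  proof
    fix c assume "c \<in> s ` U"
    then obtain y where y: "y \<in> U" "c = s y" by auto
    have "- B / e \<le> \<phi> y / e" "\<phi> y / e \<le> B / e"
      using \<phi>(2)[OF y(1)] e divide_right_mono[of "- B" "\<phi> y" e] divide_right_mono[of "\<phi> y" B e] by auto
    then have "\<lfloor>\<phi> y / e\<rfloor> \<in> {\<lfloor>- B / e\<rfloor>..\<lfloor>B / e\<rfloor>}" by (auto intro: floor_mono)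
    then show "c \<in> (\<lambda>k. e * of_int k) ` {\<lfloor>- B / e\<rfloor>..\<lfloor>B / e\<rfloor>}"
      unfolding y(2) s_def by blast
  qed
  then have fin: "finite (s ` U)" by (rule finite_subset) simp
  have spU: "space (restrict_space borel U) = U" by (simp add: space_restrict_space)
  have sf: "simple_function (restrict_space borel U) s"
    using sm fin by (simp add: simple_function_borel_measurable spU)
  have lev: "{y \<in> U. s y = c} \<in> sets borel" for c
  proof -
    have "s -` {c} \<inter> space (restrict_space borel U) \<in> sets (restrict_space borel U)"
      by (rule simple_functionD(2)[OF sf])
    moreover have "s -` {c} \<inter> space (restrict_space borel U) = {y \<in> U. s y = c}"
      by (auto simp: spU)
    ultimately show ?thesis by (simp add: sets_restrict_borel_open[OF U])
  qed
  have "\<bar>signed_integral U \<mu> s - signed_integral U \<nu> s\<bar>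
      = \<bar>\<Sum>c\<in>s ` U. c * (\<mu> {y \<in> U. s y = c} - \<nu> {y \<in> U. s y = c})\<bar>"
    by (simp add: signed_integral_simple[OF U \<mu> sf] signed_integral_simple[OF U \<nu> sf]
        sum_subtractf[symmetric] right_diff_distrib)
  also have "\<dots> \<le> (\<Sum>c\<in>s ` U. (B + e) * \<bar>\<mu> {y \<in> U. s y = c} - \<nu> {y \<in> U. s y = c}\<bar>)"
    by (rule order_trans[OF sum_abs], rule sum_mono)
      (use sB in \<open>auto simp: abs_mult intro!: mult_right_mono\<close>)
  also have "\<dots> = (B + e) * (\<Sum>c\<in>s ` U. \<bar>\<mu> {y \<in> U. s y = c} - \<nu> {y \<in> U. s y = c}\<bar>)"
    by (simp add: sum_distrib_left)
  also have "\<dots> \<le> (B + e) * tv_dist U \<mu> \<nu>"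
    using fin lev B e
    by (intro mult_left_mono radon_diff_sum_abs_le[OF U \<mu> \<nu>]) (auto simp: disjoint_family_on_def)
  finally have 1: "\<bar>signed_integral U \<mu> s - signed_integral U \<nu> s\<bar> \<le> (B + e) * tv_dist U \<mu> \<nu>" .
  have dm: "(\<lambda>y. \<phi> y - s y) \<in> borel_measurable (restrict_space borel U)"
    using \<phi>(1) sm by measurable
  have 2: "\<bar>signed_integral U \<mu> \<phi> - signed_integral U \<mu> s\<bar> \<le> e * tv_norm U \<mu>"
    using signed_integral_bound[OF U \<mu> dm close] signed_integral_diff[OF U \<mu> \<phi> sm sB] by simp
  have 3: "\<bar>signed_integral U \<nu> \<phi> - signed_integral U \<nu> s\<bar> \<le> e * tv_norm U \<nu>"
    using signed_integral_bound[OF U \<nu> dm close] signed_integral_diff[OF U \<nu> \<phi> sm sB] by simp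
  have "e * tv_dist U \<mu> \<nu> + e * tv_norm U \<mu> + e * tv_norm U \<nu> \<le> e * C"
    using e by (simp add: C_def algebra_simps)
  also have "\<dots> = r" using nn by (simp add: e_def C_def)
  finally show "\<bar>signed_integral U \<mu> \<phi> - signed_integral U \<nu> \<phi>\<bar> \<le> B * tv_dist U \<mu> \<nu> + r"
    using 1 2 3 unfolding distrib_right by linarith
qed

section \<open>Potentials of measures\<close>

context
  fixes U :: "'a::euclidean_space set" and f :: "'a \<Rightarrow>\<^sub>C real"
  assumes U: "open U"
begin

lemma kernel_measurable: "(\<lambda>y. apply_bcontfun f (x - y)) \<in> borel_measurable (restrict_space borel U)"
proof (rule measurable_restrict_space1)
  show "(\<lambda>y. apply_bcontfun f (x - y)) \<in> borel_measurable borel"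
    by (intro borel_measurable_continuous_onI continuous_on_compose2[OF continuous_on_apply_bcontfun[of UNIV]]
        continuous_intros) auto
qed

lemma kernel_bound: "\<bar>apply_bcontfun f z\<bar> \<le> norm f"
  using norm_bounded[of f z] by simp

lemma potential_bound: "\<mu> \<in> radon_measures U \<Longrightarrow> \<bar>potential U f \<mu> x\<bar> \<le> norm f * tv_norm U \<mu>"
  unfolding potential_def
  by (intro signed_integral_bound[OF U] kernel_measurable kernel_bound)

lemma potential_measure_diff:
  "\<mu> \<in> radon_measures U \<Longrightarrow> \<nu> \<in> radon_measures U \<Longrightarrow>
    \<bar>potential U f \<mu> x - potential U f \<nu> x\<bar> \<le> norm f * tv_dist U \<mu> \<nu>"
  unfolding potential_def
  by (intro signed_integral_measure_diff[OF U] kernel_measurable kernel_bound) auto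

lemma potential_point_diff:
  assumes "\<mu> \<in> radon_measures U"
    and "\<And>y. y \<in> U \<Longrightarrow> \<bar>apply_bcontfun f (x - y) - apply_bcontfun f (x' - y)\<bar> \<le> \<eta>"
  shows "\<bar>potential U f \<mu> x - potential U f \<mu> x'\<bar> \<le> \<eta> * tv_norm U \<mu>"
proof -
  have "(\<lambda>y. apply_bcontfun f (x - y) - apply_bcontfun f (x' - y)) \<in> borel_measurable (restrict_space borel U)"
    by (intro borel_measurable_diff kernel_measurable)
  from signed_integral_bound[OF U assms(1) this assms(2)]
  show ?thesis
    unfolding potential_def
    by (simp add: signed_integral_diff[OF U assms(1) kernel_measurable kernel_bound kernel_measurable kernel_bound])
qed

text \<open>The potential at \<open>x\<close> is Lipschitz in the total variation distance, so
  preimages of open sets are among the generators of \<open>radon_borel U\<close>.\<close>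

lemma potential_measurable: "(\<lambda>\<mu>. potential U f \<mu> x) \<in> borel_measurable (radon_borel U)"
proof (rule borel_measurableI)
  fix S :: "real set" assume S: "open S"
  have pow: "{\<O>. tv_open U \<O>} \<subseteq> Pow (radon_measures U)"
    by (auto simp: tv_open_def)
  have "tv_open U {\<mu> \<in> radon_measures U. potential U f \<mu> x \<in> S}"
    unfolding tv_open_def
  proof (intro conjI ballI)
    fix \<mu> assume "\<mu> \<in> {\<mu> \<in> radon_measures U. potential U f \<mu> x \<in> S}"
    then have \<mu>: "\<mu> \<in> radon_measures U" "potential U f \<mu> x \<in> S" by auto
    obtain e where e: "e > 0" "\<And>z. \<bar>z - potential U f \<mu> x\<bar> < e \<Longrightarrow> z \<in> S"
      using S \<mu>(2) unfolding open_real by blast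
    show "\<exists>r>0. \<forall>\<nu>\<in>radon_measures U. tv_dist U \<mu> \<nu> < r \<longrightarrow> \<nu> \<in> {\<mu> \<in> radon_measures U. potential U f \<mu> x \<in> S}"
    proof (intro exI[of _ "e / (norm f + 1)"] conjI ballI impI)
      show "e / (norm f + 1) > 0" using e(1) by (simp add: add_nonneg_pos)
      fix \<nu> assume \<nu>: "\<nu> \<in> radon_measures U" "tv_dist U \<mu> \<nu> < e / (norm f + 1)"
      have "norm f * tv_dist U \<mu> \<nu> \<le> (norm f + 1) * tv_dist U \<mu> \<nu>"
        using tv_dist_nonneg[OF U \<mu>(1) \<nu>(1)] by (intro mult_right_mono) auto
      also have "\<dots> < e"
        using \<nu>(2) by (simp add: pos_less_divide_eq add_nonneg_pos mult.commute)
      finally show "\<nu> \<in> {\<mu> \<in> radon_measures U. potential U f \<mu> x \<in> S}"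
        using potential_measure_diff[OF \<mu>(1) \<nu>(1), of x] \<nu>(1) e(2)[of "potential U f \<nu> x"] by auto
    qed
  qed auto
  moreover have "(\<lambda>\<mu>. potential U f \<mu> x) -` S \<inter> space (radon_borel U)
      = {\<mu> \<in> radon_measures U. potential U f \<mu> x \<in> S}"
    using pow by (auto simp: radon_borel_def)
  ultimately show "(\<lambda>\<mu>. potential U f \<mu> x) -` S \<inter> space (radon_borel U) \<in> sets (radon_borel U)"
    using pow by (simp add: radon_borel_def)
qed

lemma space_radon_borel: "space (radon_borel U) = radon_measures U"
  unfolding radon_borel_def by (rule space_measure_of) (auto simp: tv_open_def)

text \<open>Differences of points of \<open>U\<close> stay in the ball of radius \<open>2*R\<close>,
  where the continuous \<open>f\<close> is uniformly continuous. The measure enters through the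
  bound \<open>m\<close> alone, so one \<open>d\<close> serves all measures of norm at most
  \<open>m\<close>.\<close>

lemma potential_equicontinuous:
  assumes "bounded U" "0 < \<eta>" "0 \<le> m"
  obtains d where "0 < d"
    "\<And>\<mu> x x'. \<mu> \<in> radon_measures U \<Longrightarrow> tv_norm U \<mu> \<le> m \<Longrightarrow> x \<in> U \<Longrightarrow> x' \<in> U \<Longrightarrow> dist x x' < d \<Longrightarrow>
      \<bar>potential U f \<mu> x - potential U f \<mu> x'\<bar> \<le> \<eta>"
proof -
  obtain R where R: "\<And>x. x \<in> U \<Longrightarrow> norm x \<le> R"
    using assms(1) by (auto simp: bounded_iff)
  have "uniformly_continuous_on (cball 0 (2*R)) (apply_bcontfun f)"
    by (intro compact_uniformly_continuous continuous_on_apply_bcontfun) auto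
  then obtain d where d: "d > 0" "\<And>z z'. z \<in> cball 0 (2*R) \<Longrightarrow> z' \<in> cball 0 (2*R) \<Longrightarrow> dist z' z < d \<Longrightarrow>
      dist (apply_bcontfun f z') (apply_bcontfun f z) < \<eta> / (m + 1)"
    unfolding uniformly_continuous_on_def using assms(2,3)
    by (metis add_nonneg_pos divide_pos_pos zero_less_one)
  show ?thesis
  proof (rule that[OF d(1)])
    fix \<mu> x x' assume \<mu>: "\<mu> \<in> radon_measures U" "tv_norm U \<mu> \<le> m" and x: "x \<in> U" "x' \<in> U" "dist x x' < d"
    have "\<bar>potential U f \<mu> x - potential U f \<mu> x'\<bar> \<le> \<eta> / (m + 1) * tv_norm U \<mu>"
    proof (rule potential_point_diff[OF \<mu>(1)])
      fix y assume y: "y \<in> U"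
      have "norm (x - y) \<le> 2 * R" "norm (x' - y) \<le> 2 * R"
        using norm_triangle_ineq4[of x y] norm_triangle_ineq4[of x' y] R[OF x(1)] R[OF x(2)] R[OF y] by linarith+
      then show "\<bar>apply_bcontfun f (x - y) - apply_bcontfun f (x' - y)\<bar> \<le> \<eta> / (m + 1)"
        using d(2)[of "x' - y" "x - y"] x(3) by (simp add: dist_norm norm_minus_commute)
    qed
    also have "\<dots> \<le> \<eta> / (m + 1) * (m + 1)"
      using \<mu>(2) assms by (intro mult_left_mono) auto
    also have "\<dots> = \<eta>" using assms(3) by simp
    finally show "\<bar>potential U f \<mu> x - potential U f \<mu> x'\<bar> \<le> \<eta>" .
  qed
qed

lemma potential_continuous:
  assumes "bounded U" "\<mu> \<in> radon_measures U"
  shows "continuous_on U (potential U f \<mu>)"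
  unfolding continuous_on_iff
proof (intro ballI allI impI)
  fix x and e :: real assume "x \<in> U" "0 < e"
  have "0 \<le> tv_norm U \<mu>" using U by (intro total_variation_nonneg[OF U assms(2)]) auto
  then obtain d where "0 < d" "\<And>x x'. x \<in> U \<Longrightarrow> x' \<in> U \<Longrightarrow> dist x x' < d \<Longrightarrow>
      \<bar>potential U f \<mu> x - potential U f \<mu> x'\<bar> \<le> e/2"
    using potential_equicontinuous[OF assms(1) half_gt_zero[OF \<open>0 < e\<close>]] assms(2) order_refl by metis
  then show "\<exists>d>0. \<forall>x'\<in>U. dist x' x < d \<longrightarrow> dist (potential U f \<mu> x') (potential U f \<mu> x) < e"
    using \<open>x \<in> U\<close> \<open>0 < e\<close> by (force simp: dist_real_def)
qed

end

subsection \<open>The Green function\<close>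

lemma harmonic_on_add:
  assumes "harmonic_on h S" "harmonic_on k S"
  shows "harmonic_on (\<lambda>x. h x + k x) S"
proof -
  obtain D D2 where D: "\<And>x. x \<in> S \<Longrightarrow> (h has_derivative (\<lambda>v. D x \<bullet> v)) (at x)"
    "\<And>x. x \<in> S \<Longrightarrow> (D has_derivative D2 x) (at x)" "\<And>v. continuous_on S (\<lambda>x. D2 x v)"
    "\<And>x. x \<in> S \<Longrightarrow> (\<Sum>i\<in>Basis. D2 x i \<bullet> i) = 0"
    using assms(1) unfolding harmonic_on_def by blast
  obtain E E2 where E: "\<And>x. x \<in> S \<Longrightarrow> (k has_derivative (\<lambda>v. E x \<bullet> v)) (at x)"
    "\<And>x. x \<in> S \<Longrightarrow> (E has_derivative E2 x) (at x)" "\<And>v. continuous_on S (\<lambda>x. E2 x v)"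
    "\<And>x. x \<in> S \<Longrightarrow> (\<Sum>i\<in>Basis. E2 x i \<bullet> i) = 0"
    using assms(2) unfolding harmonic_on_def by blast
  show ?thesis
    unfolding harmonic_on_def
  proof (intro exI[of _ "\<lambda>x. D x + E x"] exI[of _ "\<lambda>x v. D2 x v + E2 x v"] conjI ballI allI)
    show "((\<lambda>x. h x + k x) has_derivative (\<lambda>v. (D x + E x) \<bullet> v)) (at x)" if "x \<in> S" for x
      unfolding inner_add_left by (intro has_derivative_add D(1) E(1) that)
  qed (use D E in \<open>auto simp: inner_add_left sum.distrib intro!: has_derivative_add continuous_on_add\<close>)
qed

lemma harmonic_on_affine: "harmonic_on (\<lambda>y. c + l \<bullet> y) S"
  unfolding harmonic_on_def
  by (intro exI[of _ "\<lambda>_. l"] exI[of _ "\<lambda>_ _. 0"]) (auto intro!: derivative_eq_intros)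

text \<open>Powers of the squared distance are easier to differentiate than powers of the norm. At
  the pole both sides are 0, since \<open>1 / 0\<close> and \<open>0 powr c\<close> are 0.\<close>

lemma fundamental_solution_powr:
  fixes x y :: "'a::euclidean_space"
  assumes "3 \<le> DIM('a)"
  shows "fundamental_solution (x - y) =
    1 / (real DIM('a) * measure lborel (ball (0::'a) 1) * real (DIM('a) - 2))
      * ((y - x) \<bullet> (y - x)) powr (- (real DIM('a) - 2) / 2)"
proof (cases "x = y")
  case True
  then show ?thesis using assms by (simp add: fundamental_solution_def zero_power)
next
  case False
  then have pos: "0 < norm (y - x)" by simp
  have "((y - x) \<bullet> (y - x)) powr (- (real DIM('a) - 2) / 2) = (norm (y - x) powr 2) powr (- (real DIM('a) - 2) / 2)"
    using pos by (simp add: dot_square_norm)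
  also have "\<dots> = norm (y - x) powr (- real (DIM('a) - 2))"
  proof -
    have "2 * (- (real DIM('a) - 2) / 2) = - real (DIM('a) - 2)"
      using assms by (simp add: of_nat_diff)
    then show ?thesis unfolding powr_powr by (rule arg_cong)
  qed
  also have "\<dots> = 1 / norm (x - y) ^ (DIM('a) - 2)"
    using pos by (simp add: powr_minus_divide powr_realpow norm_minus_commute)
  finally show ?thesis by (simp add: fundamental_solution_def)
qed

text \<open>With q the squared distance to \<open>x\<close> and n the dimension, the Laplacian of
  q^a is 2 a q^(a-1) (n + 2 (a - 1)), and the last factor vanishes for a = -(n-2)/2.\<close>

lemma harmonic_on_fundamental_solution:
  fixes x :: "'a::euclidean_space"
  assumes dim: "3 \<le> DIM('a)" and S: "x \<notin> S"
  shows "harmonic_on (\<lambda>y. fundamental_solution (x - y)) S"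
proof -
  define C where "C = 1 / (real DIM('a) * measure lborel (ball (0::'a) 1) * real (DIM('a) - 2))"
  define a where "a = - (real DIM('a) - 2) / 2"
  define q where "q y = (y - x) \<bullet> (y - x)" for y
  define D where "D y = (C * (2 * a) * (q y powr (a - 1))) *\<^sub>R (y - x)" for y
  define D2 where "D2 y v = (C * (2 * a) * (q y powr (a - 1))) *\<^sub>R v
      + (C * (2 * a) * ((a - 1) * q y powr (a - 2) * (2 * ((y - x) \<bullet> v)))) *\<^sub>R (y - x)" for y v
  have pos: "0 < q y" if "y \<in> S" for y
    using that S by (auto simp: q_def)
  have dq: "(q has_derivative (\<lambda>v. 2 * ((y - x) \<bullet> v))) (at y)" for y
    unfolding q_def[abs_def] by (auto intro!: derivative_eq_intros simp: inner_commute)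
  have dp: "((\<lambda>y. q y powr b) has_derivative (\<lambda>v. b * q y powr (b - 1) * (2 * ((y - x) \<bullet> v)))) (at y)"
    if "y \<in> S" for y b
    using pos[OF that]
    by (auto intro!: derivative_eq_intros dq simp: powr_diff fun_eq_iff)
  have eq: "(\<lambda>y. fundamental_solution (x - y)) = (\<lambda>y. C * q y powr a)"
    by (simp add: fundamental_solution_powr[OF dim] C_def a_def q_def)
  show ?thesis
    unfolding harmonic_on_def eq
  proof (intro exI[of _ D] exI[of _ D2] conjI ballI allI)
    fix y assume y: "y \<in> S"
    have "((\<lambda>y. C * q y powr a) has_derivative (\<lambda>v. C * (a * q y powr (a - 1) * (2 * ((y - x) \<bullet> v))))) (at y)"
      by (rule has_derivative_mult_right[OF dp[OF y]])
    moreover have "(\<lambda>v. C * (a * q y powr (a - 1) * (2 * ((y - x) \<bullet> v)))) = (\<lambda>v. D y \<bullet> v)"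
      by (simp add: D_def fun_eq_iff)
    ultimately show "((\<lambda>y. C * q y powr a) has_derivative (\<lambda>v. D y \<bullet> v)) (at y)"
      by simp
    have "(D has_derivative (\<lambda>v. (C * (2 * a) * (q y powr (a - 1))) *\<^sub>R (v - 0)
        + (C * (2 * a) * ((a - 1) * q y powr (a - 1 - 1) * (2 * ((y - x) \<bullet> v)))) *\<^sub>R (y - x))) (at y)"
      unfolding D_def[abs_def]
      by (intro has_derivative_scaleR has_derivative_mult_right dp[OF y] has_derivative_diff
          has_derivative_ident has_derivative_const)
    moreover have "a - 1 - 1 = a - 2" by simp
    ultimately show "(D has_derivative D2 y) (at y)"
      unfolding D2_def[abs_def] by simp
    have "(\<Sum>i\<in>Basis. D2 y i \<bullet> i)
        = (\<Sum>i\<in>Basis. C * (2 * a) * q y powr (a - 1)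
            + C * (2 * a) * (a - 1) * q y powr (a - 2) * 2 * (((y - x) \<bullet> i) * ((y - x) \<bullet> i)))"
      by (intro sum.cong) (auto simp: D2_def inner_add_left inner_Basis algebra_simps)
    also have "\<dots> = real DIM('a) * (C * (2 * a) * q y powr (a - 1))
        + C * (2 * a) * (a - 1) * q y powr (a - 2) * 2 * q y"
      by (simp add: sum.distrib sum_distrib_left[symmetric] q_def euclidean_inner[of "y - x" "y - x"])
    also have "q y powr (a - 2) = q y powr (a - 1) / q y"
      using pos[OF y] powr_diff[of "q y" "a - 1" 1] by simp
    also have "real DIM('a) * (C * (2 * a) * q y powr (a - 1))
        + C * (2 * a) * (a - 1) * (q y powr (a - 1) / q y) * 2 * q y
        = C * (2 * a) * q y powr (a - 1) * (real DIM('a) + 2 * (a - 1))"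
      using pos[OF y] by (simp add: field_simps)
    also have "real DIM('a) + 2 * (a - 1) = 0" by (simp add: a_def field_simps)
    finally show "(\<Sum>i\<in>Basis. D2 y i \<bullet> i) = 0" by simp
  next
    fix v
    have cq: "continuous_on S q"
      unfolding q_def[abs_def] by (intro continuous_intros)
    have cp: "continuous_on S (\<lambda>y. q y powr b)" for b
      using pos by (intro continuous_on_powr cq continuous_on_const) force
    show "continuous_on S (\<lambda>y. D2 y v)"
      unfolding D2_def by (intro continuous_intros cp)
  qed
qed

text \<open>The derivative \<open>k'\<close> vanishes at the minimum. If \<open>c\<close> were
  negative, \<open>k'\<close> would be negative just to the right of 0, and \<open>k\<close> would
  fall below \<open>k 0\<close>.\<close>

lemma second_derivative_nonneg_at_min:
  fixes k :: "real \<Rightarrow> real"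
  assumes d: "0 < d" and k: "\<And>t. \<bar>t\<bar> < d \<Longrightarrow> (k has_real_derivative k' t) (at t)"
    and k': "(k' has_real_derivative c) (at 0)" and min: "\<And>t. \<bar>t\<bar> < d \<Longrightarrow> k 0 \<le> k t"
  shows "0 \<le> c"
proof (rule ccontr)
  assume "\<not> 0 \<le> c"
  then obtain e where e: "e > 0" "\<And>t. 0 < t \<Longrightarrow> t < e \<Longrightarrow> k' t < k' 0"
    using DERIV_neg_dec_right[OF k'] by auto
  have "k' 0 = 0"
    using min d by (intro DERIV_local_min[OF k d]) auto
  define t where "t = min d e / 2"
  have t: "0 < t" "t < d" "t < e" using d e by (auto simp: t_def)
  have "k t < k 0"
  proof (rule DERIV_neg_imp_decreasing_open[OF t(1)])
    show "\<exists>y. (k has_real_derivative y) (at s) \<and> y < 0" if "0 < s" "s < t" for s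
      using k[of s] e(2)[of s] that t \<open>k' 0 = 0\<close> by auto
    show "continuous_on {0..t} k"
      using t k by (intro continuous_at_imp_continuous_on ballI DERIV_isCont[OF k]) auto
  qed
  then show False using min[of t] t by simp
qed

lemma harmonic_on_min_principle:
  fixes h :: "'a::euclidean_space \<Rightarrow> real"
  assumes r: "0 < r" and cont: "continuous_on (cball a r) h" and harm: "harmonic_on h (ball a r)"
    and bd: "\<And>y. y \<in> sphere a r \<Longrightarrow> 0 \<le> h y" and y0: "y0 \<in> ball a r"
  shows "0 \<le> h y0"
proof (rule ccontr)
  assume neg: "\<not> 0 \<le> h y0"
  obtain D D2 where D: "\<And>x. x \<in> ball a r \<Longrightarrow> (h has_derivative (\<lambda>v. D x \<bullet> v)) (at x)"
    "\<And>x. x \<in> ball a r \<Longrightarrow> (D has_derivative D2 x) (at x)"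
    "\<And>x. x \<in> ball a r \<Longrightarrow> (\<Sum>i\<in>Basis. D2 x i \<bullet> i) = 0"
    using harm unfolding harmonic_on_def by blast
  \<comment> \<open>Subtracting a small multiple of the squared distance makes the Laplacian strictly negative
    while keeping the minimum inside the ball.\<close>
  define e where "e = - h y0 / (2 * r\<^sup>2)"
  have e: "0 < e" "e * r\<^sup>2 < - h y0"
    using neg r by (auto simp: e_def field_simps)
  define k where "k y = h y - e * ((y - a) \<bullet> (y - a))" for y
  have "continuous_on (cball a r) k"
    unfolding k_def[abs_def] by (intro continuous_intros cont)
  then obtain y1 where y1: "y1 \<in> cball a r" "\<And>y. y \<in> cball a r \<Longrightarrow> k y1 \<le> k y"
    using continuous_attains_inf[of "cball a r" k] r by auto
  have "k y1 \<le> h y0"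
    using y1(2)[of y0] y0 e(1) by (simp add: k_def) (smt (verit) inner_ge_zero mult_nonneg_nonneg)
  \<comment> \<open>On the sphere \<open>k\<close> is at least -e r^2, which exceeds
    \<open>h y0\<close> and hence the minimum of \<open>k\<close>.\<close>
  have "y1 \<in> ball a r"
  proof (rule ccontr)
    assume "y1 \<notin> ball a r"
    then have s: "y1 \<in> sphere a r" using y1(1) by auto
    then have "(y1 - a) \<bullet> (y1 - a) = r\<^sup>2"
      by (simp add: dot_square_norm dist_norm norm_minus_commute)
    then show False
      using bd[OF s] \<open>k y1 \<le> h y0\<close> e by (simp add: k_def)
  qed
  then obtain d where d: "0 < d" "ball y1 d \<subseteq> ball a r"
    using openE[OF open_ball] by blast
  \<comment> \<open>Along each coordinate line \<open>k\<close> has a minimum at \<open>y1\<close>,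
    and the subtracted quadratic has second derivative \<open>2 * e\<close>. Summed over the basis,
    this contradicts the vanishing Laplacian of \<open>h\<close>.\<close>
  have "2 * e \<le> D2 y1 i \<bullet> i" if i: "i \<in> Basis" for i
  proof -
    have in_ball: "y1 + t *\<^sub>R i \<in> ball a r" if "\<bar>t\<bar> < d" for t
    proof -
      have "y1 + t *\<^sub>R i \<in> ball y1 d" using that i by (simp add: dist_norm)
      then show ?thesis using d(2) by blast
    qed
    have "0 \<le> D2 y1 i \<bullet> i - 2 * e"
    proof (rule second_derivative_nonneg_at_min[OF d(1)])
      fix t :: real assume t: "\<bar>t\<bar> < d"
      have line: "((\<lambda>t. y1 + t *\<^sub>R i) has_derivative (\<lambda>s. s *\<^sub>R i)) (at t)"
        by (auto intro!: derivative_eq_intros)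
      have dh: "((\<lambda>t. h (y1 + t *\<^sub>R i)) has_derivative (\<lambda>s. D (y1 + t *\<^sub>R i) \<bullet> (s *\<^sub>R i))) (at t)"
        by (rule has_derivative_compose[OF line D(1)[OF in_ball[OF t]]])
      show "((\<lambda>t. k (y1 + t *\<^sub>R i)) has_real_derivative
          (D (y1 + t *\<^sub>R i) \<bullet> i - e * (2 * ((y1 + t *\<^sub>R i - a) \<bullet> i)))) (at t)"
        unfolding has_field_derivative_def k_def
        by (auto intro!: derivative_eq_intros dh simp: fun_eq_iff algebra_simps inner_commute)
      show "k (y1 + 0 *\<^sub>R i) \<le> k (y1 + t *\<^sub>R i)"
        using y1(2)[of "y1 + t *\<^sub>R i"] in_ball[OF t] by auto
    next
      have line: "((\<lambda>t. y1 + t *\<^sub>R i) has_derivative (\<lambda>s. s *\<^sub>R i)) (at 0)"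
        by (auto intro!: derivative_eq_intros)
      have D2': "(D has_derivative D2 y1) (at (y1 + 0 *\<^sub>R i))"
        using D(2)[OF \<open>y1 \<in> ball a r\<close>] by simp
      have dD: "((\<lambda>t. D (y1 + t *\<^sub>R i)) has_derivative (\<lambda>s. D2 y1 (s *\<^sub>R i))) (at 0)"
        by (rule has_derivative_compose[OF line D2'])
      interpret linear "D2 y1"
        using D(2)[OF \<open>y1 \<in> ball a r\<close>] by (rule has_derivative_linear)
      show "((\<lambda>t. D (y1 + t *\<^sub>R i) \<bullet> i - e * (2 * ((y1 + t *\<^sub>R i - a) \<bullet> i)))
          has_real_derivative (D2 y1 i \<bullet> i - 2 * e)) (at 0)"
        unfolding has_field_derivative_def using i
        by (auto intro!: derivative_eq_intros dD simp: fun_eq_iff algebra_simps scale)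
    qed
    then show ?thesis by simp
  qed
  then have "(\<Sum>i\<in>(Basis::'a set). 2 * e) \<le> (\<Sum>i\<in>Basis. D2 y1 i \<bullet> i)"
    by (rule sum_mono)
  then have "0 < (\<Sum>i\<in>Basis. D2 y1 i \<bullet> i)"
    using e(1) DIM_positive[where 'a='a] by (simp add: less_le_trans[rotated])
  then show False
    using D(3)[OF \<open>y1 \<in> ball a r\<close>] by simp
qed

section \<open>Maximum principle and comparison with the fundamental solution\<close>

lemma subharmonic_on_zero: "subharmonic_on (\<lambda>_. 0) (U :: 'a::euclidean_space set)"
  unfolding subharmonic_on_def
proof (intro conjI allI impI ballI continuous_on_const)
  fix a :: 'a and r h y
  assume *: "0 < r \<and> cball a r \<subseteq> U \<and> continuous_on (cball a r) h \<and> harmonic_on h (ball a r) \<and>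
      (\<forall>y\<in>sphere a r. 0 \<le> h y)" and y: "y \<in> ball a r"
  show "0 \<le> h y"
    by (rule harmonic_on_min_principle[OF _ _ _ _ y, of h]) (use * in simp_all)
qed

text \<open>
  Comparison with affine functions on balls suffices for the maximum principle: at a point of
  largest norm where the maximum is attained, the maximum set lies in a ball through that point,
  so that an affine function separates the point from the rest of the maximum set on a small
  sphere.
\<close>

lemma affine_maximum_principle:
  fixes w :: "'a::euclidean_space \<Rightarrow> real"
  assumes S: "open S" "bounded S" and cont: "continuous_on (closure S) w"
    and aff: "\<And>a r c l. 0 < r \<Longrightarrow> cball a r \<subseteq> S \<Longrightarrow> (\<And>y. y \<in> sphere a r \<Longrightarrow> w y \<le> c + l \<bullet> y) \<Longrightarrow> w a \<le> c + l \<bullet> a"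
    and bd: "\<And>z. z \<in> frontier S \<Longrightarrow> w z \<le> 0" and y0: "y0 \<in> S"
  shows "w y0 \<le> 0"
proof (rule ccontr)
  assume "\<not> w y0 \<le> 0"
  have cS: "compact (closure S)" using S(2) by (simp add: compact_closure)
  obtain ym where ym: "ym \<in> closure S" "\<And>y. y \<in> closure S \<Longrightarrow> w y \<le> w ym"
    using continuous_attains_sup[OF cS _ cont] y0 by auto
  define m where "m = w ym"
  have m: "0 < m" "\<And>y. y \<in> closure S \<Longrightarrow> w y \<le> m"
    using ym(2) y0 \<open>\<not> w y0 \<le> 0\<close> closure_subset[of S] by (force simp: m_def)+
  define E where "E = {y \<in> closure S. w y = m}"
  have "compact E"
  proof -
    have "closed (closure S \<inter> w -` {m})"
      by (rule continuous_closed_preimage[OF cont closed_closure closed_singleton])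
    moreover have "closure S \<inter> w -` {m} = E" by (auto simp: E_def)
    moreover have "bounded E"
      using bounded_closure[OF S(2)] by (rule bounded_subset) (auto simp: E_def)
    ultimately show ?thesis by (simp add: compact_eq_bounded_closed)
  qed
  moreover have "E \<noteq> {}" using ym by (auto simp: E_def m_def)
  ultimately obtain a where a: "a \<in> E" "\<And>y. y \<in> E \<Longrightarrow> norm y \<le> norm a"
    using continuous_attains_sup[of E norm] continuous_on_norm_id by blast
  have "a \<in> S"
    using a(1) bd[of a] m(1) S(1) by (force simp: E_def frontier_def interior_open)
  then obtain r where r: "0 < r" "cball a r \<subseteq> S"
    using S(1) open_contains_cball by blast
  \<comment> \<open>On the sphere, |y|^2 = |a|^2 + 2 a.(y - a) + r^2. A maximum point there has norm
    at most |a|, so -a.(y - a) is at least r^2/2 and \<open>q y\<close> at least r^2/4, whereas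
    \<open>q a\<close> is -r^2/4. Thus the zero set of \<open>q\<close> separates \<open>a\<close>
    from the maximum points on the sphere.\<close>
  define q where "q y = - (a \<bullet> (y - a)) - r\<^sup>2 / 4" for y
  define T where "T = {y \<in> sphere a r. q y \<le> 0}"
  have sub: "sphere a r \<subseteq> closure S"
    using r(2) closure_subset[of S] by (force simp: subset_iff)
  have wT: "w y < m" if "y \<in> T" for y
  proof (rule ccontr)
    assume "\<not> w y < m"
    then have "y \<in> E" using that sub m(2)[of y] by (force simp: T_def E_def)
    then have "norm y \<le> norm a" by (rule a(2))
    then have "y \<bullet> y \<le> a \<bullet> a" by (simp add: norm_le)
    moreover have "(y - a) \<bullet> (y - a) = r\<^sup>2"
      using that by (simp add: T_def dot_square_norm dist_norm norm_minus_commute)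
    ultimately have "2 * (a \<bullet> (y - a)) + r\<^sup>2 \<le> 0"
      by (simp add: inner_diff_left inner_diff_right inner_commute)
    then have "0 < q y" using r(1) by (simp add: q_def) (smt (verit) zero_less_power)
    then show False using that by (simp add: T_def)
  qed
  have cT: "compact T"
  proof -
    have "closed {y. q y \<le> 0}"
      unfolding q_def by (intro closed_Collect_le continuous_intros)
    then have "compact (sphere a r \<inter> {y. q y \<le> 0})"
      by (intro compact_Int_closed) auto
    moreover have "sphere a r \<inter> {y. q y \<le> 0} = T" by (auto simp: T_def)
    ultimately show ?thesis by simp
  qed
  obtain m' where m': "m' < m" "\<And>y. y \<in> T \<Longrightarrow> w y \<le> m'"
  proof (cases "T = {}")
    case True
    then show ?thesis using that[of "m - 1"] by auto
  next
    case False
    have "continuous_on T w"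
      using cont by (rule continuous_on_subset) (use sub in \<open>auto simp: T_def\<close>)
    then obtain y where "y \<in> T" "\<And>z. z \<in> T \<Longrightarrow> w z \<le> w y"
      using continuous_attains_sup[OF cT False, of w] by blast
    then show ?thesis using that[of "w y"] wT by auto
  qed
  define Q where "Q = norm a * r + r\<^sup>2 / 4"
  have Q: "0 < Q" using r(1) by (simp add: Q_def add_nonneg_pos)
  have qQ: "- Q \<le> q y" if "y \<in> sphere a r" for y
    using that Cauchy_Schwarz_ineq2[of a "y - a"]
    by (simp add: q_def Q_def dist_norm norm_minus_commute)
  \<comment> \<open>The slope keeps the affine function m + \<delta> q above \<open>w\<close> on the
    sphere: off \<open>T\<close> it is at least \<open>m\<close>, and on \<open>T\<close> at least m
    - \<delta> Q = m'. At \<open>a\<close> it lies below \<open>m\<close>, the value of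
    \<open>w\<close> there.\<close>
  define \<delta> where "\<delta> = (m - m') / Q"
  have \<delta>: "0 < \<delta>" "\<delta> * Q = m - m'" using m'(1) Q by (auto simp: \<delta>_def)
  have eq: "m + \<delta> * q y = (m + \<delta> * (a \<bullet> a - r\<^sup>2 / 4)) + (- \<delta> *\<^sub>R a) \<bullet> y" for y
    by (simp add: q_def inner_diff_right algebra_simps)
  have "w a \<le> m + \<delta> * q a"
    unfolding eq
  proof (rule aff[OF r])
    fix y assume y: "y \<in> sphere a r"
    have "w y \<le> m + \<delta> * q y"
    proof (cases "y \<in> T")
      case True
      have "\<delta> * (- Q) \<le> \<delta> * q y" using qQ[OF y] \<delta>(1) by (intro mult_left_mono) auto
      then show ?thesis using m'(2)[OF True] \<delta>(2) by simp
    next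
      case False
      then have "0 \<le> \<delta> * q y" using y \<delta>(1) by (simp add: T_def)
      then show ?thesis using m(2)[of y] y sub by force
    qed
    then show "w y \<le> m + \<delta> * (a \<bullet> a - r\<^sup>2 / 4) + (- \<delta> *\<^sub>R a) \<bullet> y"
      unfolding eq .
  qed
  moreover have "\<delta> * q a < 0" using \<delta>(1) r(1) by (simp add: q_def mult_pos_neg)
  ultimately show False using a(1) by (simp add: E_def)
qed

lemma fundamental_solution_nonneg: "0 \<le> fundamental_solution z"
  by (simp add: fundamental_solution_def)

lemma continuous_on_fundamental_solution:
  fixes x :: "'a::euclidean_space"
  assumes "x \<notin> S"
  shows "continuous_on S (\<lambda>y. fundamental_solution (x - y))"
  unfolding fundamental_solution_def using assms by (intro continuous_intros) auto

text \<open>The pole is cut out by a closed ball on whose sphere \<Gamma> exceeds \<open>v\<close>.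
  On the remaining set \<open>v\<close> minus \<Gamma> satisfies the affine comparison hypothesis:
  \<Gamma> plus an affine function is harmonic on balls that avoid the pole, so subharmonicity of
  \<open>v\<close> applies to it.\<close>

lemma subharmonic_le_fundamental_solution:
  fixes x :: "'a::euclidean_space"
  assumes dim: "3 \<le> DIM('a)" and U: "open U" "bounded U" and x: "x \<in> U" and y: "y \<in> U" "y \<noteq> x"
    and v: "continuous_on (closure U) v" "subharmonic_on v U"
    and bd: "\<And>z. z \<in> frontier U \<Longrightarrow> v z \<le> fundamental_solution (x - z)"
  shows "v y \<le> fundamental_solution (x - y)"
proof -
  define C where "C = 1 / (real DIM('a) * measure lborel (ball (0::'a) 1) * real (DIM('a) - 2))"
  have C: "0 < C"
    using dim content_ball_pos[of 1 "0::'a"] by (simp add: C_def)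
  have \<Gamma>: "fundamental_solution z = C * (1 / norm z ^ (DIM('a) - 2))" for z :: 'a
    by (simp add: fundamental_solution_def C_def)
  obtain B where B: "0 \<le> B" "\<And>z. z \<in> closure U \<Longrightarrow> v z \<le> B"
  proof -
    have "compact (closure U)" using U(2) by (simp add: compact_closure)
    then obtain z0 where "\<And>z. z \<in> closure U \<Longrightarrow> v z \<le> v z0"
      using continuous_attains_sup[OF _ _ v(1)] x closure_subset by blast
    then show ?thesis using that[of "\<bar>v z0\<bar>"] by force
  qed
  obtain r0 where r0: "0 < r0" "cball x r0 \<subseteq> U"
    using U(1) x open_contains_cball by blast
  \<comment> \<open>Each entry has a purpose: \<open>r0\<close> keeps the ball inside
    \<open>U\<close>, half the distance keeps \<open>y\<close> outside the ball, 1 gives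
    \<rho>^(n-2) \<le> \<rho>, and \<open>C / (B + 1)\<close> makes C/\<rho>, a lower bound of
    \<Gamma> on the sphere, at least \<open>B + 1\<close>.\<close>
  define \<rho> where "\<rho> = Min {r0, dist x y / 2, 1, C / (B + 1)}"
  have \<rho>: "0 < \<rho>" "\<rho> \<le> r0" "\<rho> < dist x y" "\<rho> \<le> 1" "\<rho> \<le> C / (B + 1)"
  proof -
    have "0 < dist x y" using y(2) by simp
    moreover have "\<rho> \<le> dist x y / 2" unfolding \<rho>_def by (rule Min_le) auto
    ultimately show "\<rho> < dist x y" by linarith
    show "0 < \<rho>" using r0 y(2) C B by (simp add: \<rho>_def)
    show "\<rho> \<le> r0" "\<rho> \<le> 1" "\<rho> \<le> C / (B + 1)" unfolding \<rho>_def by (rule Min_le; simp)+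
  qed
  define S where "S = U - cball x \<rho>"
  have clS: "closure S \<subseteq> closure U - ball x \<rho>"
  proof -
    have "closure S \<subseteq> closure U" unfolding S_def by (intro closure_mono) auto
    moreover have "closure S \<subseteq> - ball x \<rho>"
      by (rule closure_minimal) (auto simp: S_def)
    ultimately show ?thesis by blast
  qed
  have xS: "x \<notin> closure S" using clS \<rho>(1) by auto
  have openS: "open S" using U(1) by (simp add: S_def open_Diff)
  have "v y - fundamental_solution (x - y) \<le> 0"
  proof (rule affine_maximum_principle[OF openS, where w = "\<lambda>y. v y - fundamental_solution (x - y)"])
    show "bounded S" using U(2) by (rule bounded_subset) (auto simp: S_def)
    show "continuous_on (closure S) (\<lambda>y. v y - fundamental_solution (x - y))"
      using clS by (intro continuous_on_diff continuous_on_fundamental_solution xS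
          continuous_on_subset[OF v(1)]) auto
    show "y \<in> S" using y \<rho>(3) by (simp add: S_def)
    show "v z - fundamental_solution (x - z) \<le> 0" if z: "z \<in> frontier S" for z
    proof (cases "z \<in> U")
      case False
      then have "z \<in> frontier U"
        using z clS U(1) by (auto simp: frontier_def interior_open)
      then show ?thesis using bd by simp
    next
      case True
      then have "z \<in> sphere x \<rho>"
        using z clS openS by (auto simp: frontier_def interior_open S_def)
      then have "norm (x - z) = \<rho>" by (simp add: dist_norm)
      moreover have "\<rho> ^ (DIM('a) - 2) \<le> \<rho> ^ 1"
        using \<rho> dim by (intro power_decreasing) auto
      ultimately have "C * (1 / \<rho>) \<le> fundamental_solution (x - z)"
        unfolding \<Gamma> using C \<rho>(1) by (intro mult_left_mono divide_left_mono) auto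
      moreover have "B + 1 \<le> C * (1 / \<rho>)"
        using \<rho>(1,5) B(1) C by (simp add: field_simps)
      moreover have "v z \<le> B" using B(2) True closure_subset by blast
      ultimately show ?thesis by linarith
    qed
    fix a r c l
    assume r: "0 < r" "cball a r \<subseteq> S"
      and le: "\<And>y. y \<in> sphere a r \<Longrightarrow> v y - fundamental_solution (x - y) \<le> c + l \<bullet> y"
    define h where "h y = fundamental_solution (x - y) + (c + l \<bullet> y)" for y
    have xb: "x \<notin> cball a r" using r(2) xS closure_subset by blast
    have "continuous_on (cball a r) h"
      unfolding h_def[abs_def] by (intro continuous_intros continuous_on_fundamental_solution xb)
    moreover have "harmonic_on h (ball a r)"
      unfolding h_def[abs_def] using xb
      by (intro harmonic_on_add harmonic_on_fundamental_solution[OF dim] harmonic_on_affine) auto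
    moreover have "\<forall>y\<in>sphere a r. v y \<le> h y"
      using le by (force simp: h_def simp del: mem_sphere)
    moreover have "cball a r \<subseteq> U" using r(2) by (auto simp: S_def)
    ultimately have "\<forall>y\<in>ball a r. v y \<le> h y"
      using v(2) r(1) unfolding subharmonic_on_def by blast
    then have "v a \<le> h a" using r(1) by simp
    then show "v a - fundamental_solution (x - a) \<le> c + l \<bullet> a" by (simp add: h_def)
  qed
  then show ?thesis by simp
qed

section \<open>Bounds and measurability of the Green function\<close>

context
  fixes U :: "'a::euclidean_space set" and x :: 'a
  assumes dim: "3 \<le> DIM('a)" and U: "open U" "bounded U" and x: "x \<in> U"
begin

abbreviation "perron_class \<equiv> {v. continuous_on (closure U) v \<and> subharmonic_on v U \<and>
    (\<forall>z\<in>frontier U. v z \<le> fundamental_solution (x - z))}"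

lemma perron_fundamental_eq:
  "perron_solution U (\<lambda>z. fundamental_solution (x - z)) y = (SUP v\<in>perron_class. v y)"
  unfolding perron_solution_def by (simp only: setcompr_eq_image)

lemma zero_in_perron_class: "(\<lambda>_. 0) \<in> perron_class"
  by (simp add: subharmonic_on_zero fundamental_solution_nonneg)

lemma perron_class_le:
  "v \<in> perron_class \<Longrightarrow> y \<in> U \<Longrightarrow> y \<noteq> x \<Longrightarrow> v y \<le> fundamental_solution (x - y)"
  by (rule subharmonic_le_fundamental_solution[OF dim U x]) simp_all

lemma perron_class_bdd:
  "y \<in> U \<Longrightarrow> y \<noteq> x \<Longrightarrow> bdd_above ((\<lambda>v. v y) ` perron_class)"
  using perron_class_le by (intro bdd_aboveI2[where M="fundamental_solution (x - y)"])

text \<open>Comparison with \<Gamma> bounds the Perron supremum from above, which makes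
  \<open>green\<close> nonnegative. The zero function competes in the supremum, which gives the
  upper bound. The pole is excluded because \<open>fundamental_solution 0\<close> is 0 and not
  infinite.\<close>

lemma green_bounds:
  assumes y: "y \<in> U" "y \<noteq> x"
  shows "0 \<le> green U x y" "green U x y \<le> fundamental_solution (x - y)"
proof -
  have "(SUP v\<in>perron_class. v y) \<le> fundamental_solution (x - y)"
    using zero_in_perron_class perron_class_le[OF _ y] by (intro cSUP_least) auto
  then show "0 \<le> green U x y"
    by (simp add: green_def perron_fundamental_eq)
  have "(\<lambda>_. 0) y \<le> (SUP v\<in>perron_class. v y)"
    using cSUP_upper[OF zero_in_perron_class perron_class_bdd[OF y]] by simp
  then show "green U x y \<le> fundamental_solution (x - y)"
    by (simp add: green_def perron_fundamental_eq)
qed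

text \<open>A supremum of continuous functions, even over an uncountable class, is lower
  semicontinuous: its superlevel sets are unions of open sets. The bound that makes the supremum
  meaningful is available off the pole, so the single point \<open>x\<close> is treated
  separately.\<close>

lemma green_measurable: "green U x \<in> borel_measurable (lebesgue_on U)"
proof -
  let ?p = "\<lambda>y. SUP v\<in>perron_class. v y"
  have "?p \<in> borel_measurable (restrict_space borel U)"
  proof (rule borel_measurable_iff_greater[THEN iffD2], rule allI)
    fix t :: real
    define V where "V = (\<Union>v\<in>perron_class. {y \<in> U - {x}. t < v y})"
    have oU: "open (U - {x})" using U(1) by auto
    have "open V"
      unfolding V_def
    proof (rule open_UN, rule ballI)
      fix v assume "v \<in> perron_class"
      then have "continuous_on (U - {x}) v"
        using closure_subset[of U] by (auto intro: continuous_on_subset)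
      then have "open ((U - {x}) \<inter> v -` {t<..})"
        using oU by (intro continuous_open_preimage) auto
      moreover have "(U - {x}) \<inter> v -` {t<..} = {y \<in> U - {x}. t < v y}" by auto
      ultimately show "open {y \<in> U - {x}. t < v y}" by simp
    qed
    have eq: "{y \<in> U. t < ?p y} = V \<union> ({x} \<inter> {y. t < ?p y})"
      using x less_cSUP_iff[OF _ perron_class_bdd, of _ t] zero_in_perron_class
      unfolding V_def by blast
    have "{x} \<inter> {y. t < ?p y} \<in> sets borel"
      by (cases "t < ?p x") auto
    then have "{y \<in> U. t < ?p y} \<in> sets borel"
      unfolding eq using \<open>open V\<close> by (intro sets.Un) auto
    then show "{y \<in> space (restrict_space borel U). t < ?p y} \<in> sets (restrict_space borel U)"
      using U(1) by (auto simp: sets_restrict_space_iff space_restrict_space)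
  qed
  moreover have "(\<lambda>y. fundamental_solution (x - y)) \<in> borel_measurable (restrict_space borel U)"
    by (rule measurable_restrict_space1) (simp add: fundamental_solution_def)
  ultimately have "(\<lambda>y. fundamental_solution (x - y) - ?p y) \<in> borel_measurable (restrict_space borel U)"
    by (rule borel_measurable_diff[rotated])
  then have "green U x \<in> borel_measurable (restrict_space borel U)"
    by (simp add: green_def[abs_def] perron_fundamental_eq)
  moreover have "borel_measurable (restrict_space borel U) \<subseteq> borel_measurable (lebesgue_on U)"
  proof (rule measurable_mono)
    have "sets borel \<subseteq> sets (lebesgue :: 'a measure)"
      by (auto intro: sets_completionI_sets)
    then show "sets (restrict_space borel U) \<subseteq> sets (lebesgue_on U)"
      unfolding sets_restrict_space by (rule image_mono)
  qed (simp_all add: space_restrict_space)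
  ultimately show ?thesis by blast
qed

end

section \<open>The integral of the fundamental solution\<close>

lemma inverse_power_layer_cake:
  fixes s d :: real
  assumes "0 < s" "s \<le> d" "0 < m"
  shows "ennreal (1 / s ^ m) = ennreal (1 / d ^ m)
    + (\<integral>\<^sup>+r. ennreal (real m / r ^ (m + 1)) * indicator {s..d} r \<partial>lborel)"
proof -
  have "(\<integral>\<^sup>+r. ennreal (real m / r ^ (m + 1)) * indicator {s..d} r \<partial>lborel)
      = ennreal ((- 1 / d ^ m) - (- 1 / s ^ m))"
  proof (rule nn_integral_FTC_Icc[where F = "\<lambda>r. - 1 / r ^ m" and f = "\<lambda>r. real m / r ^ (m + 1)"])
    fix r assume "r \<in> {s..d}"
    then have r: "s \<le> r" "r \<le> d" by auto
    then have "r \<noteq> 0" using assms by auto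
    have "r ^ m = r * r ^ (m - 1)" using assms(3) by (cases m) auto
    then show "((\<lambda>r. - 1 / r ^ m) has_real_derivative real m / r ^ (m + 1)) (at r)"
      using \<open>r \<noteq> 0\<close> by (auto intro!: derivative_eq_intros simp: field_simps)
    show "0 \<le> real m / r ^ (m + 1)" using r assms by auto
  qed (use assms in auto)
  moreover have "1 / d ^ m \<le> 1 / s ^ m"
    using assms by (intro divide_left_mono power_mono) auto
  ultimately show ?thesis
    using assms by (simp add: ennreal_plus[symmetric] del: ennreal_plus)
qed

text \<open>The layer-cake formula takes the place of polar coordinates: after the integrals are
  interchanged, only ball volumes \<alpha> r^(m+2) remain, with m = n - 2. The integral over the
  radii contributes m \<alpha> d^2/2 and the constant term \<alpha> d^2, together n \<alpha>
  d^2/2.\<close>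

lemma nn_integral_inverse_power_cball:
  fixes d :: real
  assumes dim: "3 \<le> DIM('a::euclidean_space)" and d: "0 < d"
  shows "(\<integral>\<^sup>+z\<in>cball (0::'a) d. ennreal (1 / norm z ^ (DIM('a) - 2)) \<partial>lborel)
    \<le> ennreal (real DIM('a) * measure lborel (ball (0::'a) 1) * d\<^sup>2 / 2)"
proof -
  define m where "m = DIM('a) - 2"
  define \<alpha> where "\<alpha> = measure lborel (ball (0::'a) 1)"
  have m: "0 < m" "DIM('a) = m + 2" using dim by (auto simp: m_def)
  have vol: "emeasure lborel (cball (0::'a) r) = ennreal (\<alpha> * r ^ (m + 2))" if "0 \<le> r" for r
  proof -
    have "emeasure lborel (cball (0::'a) r) = ennreal (unit_ball_vol (real DIM('a)) * r ^ DIM('a))"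
      by (rule emeasure_cball[OF that])
    moreover have "\<alpha> = unit_ball_vol (real DIM('a))"
      by (simp add: \<alpha>_def content_ball)
    ultimately show ?thesis by (simp add: m(2))
  qed
  have \<alpha>: "0 \<le> \<alpha>" by (simp add: \<alpha>_def)
  have [measurable]: "cball (0::'a) d \<in> sets borel" by simp
  define k :: "'a \<Rightarrow> real \<Rightarrow> ennreal" where
    "k z r = (if norm z \<le> r \<and> r \<le> d then ennreal (real m / r ^ (m + 1)) else 0)" for z r
  have km: "(\<lambda>(z, r). k z r) \<in> borel_measurable (lborel \<Otimes>\<^sub>M lborel)"
    unfolding k_def by measurable
  have "(\<integral>\<^sup>+z\<in>cball (0::'a) d. ennreal (1 / norm z ^ (DIM('a) - 2)) \<partial>lborel)
      \<le> (\<integral>\<^sup>+z. ennreal (1 / d ^ m) * indicator (cball 0 d) z + (\<integral>\<^sup>+r. k z r \<partial>lborel) \<partial>lborel)"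
  proof (rule nn_integral_mono)
    fix z :: 'a
    show "ennreal (1 / norm z ^ (DIM('a) - 2)) * indicator (cball 0 d) z
        \<le> ennreal (1 / d ^ m) * indicator (cball 0 d) z + (\<integral>\<^sup>+r. k z r \<partial>lborel)"
    proof (cases "z \<noteq> 0 \<and> norm z \<le> d")
      case True
      have "(\<integral>\<^sup>+r. k z r \<partial>lborel) = (\<integral>\<^sup>+r. ennreal (real m / r ^ (m + 1)) * indicator {norm z..d} r \<partial>lborel)"
        by (intro nn_integral_cong) (auto simp: k_def)
      then show ?thesis
        using True inverse_power_layer_cake[of "norm z" d m] m(1) by (simp add: m_def[symmetric])
    next
      case False
      then show ?thesis using m(1) by (auto simp: m_def[symmetric] zero_power)
    qed
  qed
  also have "\<dots> = ennreal (1 / d ^ m) * emeasure lborel (cball (0::'a) d)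
      + (\<integral>\<^sup>+z. (\<integral>\<^sup>+r. k z r \<partial>lborel) \<partial>lborel)"
    using lborel.borel_measurable_nn_integral[OF km]
    by (subst nn_integral_add) (auto simp: nn_integral_cmult_indicator)
  also have "(\<integral>\<^sup>+z. (\<integral>\<^sup>+r. k z r \<partial>lborel) \<partial>lborel) = (\<integral>\<^sup>+r. (\<integral>\<^sup>+z. k z r \<partial>lborel) \<partial>lborel)"
    using lborel_pair.Fubini'[OF km] by simp
  also have "\<dots> = (\<integral>\<^sup>+r. ennreal (real m * \<alpha> * r) * indicator {0..d} r \<partial>lborel)"
  proof (rule nn_integral_cong)
    fix r :: real
    show "(\<integral>\<^sup>+z. k z r \<partial>lborel) = ennreal (real m * \<alpha> * r) * indicator {0..d} r"
    proof (cases "0 \<le> r \<and> r \<le> d")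
      case True
      have "(\<integral>\<^sup>+z. k z r \<partial>lborel) = (\<integral>\<^sup>+z. ennreal (real m / r ^ (m + 1)) * indicator (cball (0::'a) r) z \<partial>lborel)"
        using True by (intro nn_integral_cong) (auto simp: k_def)
      also have "\<dots> = ennreal (real m / r ^ (m + 1)) * ennreal (\<alpha> * r ^ (m + 2))"
        using True by (simp add: nn_integral_cmult_indicator vol)
      also have "\<dots> = ennreal (real m / r ^ (m + 1) * (\<alpha> * r ^ (m + 2)))"
        using True \<alpha> by (intro ennreal_mult[symmetric]) auto
      \<comment> \<open>At \<open>r = 0\<close> both sides are 0 because division by 0 gives
        0.\<close>
      also have "real m / r ^ (m + 1) * (\<alpha> * r ^ (m + 2)) = real m * \<alpha> * r"
        by (cases "r = 0") (auto simp: field_simps)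
      finally show ?thesis using True by simp
    next
      case False
      then have "k z r = 0" for z
        unfolding k_def using norm_ge_zero[of z] by (smt (verit))
      then show ?thesis using False by auto
    qed
  qed
  also have "\<dots> = ennreal (real m * \<alpha> * d\<^sup>2 / 2 - real m * \<alpha> * 0\<^sup>2 / 2)"
    using d \<alpha> by (intro nn_integral_FTC_Icc[where F = "\<lambda>r. real m * \<alpha> * r\<^sup>2 / 2"])
      (auto intro!: derivative_eq_intros)
  also have "ennreal (1 / d ^ m) * emeasure lborel (cball (0::'a) d) = ennreal (\<alpha> * d\<^sup>2)"
    using d \<alpha> by (simp add: vol ennreal_mult[symmetric] power_add power2_eq_square)
  also have "ennreal (\<alpha> * d\<^sup>2) + ennreal (real m * \<alpha> * d\<^sup>2 / 2 - real m * \<alpha> * 0\<^sup>2 / 2)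
      = ennreal (\<alpha> * d\<^sup>2 + real m * \<alpha> * d\<^sup>2 / 2)"
    using \<alpha> by (subst ennreal_plus[symmetric]) auto
  also have "\<alpha> * d\<^sup>2 + real m * \<alpha> * d\<^sup>2 / 2 = real DIM('a) * measure lborel (ball (0::'a) 1) * d\<^sup>2 / 2"
    unfolding m(2) \<alpha>_def by (simp add: field_simps)
  finally show ?thesis .
qed

lemma diameter_open_pos:
  fixes U :: "'a::euclidean_space set"
  assumes "open U" "bounded U" "x \<in> U"
  shows "0 < diameter U"
proof -
  obtain r where r: "0 < r" "cball x r \<subseteq> U"
    using assms open_contains_cball by blast
  then have "diameter (cball x r) \<le> diameter U"
    using assms(2) by (intro diameter_subset)
  then show ?thesis using r(1) by simp
qed

text \<open>All of \<open>U\<close> lies within the diameter d of \<open>x\<close>, so the integral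
  is at most the one over a ball of radius d. The value n \<alpha> d^2/2 there, times the constant
  1/(n \<alpha> (n-2)) of \<Gamma>, is \<open>l0 U\<close>.\<close>

lemma nn_integral_fundamental_solution:
  fixes U :: "'a::euclidean_space set"
  assumes dim: "3 \<le> DIM('a)" and U: "open U" "bounded U" and x: "x \<in> U"
  shows "(\<integral>\<^sup>+y. ennreal (fundamental_solution (x - y)) \<partial>lebesgue_on U) \<le> ennreal (l0 U)"
proof -
  define d where "d = diameter U"
  have d: "0 < d" unfolding d_def by (rule diameter_open_pos[OF U x])
  define C where "C = 1 / (real DIM('a) * measure lborel (ball (0::'a) 1) * real (DIM('a) - 2))"
  have C: "0 \<le> C" by (simp add: C_def)
  have [measurable]: "cball (0::'a) d \<in> sets borel" by simp
  have \<alpha>: "0 < measure lborel (ball (0::'a) 1)" using content_ball_pos[of 1 "0::'a"] by simp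
  have sU: "U \<in> sets lebesgue" using U(1) by simp
  have "(\<integral>\<^sup>+y. ennreal (fundamental_solution (x - y)) \<partial>lebesgue_on U)
      = (\<integral>\<^sup>+y. ennreal (fundamental_solution (x - y)) * indicator U y \<partial>lborel)"
    using sU by (simp add: nn_integral_restrict_space nn_integral_completion)
  also have "\<dots> \<le> (\<integral>\<^sup>+y. ennreal C * (ennreal (1 / norm (x - y) ^ (DIM('a) - 2)) * indicator (cball 0 d) (x - y)) \<partial>lborel)"
  proof (rule nn_integral_mono)
    fix y
    have "y \<in> U \<Longrightarrow> norm (x - y) \<le> d"
      using diameter_bounded_bound[OF U(2) x] by (simp add: d_def dist_norm)
    then show "ennreal (fundamental_solution (x - y)) * indicator U y
        \<le> ennreal C * (ennreal (1 / norm (x - y) ^ (DIM('a) - 2)) * indicator (cball 0 d) (x - y))"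
      using C by (auto simp: fundamental_solution_def C_def[symmetric] ennreal_mult[symmetric] indicator_def)
  qed
  also have "\<dots> = ennreal C * (\<integral>\<^sup>+y. ennreal (1 / norm (x - y) ^ (DIM('a) - 2)) * indicator (cball 0 d) (x - y) \<partial>lborel)"
    by (rule nn_integral_cmult) measurable
  also have "(\<integral>\<^sup>+y. ennreal (1 / norm (x - y) ^ (DIM('a) - 2)) * indicator (cball 0 d) (x - y) \<partial>lborel)
      = (\<integral>\<^sup>+z\<in>cball (0::'a) d. ennreal (1 / norm z ^ (DIM('a) - 2)) \<partial>lborel)"
  proof -
    have "(\<integral>\<^sup>+z\<in>cball (0::'a) d. ennreal (1 / norm z ^ (DIM('a) - 2)) \<partial>lborel)
        = (\<integral>\<^sup>+z. ennreal (1 / norm z ^ (DIM('a) - 2)) * indicator (cball 0 d) z \<partial>distr lborel borel ((+) (- x)))"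
      by (simp only: lborel_distr_plus)
    also have "\<dots> = (\<integral>\<^sup>+y. ennreal (1 / norm (- x + y) ^ (DIM('a) - 2)) * indicator (cball 0 d) (- x + y) \<partial>lborel)"
      by (rule nn_integral_distr) auto
    also have "\<dots> = (\<integral>\<^sup>+y. ennreal (1 / norm (x - y) ^ (DIM('a) - 2)) * indicator (cball 0 d) (x - y) \<partial>lborel)"
      by (intro nn_integral_cong) (simp add: indicator_def norm_minus_commute)
    finally show ?thesis by simp
  qed
  also have "ennreal C * \<dots> \<le> ennreal C * ennreal (real DIM('a) * measure lborel (ball (0::'a) 1) * d\<^sup>2 / 2)"
    by (intro mult_left_mono nn_integral_inverse_power_cball[OF dim d]) simp
  also have "\<dots> = ennreal (C * (real DIM('a) * measure lborel (ball (0::'a) 1) * d\<^sup>2 / 2))"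
    using C by (intro ennreal_mult[symmetric]) auto
  also have "C * (real DIM('a) * measure lborel (ball (0::'a) 1) * d\<^sup>2 / 2) = l0 U"
    using \<alpha> dim by (simp add: C_def l0_def d_def of_nat_diff field_simps)
  finally show ?thesis .
qed

lemma l0_pos:
  fixes U :: "'a::euclidean_space set"
  assumes "3 \<le> DIM('a)" "open U" "bounded U" "x \<in> U"
  shows "0 < l0 U"
  using diameter_open_pos[OF assms(2-4)] assms(1) by (simp add: l0_def)

lemma
  fixes U :: "'a::euclidean_space set"
  assumes dim: "3 \<le> DIM('a)" and U: "open U" "bounded U" and x: "x \<in> U"
  shows green_nonneg_AE: "AE y in lebesgue_on U. 0 \<le> green U x y"
    and green_integrable: "integrable (lebesgue_on U) (green U x)"
    and green_integral_le: "(\<integral>y. green U x y \<partial>lebesgue_on U) \<le> l0 U"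
proof -
  have sU: "U \<in> sets lebesgue" using U(1) by simp
  have ae: "AE y in lebesgue_on U. y \<in> U \<and> y \<noteq> x"
  proof -
    have "AE y in lebesgue. y \<noteq> x"
      by (rule AE_completion) (rule AE_lborel_singleton)
    then show ?thesis using sU by (auto simp: AE_restrict_space_iff)
  qed
  show nn: "AE y in lebesgue_on U. 0 \<le> green U x y"
    using ae by eventually_elim (auto intro: green_bounds(1)[OF dim U x])
  have bound: "(\<integral>\<^sup>+y. ennreal (green U x y) \<partial>lebesgue_on U) \<le> ennreal (l0 U)"
  proof -
    have "(\<integral>\<^sup>+y. ennreal (green U x y) \<partial>lebesgue_on U)
        \<le> (\<integral>\<^sup>+y. ennreal (fundamental_solution (x - y)) \<partial>lebesgue_on U)"
      by (rule nn_integral_mono_AE)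
        (use ae in eventually_elim, auto intro!: ennreal_leI green_bounds(2)[OF dim U x])
    then show ?thesis using nn_integral_fundamental_solution[OF dim U x] by simp
  qed
  show "integrable (lebesgue_on U) (green U x)"
    using green_measurable[OF dim U x] nn bound
    by (intro integrableI_nonneg) (auto intro: le_less_trans)
  show "(\<integral>y. green U x y \<partial>lebesgue_on U) \<le> l0 U"
    using green_measurable[OF dim U x] nn bound l0_pos[OF dim U x]
    by (intro integral_real_bounded) auto
qed

section \<open>The Green operator on L^infinity\<close>

lemma
  fixes U :: "'a::euclidean_space set"
  assumes dim: "3 \<le> DIM('a)" and U: "open U" "bounded U" and x: "x \<in> U" and \<phi>: "\<phi> \<in> Linf U"
  shows green_op_integrable: "integrable (lebesgue_on U) (\<lambda>y. green U x y * \<phi> y)"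
    and green_op_bound: "\<bar>green_op U \<phi> x\<bar> \<le> l0 U * Linf_norm U \<phi>"
proof -
  note gi = green_integrable[OF dim U x]
  have ae: "AE y in lebesgue_on U. \<bar>green U x y * \<phi> y\<bar> \<le> green U x y * Linf_norm U \<phi>"
    using green_nonneg_AE[OF dim U x] Linf_AE_le[OF \<phi>]
    by eventually_elim (auto simp: abs_mult intro: mult_left_mono)
  show int: "integrable (lebesgue_on U) (\<lambda>y. green U x y * \<phi> y)"
  proof (rule Bochner_Integration.integrable_bound)
    show "integrable (lebesgue_on U) (\<lambda>y. green U x y * Linf_norm U \<phi>)" using gi by simp
    show "(\<lambda>y. green U x y * \<phi> y) \<in> borel_measurable (lebesgue_on U)"
      by (intro borel_measurable_times green_measurable[OF dim U x] Linf_measurable \<phi>)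
    show "AE y in lebesgue_on U. norm (green U x y * \<phi> y) \<le> norm (green U x y * Linf_norm U \<phi>)"
      using ae by eventually_elim simp
  qed
  have "\<bar>green_op U \<phi> x\<bar> \<le> (\<integral>y. \<bar>green U x y * \<phi> y\<bar> \<partial>lebesgue_on U)"
    unfolding green_op_def by (rule integral_abs_bound)
  also have "\<dots> \<le> (\<integral>y. green U x y * Linf_norm U \<phi> \<partial>lebesgue_on U)"
    using int gi ae by (intro integral_mono_AE) auto
  also have "\<dots> = (\<integral>y. green U x y \<partial>lebesgue_on U) * Linf_norm U \<phi>" by simp
  also have "\<dots> \<le> l0 U * Linf_norm U \<phi>"
    by (intro mult_right_mono green_integral_le[OF dim U x] Linf_norm_nonneg)
  finally show "\<bar>green_op U \<phi> x\<bar> \<le> l0 U * Linf_norm U \<phi>" .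
qed

lemma green_op_diff:
  fixes U :: "'a::euclidean_space set"
  assumes "3 \<le> DIM('a)" "open U" "bounded U" "x \<in> U" "\<phi> \<in> Linf U" "\<psi> \<in> Linf U"
  shows "green_op U \<phi> x - green_op U \<psi> x = green_op U (\<lambda>y. \<phi> y - \<psi> y) x"
  unfolding green_op_def
  using green_op_integrable[OF assms(1-5)] green_op_integrable[OF assms(1-4,6)]
  by (simp add: right_diff_distrib)

subsection \<open>Stability of the integral equation\<close>

text \<open>For positive \<open>t\<close> this is the mean value theorem. At \<open>t = 0\<close>,
  where \<open>powr\<close> offers no derivative, the bound s^p = s^(p-1) s \<le> p R^(p-1) s is
  used.\<close>

lemma powr_diff_le:
  fixes s t R p :: real
  assumes "1 < p" "0 \<le> t" "t \<le> s" "s \<le> R"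
  shows "s powr p - t powr p \<le> p * R powr (p - 1) * (s - t)"
proof (cases "0 < t \<and> t < s")
  case True
  have "\<exists>z>t. z < s \<and> s powr p - t powr p = (s - t) * (p * z powr (p - 1))"
    using True by (intro MVT2) (auto intro!: derivative_eq_intros)
  then obtain z where z: "t < z" "z < s" "s powr p - t powr p = (s - t) * (p * z powr (p - 1))"
    by blast
  have "(s - t) * (p * z powr (p - 1)) \<le> (s - t) * (p * R powr (p - 1))"
    using z True assms by (intro mult_left_mono powr_mono2) auto
  then show ?thesis using z(3) by (simp add: mult.commute)
next
  case False
  then consider "t = s" | "t = 0" "t < s" using assms by linarith
  then show ?thesis
  proof cases
    case 2
    have "s powr p = s powr (p - 1) * s"
      using 2 powr_add[of s "p - 1" 1] by simp
    also have "\<dots> \<le> R powr (p - 1) * s"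
      using 2 assms by (intro mult_right_mono powr_mono2) auto
    also have "\<dots> \<le> (p * R powr (p - 1)) * s"
      using 2 assms mult_right_mono[of 1 p "R powr (p - 1)"] by (intro mult_right_mono) auto
    finally show ?thesis using 2 by simp
  qed simp
qed

text \<open>For equal signs this is \<open>powr_diff_le\<close> up to a reflection. For opposite
  signs each value is compared with 0, and the distances to 0 add up to |s - t|.\<close>

lemma signed_powr_Lipschitz:
  fixes s t R p :: real
  assumes p: "1 < p" and s: "\<bar>s\<bar> \<le> R" and t: "\<bar>t\<bar> \<le> R"
  shows "\<bar>s * \<bar>s\<bar> powr (p - 1) - t * \<bar>t\<bar> powr (p - 1)\<bar> \<le> p * R powr (p - 1) * \<bar>s - t\<bar>"
proof -
  have F: "x * \<bar>x\<bar> powr (p - 1) = x powr p" if "0 \<le> x" for x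
    using that powr_add[of x "p - 1" 1] by (cases "x = 0") (auto simp: mult.commute)
  have F': "x * \<bar>x\<bar> powr (p - 1) = - ((- x) powr p)" if "x \<le> 0" for x
    using F[of "- x"] that by simp
  have ord: "\<bar>s * \<bar>s\<bar> powr (p - 1) - t * \<bar>t\<bar> powr (p - 1)\<bar> \<le> p * R powr (p - 1) * \<bar>s - t\<bar>"
    if "t \<le> s" "\<bar>s\<bar> \<le> R" "\<bar>t\<bar> \<le> R" for s t
  proof -
    consider "0 \<le> t" | "s \<le> 0" | "t < 0" "0 < s" using that by linarith
    then show ?thesis
    proof cases
      case 1
      have "t powr p \<le> s powr p" using 1 that p by (intro powr_mono2) auto
      then show ?thesis
        using powr_diff_le[OF p 1 that(1), of R] that 1 F[of s] F[of t] by (simp only: abs_of_nonneg)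
    next
      case 2
      have "(- s) powr p \<le> (- t) powr p" using 2 that p by (intro powr_mono2) auto
      moreover have "(- t) powr p - (- s) powr p \<le> p * R powr (p - 1) * (- t - - s)"
        using 2 that by (intro powr_diff_le p) auto
      moreover have "- t - - s = \<bar>s - t\<bar>" using that by simp
      ultimately show ?thesis
        using F'[of s] F'[of t] 2 that by simp
    next
      case 3
      have "s powr p \<le> p * R powr (p - 1) * s"
        using powr_diff_le[OF p, of 0 s R] 3 that by simp
      moreover have "(- t) powr p \<le> p * R powr (p - 1) * (- t)"
        using powr_diff_le[OF p, of 0 "- t" R] 3 that by simp
      ultimately have "s powr p + (- t) powr p \<le> p * R powr (p - 1) * s + p * R powr (p - 1) * (- t)"
        by (rule add_mono)
      also have "\<dots> = p * R powr (p - 1) * \<bar>s - t\<bar>"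
        using 3 by (simp add: algebra_simps)
      finally show ?thesis
        using F[of s] F'[of t] 3 by simp
    qed
  qed
  show ?thesis
    using ord[of t s] ord[of s t] s t by (metis abs_minus_commute linear)
qed

lemma
  assumes "\<phi> \<in> Linf U" "\<psi> \<in> borel_measurable (lebesgue_on U)" "AE x in lebesgue_on U. \<bar>\<psi> x\<bar> \<le> C" "0 \<le> C"
  shows Linf_mult: "(\<lambda>x. \<phi> x * \<psi> x) \<in> Linf U"
    and Linf_norm_mult_le: "Linf_norm U (\<lambda>x. \<phi> x * \<psi> x) \<le> Linf_norm U \<phi> * C"
proof -
  have m: "(\<lambda>x. \<phi> x * \<psi> x) \<in> borel_measurable (lebesgue_on U)"
    by (intro borel_measurable_times Linf_measurable assms)
  have ae: "AE x in lebesgue_on U. \<bar>\<phi> x * \<psi> x\<bar> \<le> Linf_norm U \<phi> * C"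
    using Linf_AE_le[OF assms(1)] assms(3)
    by eventually_elim (auto simp: abs_mult intro: mult_mono Linf_norm_nonneg)
  show "(\<lambda>x. \<phi> x * \<psi> x) \<in> Linf U" by (rule LinfI[OF m ae])
  show "Linf_norm U (\<lambda>x. \<phi> x * \<psi> x) \<le> Linf_norm U \<phi> * C"
    using assms(4) by (intro Linf_norm_le[OF m ae] mult_nonneg_nonneg Linf_norm_nonneg)
qed

text \<open>Let V, W be the potentials of \<mu>, \<nu> and F t = t |t|^(p-1). Subtracting the
  equations cancels the term with \<open>g\<close> and leaves u - v = H(b (F u - F v)) - H(V (u -
  v)) - H((V - W) v). The first two terms together are at most \<kappa> times the norm of u - v, the
  last is at most l0 e R, and \<kappa> < 1 allows the norm to be absorbed. Only V multiplies u - v,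
  so the smallness condition concerns \<mu> alone.\<close>

lemma integral_solution_stability:
  fixes U :: "'a::euclidean_space set" and f :: "'a \<Rightarrow>\<^sub>C real"
  assumes dim: "3 \<le> DIM('a)" and U: "open U" "bounded U" and p: "1 < p" and b: "b \<in> Linf U"
    and \<mu>: "\<mu> \<in> radon_measures U" and \<nu>: "\<nu> \<in> radon_measures U"
    and u: "integral_solution U p f b g \<mu> u" and v: "integral_solution U p f b g \<nu> v"
    and uR: "Linf_norm U u \<le> R" and vR: "Linf_norm U v \<le> R"
    and \<kappa>: "l0 U * (norm f * tv_norm U \<mu>) + l0 U * (Linf_norm U b * (p * R powr (p - 1))) \<le> \<kappa>" "\<kappa> < 1"
    and e: "\<And>x. x \<in> U \<Longrightarrow> \<bar>potential U f \<mu> x - potential U f \<nu> x\<bar> \<le> e" "0 \<le> e"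
  shows "Linf_norm U (\<lambda>x. u x - v x) \<le> l0 U * R / (1 - \<kappa>) * e"
proof -
  let ?V = "potential U f \<mu>" and ?W = "potential U f \<nu>"
  let ?F = "\<lambda>t::real. t * \<bar>t\<bar> powr (p - 1)"
  have sU: "U \<in> sets lebesgue" using U(1) by simp
  have inU: "AE x in lebesgue_on U. x \<in> U"
    by (rule AE_I2) (simp add: space_restrict_space)
  have uL: "u \<in> Linf U" and vL: "v \<in> Linf U"
    using u v by (auto simp: integral_solution_def)
  have R: "0 \<le> R" using uR Linf_norm_nonneg[of U u] by linarith
  have pot: "potential U f \<mu>' \<in> Linf U" if "\<mu>' \<in> radon_measures U" for \<mu>'
    using continuous_imp_measurable_on_sets_lebesgue[OF potential_continuous[OF U that] sU]
      potential_bound[OF U(1) that] by (intro LinfI[where C="norm f * tv_norm U \<mu>'"]) auto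
  have dL: "(\<lambda>x. u x - v x) \<in> Linf U" by (rule Linf_diff[OF uL vL])
  define N where "N = Linf_norm U (\<lambda>x. u x - v x)"
  have N: "0 \<le> N" by (simp add: N_def Linf_norm_nonneg)
  have ae_u: "AE x in lebesgue_on U. \<bar>u x\<bar> \<le> R" and ae_v: "AE x in lebesgue_on U. \<bar>v x\<bar> \<le> R"
    subgoal using Linf_AE_le[OF uL] by eventually_elim (use uR in linarith)
    subgoal using Linf_AE_le[OF vL] by eventually_elim (use vR in linarith)
    done
  have Fm: "(\<lambda>x. ?F (w x)) \<in> borel_measurable (lebesgue_on U)" if "w \<in> Linf U" for w
    using Linf_measurable[OF that] by measurable
  have Fb: "AE x in lebesgue_on U. \<bar>?F (w x)\<bar> \<le> p * R powr (p - 1) * R"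
    if "AE x in lebesgue_on U. \<bar>w x\<bar> \<le> R" for w
    using that
  proof eventually_elim
    case (elim x)
    have "\<bar>?F (w x)\<bar> \<le> p * R powr (p - 1) * \<bar>w x\<bar>"
      using signed_powr_Lipschitz[OF p elim, of 0] R by simp
    also have "\<dots> \<le> p * R powr (p - 1) * R"
      using elim p by (intro mult_left_mono) auto
    finally show ?case .
  qed
  have bF: "(\<lambda>x. b x * ?F (w x)) \<in> Linf U" if "w \<in> Linf U" "AE x in lebesgue_on U. \<bar>w x\<bar> \<le> R" for w
    using p R by (intro Linf_mult[OF b Fm[OF that(1)] Fb[OF that(2)]]) auto
  have Vu: "(\<lambda>x. ?V x * u x) \<in> Linf U" and Wv: "(\<lambda>x. ?W x * v x) \<in> Linf U"
    by (intro Linf_mult[OF pot[OF \<mu>] Linf_measurable[OF uL] ae_u R]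
        Linf_mult[OF pot[OF \<nu>] Linf_measurable[OF vL] ae_v R])+
  have 1: "Linf_norm U (\<lambda>x. ?V x * u x - ?W x * v x) \<le> norm f * tv_norm U \<mu> * N + e * R"
  proof (rule Linf_norm_le)
    show "(\<lambda>x. ?V x * u x - ?W x * v x) \<in> borel_measurable (lebesgue_on U)"
      by (intro Linf_measurable Linf_diff Vu Wv)
    show "AE x in lebesgue_on U. \<bar>?V x * u x - ?W x * v x\<bar> \<le> norm f * tv_norm U \<mu> * N + e * R"
      using Linf_AE_le[OF dL] ae_v inU
    proof eventually_elim
      case (elim x)
      have "?V x * u x - ?W x * v x = ?V x * (u x - v x) + (?V x - ?W x) * v x"
        by (simp add: algebra_simps)
      also have "\<bar>\<dots>\<bar> \<le> \<bar>?V x\<bar> * \<bar>u x - v x\<bar> + \<bar>?V x - ?W x\<bar> * \<bar>v x\<bar>"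
        by (rule order_trans[OF abs_triangle_ineq]) (simp add: abs_mult)
      also have "\<dots> \<le> (norm f * tv_norm U \<mu>) * N + e * R"
        using elim e R N potential_bound[OF U(1) \<mu>, of f x]
        by (intro add_mono mult_mono) (auto simp: N_def intro: order_trans[OF abs_ge_zero])
      finally show ?case .
    qed
    show "0 \<le> norm f * tv_norm U \<mu> * N + e * R"
      using N R e(2) order_trans[OF abs_ge_zero potential_bound[OF U(1) \<mu>, of f 0]] by simp
  qed
  have 2: "Linf_norm U (\<lambda>x. b x * ?F (u x) - b x * ?F (v x)) \<le> Linf_norm U b * (p * R powr (p - 1) * N)"
  proof -
    have "AE x in lebesgue_on U. \<bar>?F (u x) - ?F (v x)\<bar> \<le> p * R powr (p - 1) * N"
      using Linf_AE_le[OF dL] ae_u ae_v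
    proof eventually_elim
      case (elim x)
      have "\<bar>?F (u x) - ?F (v x)\<bar> \<le> p * R powr (p - 1) * \<bar>u x - v x\<bar>"
        by (rule signed_powr_Lipschitz[OF p elim(2,3)])
      also have "\<dots> \<le> p * R powr (p - 1) * N"
        using elim(1) p by (intro mult_left_mono) (auto simp: N_def)
      finally show ?case .
    qed
    then have "Linf_norm U (\<lambda>x. b x * (?F (u x) - ?F (v x))) \<le> Linf_norm U b * (p * R powr (p - 1) * N)"
      using p N by (intro Linf_norm_mult_le b borel_measurable_diff Fm uL vL) auto
    then show ?thesis by (simp only: right_diff_distrib)
  qed
  have l0: "0 \<le> l0 U" using dim by (simp add: l0_def)
  have "N \<le> \<kappa> * N + l0 U * (e * R)"
    unfolding N_def
  proof (rule Linf_norm_le)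
    show "(\<lambda>x. u x - v x) \<in> borel_measurable (lebesgue_on U)" by (rule Linf_measurable[OF dL])
    have eq: "(\<lambda>y. b y * w y * \<bar>w y\<bar> powr (p - 1)) = (\<lambda>y. b y * ?F (w y))" for w :: "'a \<Rightarrow> real"
      by (simp add: mult.assoc)
    have "AE x in lebesgue_on U. u x = green_op U g x - green_op U (\<lambda>y. ?V y * u y) x + green_op U (\<lambda>y. b y * ?F (u y)) x"
      "AE x in lebesgue_on U. v x = green_op U g x - green_op U (\<lambda>y. ?W y * v y) x + green_op U (\<lambda>y. b y * ?F (v y)) x"
      using u v by (simp_all add: integral_solution_def eq)
    then show "AE x in lebesgue_on U. \<bar>u x - v x\<bar> \<le> \<kappa> * Linf_norm U (\<lambda>x. u x - v x) + l0 U * (e * R)"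
      unfolding N_def[symmetric] using inU
    proof eventually_elim
      case (elim x)
      note G = green_op_diff[OF dim U elim(3)] and B = green_op_bound[OF dim U elim(3)]
      have "u x - v x = (green_op U (\<lambda>y. b y * ?F (u y)) x - green_op U (\<lambda>y. b y * ?F (v y)) x)
          - (green_op U (\<lambda>y. ?V y * u y) x - green_op U (\<lambda>y. ?W y * v y) x)"
        using elim(1,2) by simp
      also have "\<dots> = green_op U (\<lambda>y. b y * ?F (u y) - b y * ?F (v y)) x
          - green_op U (\<lambda>y. ?V y * u y - ?W y * v y) x"
        unfolding G[OF bF[OF uL ae_u] bF[OF vL ae_v]] G[OF Vu Wv] ..
      finally have "\<bar>u x - v x\<bar> \<le> l0 U * Linf_norm U (\<lambda>y. b y * ?F (u y) - b y * ?F (v y))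
          + l0 U * Linf_norm U (\<lambda>y. ?V y * u y - ?W y * v y)"
        using B[OF Linf_diff[OF bF[OF uL ae_u] bF[OF vL ae_v]]] B[OF Linf_diff[OF Vu Wv]] by linarith
      also have "\<dots> \<le> l0 U * (Linf_norm U b * (p * R powr (p - 1) * N))
          + l0 U * (norm f * tv_norm U \<mu> * N + e * R)"
        by (rule add_mono[OF mult_left_mono[OF 2 l0] mult_left_mono[OF 1 l0]])
      also have "\<dots> = (l0 U * (norm f * tv_norm U \<mu>) + l0 U * (Linf_norm U b * (p * R powr (p - 1)))) * N
          + l0 U * (e * R)"
        by (simp add: algebra_simps)
      also have "\<dots> \<le> \<kappa> * N + l0 U * (e * R)"
        by (rule add_right_mono[OF mult_right_mono[OF \<kappa>(1) N]])
      finally show ?case .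
    qed
    have "0 \<le> tv_norm U \<mu>" using U(1) by (intro total_variation_nonneg[OF U(1) \<mu>]) auto
    then have "0 \<le> \<kappa>"
      using l0 p Linf_norm_nonneg[of U b] by (intro order_trans[OF _ \<kappa>(1)]) simp
    then show "0 \<le> \<kappa> * Linf_norm U (\<lambda>x. u x - v x) + l0 U * (e * R)"
      using l0 e R by (simp add: Linf_norm_nonneg)
  qed
  then have "N * (1 - \<kappa>) \<le> l0 U * (e * R)" by (simp add: algebra_simps)
  then show ?thesis
    using \<kappa>(2) unfolding N_def[symmetric] by (simp add: field_simps)
qed


subsection \<open>Random potentials and convergence in probability\<close>

text \<open>The net is taken from \<open>D\<close> because almost sure convergence of the potentials
  will be known at countably many points only, while all of \<open>U\<close> has to be
  covered.\<close>

lemma finite_net_in_dense_subset: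
  fixes U :: "'a::euclidean_space set"
  assumes U: "bounded U" and D: "D \<subseteq> U" "U \<subseteq> closure D" and d: "0 < d"
  obtains Q where "finite Q" "Q \<subseteq> D" "\<And>x. x \<in> U \<Longrightarrow> \<exists>q\<in>Q. dist x q < d"
proof -
  have "compact (closure U)" using U by (simp add: compact_closure)
  moreover have "closure U \<subseteq> (\<Union>q\<in>D. ball q d)"
  proof
    fix x assume "x \<in> closure U"
    then have "x \<in> closure D" using D(2) closure_minimal[OF D(2) closed_closure] by blast
    then obtain q where "q \<in> D" "dist q x < d"
      using d closure_approachable by blast
    then show "x \<in> (\<Union>q\<in>D. ball q d)" by auto
  qed
  ultimately obtain Q where "Q \<subseteq> D" "finite Q" "closure U \<subseteq> (\<Union>q\<in>Q. ball q d)"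
    using compactE_image[of "closure U" D "\<lambda>q. ball q d"] by blast
  moreover have "\<exists>q\<in>Q. dist x q < d" if "x \<in> U" for x
    using calculation(3) closure_subset[of U] that by (force simp: dist_commute)
  ultimately show ?thesis using that by blast
qed

text \<open>If the rounded values on a finite net agree for two samples, their potentials differ by
  at most 3\<eta> on \<open>U\<close>: \<eta> at the net point and \<eta> for each of the two moves
  to it. Stability turns this into closeness of \<open>Y\<close>. Taking one sample per cell makes
  the approximant a function of the finite-valued \<open>T\<close>, so measurability enters only
  through \<open>V\<close> at points.\<close>

lemma Linf_approximable_equicontinuous:
  fixes U :: "'a::euclidean_space set" and Y V :: "'w \<Rightarrow> 'a \<Rightarrow> real"
  assumes U: "bounded U" and Y: "\<And>\<omega>. \<omega> \<in> space M \<Longrightarrow> Y \<omega> \<in> Linf U"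
    and meas: "\<And>x. x \<in> U \<Longrightarrow> (\<lambda>\<omega>. V \<omega> x) \<in> borel_measurable M"
    and bound: "\<And>\<omega> x. \<omega> \<in> space M \<Longrightarrow> x \<in> U \<Longrightarrow> \<bar>V \<omega> x\<bar> \<le> B"
    and equi: "\<And>\<eta>. 0 < \<eta> \<Longrightarrow> \<exists>d>0. \<forall>\<omega>\<in>space M. \<forall>x\<in>U. \<forall>x'\<in>U. dist x x' < d \<longrightarrow> \<bar>V \<omega> x - V \<omega> x'\<bar> \<le> \<eta>"
    and stable: "\<And>\<omega> \<omega>' e. \<omega> \<in> space M \<Longrightarrow> \<omega>' \<in> space M \<Longrightarrow> 0 \<le> e \<Longrightarrow>
      (\<And>x. x \<in> U \<Longrightarrow> \<bar>V \<omega> x - V \<omega>' x\<bar> \<le> e) \<Longrightarrow> Linf_norm U (\<lambda>x. Y \<omega> x - Y \<omega>' x) \<le> C * e"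
    and C: "0 \<le> C"
  shows "Linf_approximable M U Y"
  unfolding Linf_approximable_def
proof (intro conjI ballI allI impI Y)
  fix e :: real assume e: "0 < e"
  \<comment> \<open>The 3 belongs to the three-term estimate; \<open>C + 1\<close> instead of
    \<open>C\<close> keeps the denominator positive.\<close>
  define \<eta> where "\<eta> = e / (3 * (C + 1))"
  have \<eta>: "0 < \<eta>" using e C by (simp add: \<eta>_def)
  obtain d where d: "0 < d" "\<And>\<omega> x x'. \<omega> \<in> space M \<Longrightarrow> x \<in> U \<Longrightarrow> x' \<in> U \<Longrightarrow> dist x x' < d \<Longrightarrow> \<bar>V \<omega> x - V \<omega> x'\<bar> \<le> \<eta>"
    using equi[OF \<eta>] by blast
  obtain Q where Q: "finite Q" "Q \<subseteq> U" "\<And>x. x \<in> U \<Longrightarrow> \<exists>q\<in>Q. dist x q < d"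
    using finite_net_in_dense_subset[OF U order_refl closure_subset d(1)] by blast
  \<comment> \<open>The cell of \<open>\<omega>\<close> records \<open>V \<omega>\<close> on the finite net up to the error \<open>\<eta>\<close>.\<close>
  define T where "T \<omega> = (\<lambda>q\<in>Q. \<lfloor>V \<omega> q / \<eta>\<rfloor>)" for \<omega>
  have T: "simple_function M T"
    unfolding simple_function_def
  proof
    have "T ` space M \<subseteq> PiE Q (\<lambda>_. {\<lfloor>- B / \<eta>\<rfloor>..\<lfloor>B / \<eta>\<rfloor>})"
    proof
      fix k assume "k \<in> T ` space M"
      then obtain \<omega> where w: "\<omega> \<in> space M" "k = T \<omega>" by blast
      have "\<lfloor>V \<omega> q / \<eta>\<rfloor> \<in> {\<lfloor>- B / \<eta>\<rfloor>..\<lfloor>B / \<eta>\<rfloor>}" if "q \<in> Q" for q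
      proof -
        have "\<bar>V \<omega> q\<bar> \<le> B" using bound[OF w(1)] that Q(2) by blast
        then have "- B / \<eta> \<le> V \<omega> q / \<eta>" "V \<omega> q / \<eta> \<le> B / \<eta>"
          using divide_right_mono[of "- B" "V \<omega> q" \<eta>] divide_right_mono[of "V \<omega> q" B \<eta>] \<eta> by auto
        then show ?thesis by (auto intro: floor_mono)
      qed
      then show "k \<in> PiE Q (\<lambda>_. {\<lfloor>- B / \<eta>\<rfloor>..\<lfloor>B / \<eta>\<rfloor>})"
        unfolding w(2) T_def by (intro restrict_PiE_iff[THEN iffD2]) blast
    qed
    then show "finite (T ` space M)"
      by (rule finite_subset) (intro finite_PiE Q(1) finite_atLeastAtMost_int)
    show "\<forall>k\<in>T ` space M. T -` {k} \<inter> space M \<in> sets M"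
    proof
      fix k assume "k \<in> T ` space M"
      then obtain \<omega>' where k: "k = T \<omega>'" by blast
      have "T \<omega> = k \<longleftrightarrow> (\<forall>q\<in>Q. \<lfloor>V \<omega> q / \<eta>\<rfloor> = k q)" for \<omega>
      proof
        assume eq: "T \<omega> = k"
        show "\<forall>q\<in>Q. \<lfloor>V \<omega> q / \<eta>\<rfloor> = k q"
          unfolding eq[symmetric] by (simp add: T_def)
      next
        assume "\<forall>q\<in>Q. \<lfloor>V \<omega> q / \<eta>\<rfloor> = k q"
        then show "T \<omega> = k" unfolding k by (auto simp: T_def intro!: restrict_ext)
      qed
      then have "T -` {k} \<inter> space M = {\<omega> \<in> space M. \<forall>q\<in>Q. \<lfloor>V \<omega> q / \<eta>\<rfloor> = k q}"
        by blast
      also have "\<dots> \<in> sets M"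
      proof (rule sets.sets_Collect_finite_All[OF _ Q(1)])
        fix q assume "q \<in> Q"
        then have [measurable]: "(\<lambda>\<omega>. V \<omega> q) \<in> borel_measurable M" using Q(2) meas by blast
        show "{\<omega> \<in> space M. \<lfloor>V \<omega> q / \<eta>\<rfloor> = k q} \<in> sets M" by measurable
      qed
      finally show "T -` {k} \<inter> space M \<in> sets M" .
    qed
  qed
  define rep where "rep k = (SOME \<omega>. \<omega> \<in> space M \<and> T \<omega> = k)" for k
  have rep: "rep (T \<omega>) \<in> space M" "T (rep (T \<omega>)) = T \<omega>" if "\<omega> \<in> space M" for \<omega>
    using someI[of "\<lambda>\<omega>'. \<omega>' \<in> space M \<and> T \<omega>' = T \<omega>" \<omega>] that by (auto simp: rep_def)
  show "\<exists>s. Linf_simple M U s \<and> (\<forall>\<omega>\<in>space M. Linf_norm U (\<lambda>x. Y \<omega> x - s \<omega> x) \<le> e)"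
  proof (intro exI[of _ "\<lambda>\<omega>. Y (rep (T \<omega>))"] conjI ballI)
    show "Linf_simple M U (\<lambda>\<omega>. Y (rep (T \<omega>)))"
      unfolding Linf_simple_def
      using simple_function_compose1[OF T, of "\<lambda>k. Y (rep k)"] rep(1) Y by blast
    fix \<omega> assume w: "\<omega> \<in> space M"
    note w' = rep[OF w]
    have net: "\<bar>V \<omega> q - V (rep (T \<omega>)) q\<bar> \<le> \<eta>" if "q \<in> Q" for q
    proof -
      have "\<lfloor>V \<omega> q / \<eta>\<rfloor> = \<lfloor>V (rep (T \<omega>)) q / \<eta>\<rfloor>"
        using fun_cong[OF w'(2), of q] that by (simp add: T_def)
      then have "\<bar>V \<omega> q / \<eta> - V (rep (T \<omega>)) q / \<eta>\<bar> \<le> 1" by linarith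
      then have "\<bar>V \<omega> q - V (rep (T \<omega>)) q\<bar> / \<eta> \<le> 1"
        using \<eta> by (simp add: diff_divide_distrib[symmetric] abs_divide)
      then show ?thesis using \<eta> by (simp add: field_simps)
    qed
    have "Linf_norm U (\<lambda>x. Y \<omega> x - Y (rep (T \<omega>)) x) \<le> C * (3 * \<eta>)"
    proof (rule stable[OF w w'(1)])
      fix x assume x: "x \<in> U"
      then obtain q where q: "q \<in> Q" "dist x q < d" using Q(3) by blast
      have "q \<in> U" using q Q(2) by blast
      then show "\<bar>V \<omega> x - V (rep (T \<omega>)) x\<bar> \<le> 3 * \<eta>"
        using d(2)[OF w x _ q(2)] d(2)[OF w'(1) x _ q(2)] net[OF q(1)] by linarith
    qed (use \<eta> in simp)
    also have "\<dots> \<le> (C + 1) * (3 * \<eta>)" using \<eta> by (intro mult_right_mono) auto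
    also have "\<dots> = e" using C by (simp add: \<eta>_def field_simps)
    finally show "Linf_norm U (\<lambda>x. Y \<omega> x - Y (rep (T \<omega>)) x) \<le> e" .
  qed
qed

text \<open>
  If independent \<open>Z j\<close> converge to \<open>Z'\<close>, then $E[Z_jZ_{j+1}]=E[Z_j]E[Z_{j+1}]$ gives
  $E[Z'^2]=E[Z']^2$ in the limit, so \<open>Z'\<close> has zero variance.
\<close>

lemma (in prob_space) independent_limit_constant:
  fixes Z :: "nat \<Rightarrow> 'a \<Rightarrow> real"
  assumes indep: "indep_vars (\<lambda>_. borel) Z {1..}"
    and bound: "\<And>j \<omega>. 1 \<le> j \<Longrightarrow> \<omega> \<in> space M \<Longrightarrow> \<bar>Z j \<omega>\<bar> \<le> B"
    and Z'[measurable]: "Z' \<in> borel_measurable M" and conv: "AE \<omega> in M. (\<lambda>j. Z j \<omega>) \<longlonglongrightarrow> Z' \<omega>"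
  obtains c where "AE \<omega> in M. (\<lambda>j. Z j \<omega>) \<longlonglongrightarrow> c"
proof -
  \<comment> \<open>The hypotheses start at index 1, so all sequences are shifted by
    \<open>Suc\<close>; limits do not change.\<close>
  have Zm[measurable]: "Z (Suc j) \<in> borel_measurable M" for j
    using indep by (simp add: indep_vars_def)
  have bS: "\<bar>Z (Suc j) \<omega>\<bar> \<le> B" if "\<omega> \<in> space M" for j \<omega>
    using bound[of "Suc j" \<omega>] that by simp
  have Zint: "integrable M (Z (Suc j))" for j
    using bS by (intro integrable_const_bound[where B=B]) auto
  have conv1: "AE \<omega> in M. (\<lambda>j. Z (Suc j) \<omega>) \<longlonglongrightarrow> Z' \<omega>"
    using conv by eventually_elim (rule LIMSEQ_Suc)
  have conv2: "AE \<omega> in M. (\<lambda>j. Z (Suc j) \<omega> * Z (Suc (Suc j)) \<omega>) \<longlonglongrightarrow> Z' \<omega> * Z' \<omega>"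
    using conv1
  proof eventually_elim
    case (elim \<omega>)
    show ?case by (rule tendsto_mult[OF elim LIMSEQ_Suc[OF elim]])
  qed
  have E1: "(\<lambda>j. expectation (Z (Suc j))) \<longlonglongrightarrow> expectation Z'"
    using bS by (intro integral_dominated_convergence[where w="\<lambda>_. B"] conv1) auto
  have B2: "AE \<omega> in M. norm (Z (Suc j) \<omega> * Z (Suc (Suc j)) \<omega>) \<le> B * B" for j
  proof (rule AE_I2)
    fix \<omega> assume w: "\<omega> \<in> space M"
    show "norm (Z (Suc j) \<omega> * Z (Suc (Suc j)) \<omega>) \<le> B * B"
      unfolding norm_mult using bS[OF w, of j] bS[OF w, of "Suc j"] by (intro mult_mono) auto
  qed
  have E2: "(\<lambda>j. expectation (\<lambda>\<omega>. Z (Suc j) \<omega> * Z (Suc (Suc j)) \<omega>)) \<longlonglongrightarrow> expectation (\<lambda>\<omega>. Z' \<omega> * Z' \<omega>)"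
    by (intro integral_dominated_convergence[where w="\<lambda>_. B * B"] conv2 B2) auto
  have "expectation (\<lambda>\<omega>. Z (Suc j) \<omega> * Z (Suc (Suc j)) \<omega>) = expectation (Z (Suc j)) * expectation (Z (Suc (Suc j)))" for j
  proof -
    have "indep_vars (\<lambda>_. borel) Z {Suc j, Suc (Suc j)}"
      by (rule indep_vars_subset[OF indep]) auto
    moreover have "integrable M (Z i)" if "i \<in> {Suc j, Suc (Suc j)}" for i
      using that Zint by auto
    ultimately have "expectation (\<lambda>\<omega>. \<Prod>i\<in>{Suc j, Suc (Suc j)}. Z i \<omega>) = (\<Prod>i\<in>{Suc j, Suc (Suc j)}. expectation (Z i))"
      by (intro indep_vars_lebesgue_integral) auto
    then show ?thesis by simp
  qed
  then have "(\<lambda>j. expectation (\<lambda>\<omega>. Z (Suc j) \<omega> * Z (Suc (Suc j)) \<omega>)) \<longlonglongrightarrow> expectation Z' * expectation Z'"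
    by (simp only:) (intro tendsto_mult E1 LIMSEQ_Suc[OF E1])
  from LIMSEQ_unique[OF E2 this] have sq: "expectation (\<lambda>\<omega>. Z' \<omega> * Z' \<omega>) = expectation Z' * expectation Z'" .
  define c where "c = expectation Z'"
  have bZ': "AE \<omega> in M. \<bar>Z' \<omega>\<bar> \<le> B"
    using conv1 AE_space
  proof eventually_elim
    case (elim \<omega>)
    show ?case
      using LIMSEQ_le_const2[OF tendsto_rabs[OF elim(1)], of B] bS[OF elim(2)] by auto
  qed
  have i1: "integrable M Z'"
    using bZ' by (intro integrable_const_bound[where B=B]) auto
  have i2: "integrable M (\<lambda>\<omega>. Z' \<omega> * Z' \<omega>)"
  proof (rule integrable_const_bound[where B="B * B"])
    show "AE \<omega> in M. norm (Z' \<omega> * Z' \<omega>) \<le> B * B"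
      using bZ'
    proof eventually_elim
      case (elim \<omega>)
      show ?case
        unfolding real_norm_def abs_mult by (rule mult_mono[OF elim elim]) (use elim in auto)
    qed
  qed simp
  have "expectation (\<lambda>\<omega>. (Z' \<omega> - c) * (Z' \<omega> - c))
      = expectation (\<lambda>\<omega>. Z' \<omega> * Z' \<omega> - 2 * c * Z' \<omega> + c * c)"
    by (intro Bochner_Integration.integral_cong refl) (simp add: algebra_simps)
  also have "\<dots> = 0"
    using i1 i2 sq by (simp add: prob_space c_def)
  finally have z: "expectation (\<lambda>\<omega>. (Z' \<omega> - c) * (Z' \<omega> - c)) = 0" .
  have i3: "integrable M (\<lambda>\<omega>. (Z' \<omega> - c) * (Z' \<omega> - c))"
    using i1 i2 by (simp add: left_diff_distrib right_diff_distrib)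
  have "AE \<omega> in M. (Z' \<omega> - c) * (Z' \<omega> - c) = 0"
    using integral_nonneg_eq_0_iff_AE[OF i3] z by simp
  then have "AE \<omega> in M. (\<lambda>j. Z j \<omega>) \<longlonglongrightarrow> c"
    using conv by eventually_elim auto
  then show ?thesis by (rule that)
qed

section \<open>Averages and convergence in probability\<close>

lemma Cesaro_mean_null:
  fixes a :: "nat \<Rightarrow> real"
  assumes a: "a \<longlonglongrightarrow> 0"
  shows "(\<lambda>k. (\<Sum>j=1..k. a j) / real k) \<longlonglongrightarrow> 0"
proof (rule LIMSEQ_I)
  fix r :: real assume r: "0 < r"
  obtain n where n: "\<And>j. n \<le> j \<Longrightarrow> \<bar>a j\<bar> < r / 2"
    using LIMSEQ_D[OF a half_gt_zero[OF r]] by auto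
  define S where "S = (\<Sum>j=1..n. \<bar>a j\<bar>)"
  obtain k0 :: nat where k0: "2 * S / r < real k0" using reals_Archimedean2 by blast
  show "\<exists>n. \<forall>k\<ge>n. norm ((\<Sum>j=1..k. a j) / real k - 0) < r"
  proof (intro exI[of _ "max (max n k0) 1"] allI impI)
    fix k assume k: "max (max n k0) 1 \<le> k"
    have "{1..k} = {1..n} \<union> {n+1..k}" using k by auto
    then have "(\<Sum>j=1..k. \<bar>a j\<bar>) = S + (\<Sum>j=n+1..k. \<bar>a j\<bar>)"
      unfolding S_def by (simp add: sum.union_disjoint)
    also have "(\<Sum>j=n+1..k. \<bar>a j\<bar>) \<le> (\<Sum>j=n+1..k. r / 2)"
      using n by (intro sum_mono less_imp_le) auto
    also have "\<dots> \<le> real k * (r / 2)"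
      using r by (simp add: mult_right_mono)
    finally have 1: "(\<Sum>j=1..k. \<bar>a j\<bar>) \<le> S + real k * (r / 2)" by simp
    have "S < real k * (r / 2)"
    proof -
      have "2 * S / r < real k" using k0 k by (simp add: less_le_trans)
      then show ?thesis using r by (simp add: field_simps)
    qed
    moreover have "real k * r = real k * (r / 2) + real k * (r / 2)" by (simp add: field_simps)
    ultimately have "\<bar>\<Sum>j=1..k. a j\<bar> < real k * r"
      using 1 sum_abs[of a "{1..k}"] by linarith
    then show "norm ((\<Sum>j=1..k. a j) / real k - 0) < r"
      using k by (simp add: divide_less_eq mult.commute)
  qed
qed

text \<open>Markov's inequality. Measurability of the event is stated alongside because it is part
  of the notion of convergence in probability.\<close>

lemma (in prob_space) null_in_prob_of_null_in_mean:
  fixes Y :: "nat \<Rightarrow> 'a \<Rightarrow> real"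
  assumes int: "\<And>k. integrable M (Y k)" and nonneg: "\<And>k \<omega>. \<omega> \<in> space M \<Longrightarrow> 0 \<le> Y k \<omega>"
    and lim: "(\<lambda>k. expectation (Y k)) \<longlonglongrightarrow> 0" and \<delta>: "0 < \<delta>"
  shows "{\<omega> \<in> space M. \<delta> \<le> Y k \<omega>} \<in> sets M" "(\<lambda>k. prob {\<omega> \<in> space M. \<delta> \<le> Y k \<omega>}) \<longlonglongrightarrow> 0"
proof -
  have [measurable]: "Y k \<in> borel_measurable M" for k using int by auto
  show "{\<omega> \<in> space M. \<delta> \<le> Y k \<omega>} \<in> sets M" by measurable
  have "prob {\<omega> \<in> space M. \<delta> \<le> Y k \<omega>} \<le> expectation (Y k) / \<delta>" for k
    using nonneg \<delta> by (intro integral_Markov_inequality_measure[OF int, of "{}"]) auto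
  then have "\<forall>k. norm (prob {\<omega> \<in> space M. \<delta> \<le> Y k \<omega>}) \<le> expectation (Y k) / \<delta>"
    by simp
  moreover have "(\<lambda>k. expectation (Y k) / \<delta>) \<longlonglongrightarrow> 0"
    using tendsto_divide[OF lim tendsto_const[of \<delta>]] \<delta> by simp
  ultimately show "(\<lambda>k. prob {\<omega> \<in> space M. \<delta> \<le> Y k \<omega>}) \<longlonglongrightarrow> 0"
    by (rule Lim_null_comparison[OF always_eventually])
qed

theorem theorem3p7:
  fixes U :: "(real ^ 'n) set" and p c0 K \<epsilon>0 :: real
    and f :: "(real ^ 'n) \<Rightarrow>\<^sub>C real" and b g :: "real ^ 'n \<Rightarrow> real"
    and M :: "'w measure"
    and X :: "nat \<Rightarrow> 'w \<Rightarrow> (real ^ 'n) set \<Rightarrow> real"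
    and X_lim :: "'w \<Rightarrow> (real ^ 'n) set \<Rightarrow> real"
    and u :: "nat \<Rightarrow> 'w \<Rightarrow> real ^ 'n \<Rightarrow> real"
  assumes dim: "CARD('n) \<ge> 3"
    and p: "p > 1"
    and U: "open U" "connected U" "U \<noteq> {}" "bounded U"
    and M: "prob_space M" "complete_measure M"
    and f: "f \<noteq> 0"
    and b: "b \<in> Linf U" "\<not> (AE x in lebesgue_on U. b x = 0)"
    and K: "K = l0 U * p * Linf_norm U b"
    and g: "g \<in> Linf U"
           "Linf_norm U g < 1 / l0 U * (1 / (2 powr p * K)) powr (1 / (p - 1))"
    and c0: "0 < c0" "c0 < 1"
    and \<epsilon>0: "\<epsilon>0 = ((1 - c0) powr p / (2 powr p * K)) powr (1 / (p - 1))"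
    and indep: "prob_space.indep_vars M (\<lambda>_. radon_borel U) X {1..}"
    and admissible: "\<And>j. j \<ge> 1 \<Longrightarrow> admissible_set M U p f b g \<epsilon>0 (X j) = space M"
    and sol: "\<And>j \<omega>. j \<ge> 1 \<Longrightarrow> \<omega> \<in> space M \<Longrightarrow> small_solution U p f b g \<epsilon>0 (X j \<omega>) (u j \<omega>)"
    and X_lim: "X_lim \<in> M \<rightarrow>\<^sub>M radon_borel U"
    and conv: "AE \<omega> in M. (\<lambda>j. tv_dist U (X j \<omega>) (X_lim \<omega>)) \<longlonglongrightarrow> 0"
    and L: "(SUP j\<in>{1..}. esssup M (\<lambda>\<omega>. ereal (tv_norm U (X j \<omega>)))) < ereal (1 / (l0 U * norm f))"
  shows "Linf_tendsto_in_prob M U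
           (\<lambda>k \<omega> x. \<Sum>j=1..k. (u j \<omega> x - Linf_expectation M U (u j) x) / real k)
           (\<lambda>\<omega> x. 0)
       \<and> tendsto_in_prob M
           (\<lambda>k \<omega>. \<Sum>j=1..k. (Linf_norm U (u j \<omega>) - (\<integral>\<omega>'. Linf_norm U (u j \<omega>') \<partial>M)) / real k)
           (\<lambda>\<omega>. 0)"
proof -
  interpret prob_space M by (rule M(1))
  have dim': "3 \<le> DIM(real ^ 'n)" using dim by simp
  obtain x0 where x0: "x0 \<in> U" using U(3) by auto
  have l0: "0 < l0 U" by (rule l0_pos[OF dim' U(1,4) x0])
  have nf: "0 < norm f" using f by simp
  have nb: "0 < Linf_norm U b"
  proof (rule ccontr)
    assume "\<not> 0 < Linf_norm U b"
    then have "Linf_norm U b = 0" using Linf_norm_nonneg[of U b] by linarith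
    then have "AE x in lebesgue_on U. b x = 0"
      using Linf_AE_le[OF b(1)] by simp
    then show False using b(2) by simp
  qed
  have K0: "0 < K" using l0 nb p by (simp add: K)
  \<comment> \<open>\<open>R\<close> bounds all solutions, since 2 \<epsilon>0 / (1 - tau) increases
    with tau < c0; \<open>m\<close> is the total variation at which tau equals c0. In \<kappa>, the
    potential term contributes c0 and the power term (1 - c0)/2.\<close>
  define R where "R = 2 * \<epsilon>0 / (1 - c0)"
  define m where "m = c0 / (l0 U * norm f)"
  define \<kappa> where "\<kappa> = c0 + (1 - c0) / 2"
  have \<kappa>: "\<kappa> < 1" using c0 by (simp add: \<kappa>_def field_simps)
  have m: "0 \<le> m" using l0 nf c0 by (simp add: m_def)
  have eps_powr: "\<epsilon>0 powr (p - 1) = (1 - c0) powr p / (2 powr p * K)"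
    using p c0 K0 by (simp add: \<epsilon>0 powr_powr)
  have eps_pos: "0 < \<epsilon>0" using c0 K0 by (simp add: \<epsilon>0)
  have R: "0 \<le> R" using eps_pos c0 by (simp add: R_def)
  have R_powr: "R powr (p - 1) = (1 - c0) / (2 * K)"
  proof -
    \<comment> \<open>Writing p as (p - 1) + 1 expresses everything by \<open>a\<close> and
      \<open>q\<close>, which cancel from 2^(p-1) \<epsilon>0^(p-1) / (1 - c0)^(p-1).\<close>
    define a where "a = (2::real) powr (p - 1)"
    define q where "q = (1 - c0) powr (p - 1)"
    have aq: "0 < a" "0 < q" using c0 by (auto simp: a_def q_def)
    have pw: "2 powr p = 2 * a" "(1 - c0) powr p = (1 - c0) * q"
      using powr_add[of 2 "p - 1" 1] powr_add[of "1 - c0" "p - 1" 1] c0 by (auto simp: a_def q_def mult.commute)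
    have "R powr (p - 1) = a * \<epsilon>0 powr (p - 1) / q"
      using eps_pos c0 by (simp add: R_def powr_divide powr_mult a_def q_def)
    also have "\<dots> = a * ((1 - c0) * q / (2 * a * K)) / q"
      unfolding eps_powr pw ..
    also have "\<dots> = (1 - c0) / (2 * K)"
      using aq K0 by (simp add: field_simps)
    finally show ?thesis .
  qed
  have Xm: "X j \<in> M \<rightarrow>\<^sub>M radon_borel U" if "1 \<le> j" for j
    using indep that by (simp add: indep_vars_def)
  have Xrad: "X j \<omega> \<in> radon_measures U" if "1 \<le> j" "\<omega> \<in> space M" for j \<omega>
    using measurable_space[OF Xm[OF that(1)] that(2)] by (simp add: space_radon_borel[OF U(1)])
  \<comment> \<open>The choice of \<open>\<epsilon>0\<close> turns admissibility into the bound \<open>tau < c0\<close>.\<close>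
  have tau: "tau U f (X j \<omega>) < c0" if "1 \<le> j" "\<omega> \<in> space M" for j \<omega>
  proof -
    define t where "t = tau U f (X j \<omega>)"
    have "\<omega> \<in> admissible_set M U p f b g \<epsilon>0 (X j)"
      using admissible[OF that(1)] that(2) by simp
    then have t: "t < 1" and le: "2 powr p * K * \<epsilon>0 powr (p - 1) / (1 - t) powr (p - 1) + t < 1"
      by (auto simp: admissible_set_def existence_conditions_def Kconst_def K t_def)
    have "2 powr p * K * \<epsilon>0 powr (p - 1) = (1 - c0) powr p"
      using K0 by (simp add: eps_powr)
    \<comment> \<open>The exponent \<open>p\<close> on 1 - c0 in \<epsilon>0 pays off here:
      multiplied by (1 - t)^(p-1), the condition compares the p-th powers of 1 - c0 and 1 -
      t.\<close>
    then have "(1 - c0) powr p / (1 - t) powr (p - 1) < 1 - t" using le by simp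
    then have "(1 - c0) powr p < (1 - t) * (1 - t) powr (p - 1)"
      using t by (simp add: pos_divide_less_eq)
    also have "\<dots> = (1 - t) powr p"
      using t powr_add[of "1 - t" "p - 1" 1] by (simp add: mult.commute)
    finally have "(1 - c0) powr p < (1 - t) powr p" .
    then have "1 - c0 < 1 - t"
      using powr_mono2[of p "1 - t" "1 - c0"] t p by (meson diff_ge_0_iff_ge less_imp_le linorder_not_le order_less_trans zero_less_one)
    then show ?thesis by (simp add: t_def)
  qed
  have tvm: "tv_norm U (X j \<omega>) \<le> m" if "1 \<le> j" "\<omega> \<in> space M" for j \<omega>
    using tau[OF that] l0 nf by (simp add: tau_def m_def field_simps)
  have sol': "integral_solution U p f b g (X j \<omega>) (u j \<omega>)" if "1 \<le> j" "\<omega> \<in> space M" for j \<omega>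
    using sol[OF that] by (simp add: small_solution_def)
  have uL: "u j \<omega> \<in> Linf U" if "1 \<le> j" "\<omega> \<in> space M" for j \<omega>
    using sol'[OF that] by (simp add: integral_solution_def)
  have uR: "Linf_norm U (u j \<omega>) \<le> R" if "1 \<le> j" "\<omega> \<in> space M" for j \<omega>
  proof -
    have "Linf_norm U (u j \<omega>) \<le> 2 * \<epsilon>0 / (1 - tau U f (X j \<omega>))"
      using sol[OF that] by (simp add: small_solution_def)
    also have "\<dots> \<le> R"
      unfolding R_def using tau[OF that] c0 eps_pos by (intro divide_left_mono mult_pos_pos) auto
    finally show ?thesis .
  qed
  let ?W = "\<lambda>j \<omega>. potential U f (X j \<omega>)"
  define C where "C = l0 U * R / (1 - \<kappa>)"
  have C: "0 \<le> C" using l0 R \<kappa> by (simp add: C_def)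
  \<comment> \<open>\<open>C\<close> depends neither on \<open>j\<close> nor on the samples, so a
    uniform error of the potentials gives a uniform error of the solutions along the whole
    sequence.\<close>
  have stable: "Linf_norm U (\<lambda>x. u j \<omega> x - u j \<omega>' x) \<le> C * e"
    if j: "1 \<le> j" and w: "\<omega> \<in> space M" "\<omega>' \<in> space M" and e: "0 \<le> e"
      and le: "\<And>x. x \<in> U \<Longrightarrow> \<bar>?W j \<omega> x - ?W j \<omega>' x\<bar> \<le> e" for j \<omega> \<omega>' e
    unfolding C_def
  proof (rule integral_solution_stability[OF dim' U(1,4) p b(1) Xrad[OF j w(1)] Xrad[OF j w(2)]
        sol'[OF j w(1)] sol'[OF j w(2)] uR[OF j w(1)] uR[OF j w(2)] _ \<kappa> le e])
    have "l0 U * (norm f * tv_norm U (X j \<omega>)) \<le> c0"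
      using tau[OF j w(1)] by (simp add: tau_def mult.assoc)
    moreover have "l0 U * (Linf_norm U b * (p * R powr (p - 1))) = (1 - c0) / 2"
    proof -
      have "l0 U * (Linf_norm U b * (p * R powr (p - 1))) = K * R powr (p - 1)"
        by (simp add: K)
      then show ?thesis using K0 by (simp add: R_powr)
    qed
    ultimately show "l0 U * (norm f * tv_norm U (X j \<omega>)) + l0 U * (Linf_norm U b * (p * R powr (p - 1))) \<le> \<kappa>"
      unfolding \<kappa>_def by linarith
  qed
  \<comment> \<open>One \<open>d\<close> has to serve all \<open>j\<close>, because the finite net
    in the limit argument is fixed before \<open>j\<close> tends to infinity.\<close>
  have equi: "\<exists>d>0. \<forall>j\<ge>1. \<forall>\<omega>\<in>space M. \<forall>x\<in>U. \<forall>x'\<in>U. dist x x' < d \<longrightarrow> \<bar>?W j \<omega> x - ?W j \<omega> x'\<bar> \<le> \<eta>"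
    if \<eta>: "0 < \<eta>" for \<eta>
  proof -
    obtain d where "0 < d"
      "\<And>\<mu> x x'. \<mu> \<in> radon_measures U \<Longrightarrow> tv_norm U \<mu> \<le> m \<Longrightarrow> x \<in> U \<Longrightarrow> x' \<in> U \<Longrightarrow> dist x x' < d \<Longrightarrow>
        \<bar>potential U f \<mu> x - potential U f \<mu> x'\<bar> \<le> \<eta>"
      using potential_equicontinuous[OF U(1,4) \<eta> m] by blast
    then show ?thesis using Xrad tvm by (intro exI[of _ d]) auto
  qed
  have Wm: "(\<lambda>\<omega>. ?W j \<omega> x) \<in> borel_measurable M" if "1 \<le> j" for j x
    by (rule measurable_compose[OF Xm[OF that] potential_measurable[OF U(1)]])
  have Wb: "\<bar>?W j \<omega> x\<bar> \<le> norm f * m" if "1 \<le> j" "\<omega> \<in> space M" for j \<omega> x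
    using potential_bound[OF U(1) Xrad[OF that], of f x] mult_left_mono[OF tvm[OF that], of "norm f"] by simp
  \<comment> \<open>Measurability of \<open>u j\<close> in \<omega> originates here: it is inherited
    from the potentials of the measurable \<open>X j\<close>.\<close>
  have approx: "Linf_approximable M U (u j)" if j: "1 \<le> j" for j
  proof (rule Linf_approximable_equicontinuous[where V="?W j" and B="norm f * m" and C=C])
    show "\<exists>d>0. \<forall>\<omega>\<in>space M. \<forall>x\<in>U. \<forall>x'\<in>U. dist x x' < d \<longrightarrow> \<bar>?W j \<omega> x - ?W j \<omega> x'\<bar> \<le> \<eta>"
      if "0 < \<eta>" for \<eta>
      using equi[OF that] j by blast
    show "Linf_norm U (\<lambda>x. u j \<omega> x - u j \<omega>' x) \<le> C * e"
      if "\<omega> \<in> space M" "\<omega>' \<in> space M" "0 \<le> e" "\<And>x. x \<in> U \<Longrightarrow> \<bar>?W j \<omega> x - ?W j \<omega>' x\<bar> \<le> e" for \<omega> \<omega>' e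
      by (rule stable[OF j that])
  qed (use U(4) uL[OF j] Wm[OF j] Wb[OF j] C in auto)
  \<comment> \<open>At fixed \<open>x\<close> the potentials are measurable functions of independent
    measures, hence independent; they converge almost surely to the potential of
    \<open>X_lim\<close>, which must then be constant.\<close>
  have "\<exists>c. AE \<omega> in M. (\<lambda>j. ?W j \<omega> x) \<longlonglongrightarrow> c" for x
  proof -
    have ind: "indep_vars (\<lambda>_. borel) (\<lambda>j \<omega>. ?W j \<omega> x) {1..}"
      by (rule indep_vars_compose2[OF indep]) (rule potential_measurable[OF U(1)])
    have lm: "(\<lambda>\<omega>. potential U f (X_lim \<omega>) x) \<in> borel_measurable M"
      by (rule measurable_compose[OF X_lim potential_measurable[OF U(1)]])
    have "AE \<omega> in M. (\<lambda>j. ?W j \<omega> x) \<longlonglongrightarrow> potential U f (X_lim \<omega>) x"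
      using conv AE_space
    proof eventually_elim
      case (elim \<omega>)
      have rad: "X_lim \<omega> \<in> radon_measures U"
        using measurable_space[OF X_lim elim(2)] by (simp add: space_radon_borel[OF U(1)])
      have "(\<lambda>j. ?W j \<omega> x - potential U f (X_lim \<omega>) x) \<longlonglongrightarrow> 0"
      proof (rule Lim_null_comparison)
        show "\<forall>\<^sub>F j in sequentially. norm (?W j \<omega> x - potential U f (X_lim \<omega>) x)
            \<le> norm f * tv_dist U (X j \<omega>) (X_lim \<omega>)"
          using eventually_ge_at_top[of 1]
        proof eventually_elim
          case (elim j)
          show ?case
            unfolding real_norm_def
            by (rule potential_measure_diff[OF U(1) Xrad[OF elim \<open>\<omega> \<in> space M\<close>] rad])
        qed
        show "(\<lambda>j. norm f * tv_dist U (X j \<omega>) (X_lim \<omega>)) \<longlonglongrightarrow> 0"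
          by (rule tendsto_mult_right_zero[OF elim(1)])
      qed
      then show ?case by (simp add: LIM_zero_iff)
    qed
    then show ?thesis
      using independent_limit_constant[OF ind Wb lm] by blast
  qed
  then obtain c where c: "\<And>x. AE \<omega> in M. (\<lambda>j. ?W j \<omega> x) \<longlonglongrightarrow> c x" by metis
  \<comment> \<open>The exceptional null set depends on \<open>x\<close>. Equicontinuity makes a
    countable dense set of points sufficient, and countably many null sets unite to a null
    set.\<close>
  obtain D where D: "countable D" "D \<subseteq> U" "U \<subseteq> closure D"
    using separable[of U] by blast
  have AE_D: "AE \<omega> in M. \<forall>x\<in>D. (\<lambda>j. ?W j \<omega> x) \<longlonglongrightarrow> c x"
    using D(1) c by (simp add: AE_ball_countable)
  \<comment> \<open>An almost sure event of a probability space is nonempty, which supplies the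
    sample \<open>\<omega>0\<close>.\<close>
  obtain \<omega>0 where w0: "\<omega>0 \<in> space M" "\<And>x. x \<in> D \<Longrightarrow> (\<lambda>j. ?W j \<omega>0 x) \<longlonglongrightarrow> c x"
  proof (rule ccontr)
    assume neg: "\<not> thesis"
    have "AE \<omega> in M. False"
      using AE_D AE_space
    proof eventually_elim
      case (elim \<omega>)
      then show False using that neg by blast
    qed
    then show False by simp
  qed
  \<comment> \<open>\<open>d j\<close> is the deviation from the reference
    \<open>u j \<omega>0\<close>. Its mean \<open>a j\<close> also bounds the distance of the
    expectation of \<open>u j\<close> from the reference, and likewise for the expected
    norm.\<close>
  define d where "d j \<omega> = Linf_norm U (\<lambda>x. u j \<omega> x - u j \<omega>0 x)" for j \<omega>
  define a where "a j = expectation (d j)" for j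
  have d_lim: "AE \<omega> in M. (\<lambda>j. d j \<omega>) \<longlonglongrightarrow> 0"
    using AE_D AE_space
  proof eventually_elim
    case (elim \<omega>)
    show ?case
    proof (rule tendstoI)
      fix e :: real assume e: "0 < e"
      \<comment> \<open>The three-term estimate gives \<open>C * (3 * \<eta>)\<close>; the factor 4
        makes the final inequality strict.\<close>
      define \<eta> where "\<eta> = e / (4 * (C + 1))"
      have \<eta>: "0 < \<eta>" using e C by (simp add: \<eta>_def)
      obtain r where r: "0 < r" "\<And>j \<omega> x x'. 1 \<le> j \<Longrightarrow> \<omega> \<in> space M \<Longrightarrow> x \<in> U \<Longrightarrow> x' \<in> U \<Longrightarrow> dist x x' < r \<Longrightarrow>
          \<bar>?W j \<omega> x - ?W j \<omega> x'\<bar> \<le> \<eta>"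
        using equi[OF \<eta>] by blast
      obtain Q where Q: "finite Q" "Q \<subseteq> D" "\<And>x. x \<in> U \<Longrightarrow> \<exists>q\<in>Q. dist x q < r"
        using finite_net_in_dense_subset[OF U(4) D(2,3) r(1)] by blast
      have "\<forall>\<^sub>F j in sequentially. \<forall>q\<in>Q. \<bar>?W j \<omega> q - ?W j \<omega>0 q\<bar> < \<eta>"
      proof (rule eventually_ball_finite[OF Q(1)], rule ballI)
        fix q assume "q \<in> Q"
        then have q: "q \<in> D" using Q(2) by blast
        have "(\<lambda>j. \<bar>?W j \<omega> q - ?W j \<omega>0 q\<bar>) \<longlonglongrightarrow> \<bar>c q - c q\<bar>"
          using elim(1) q w0(2)[OF q] by (intro tendsto_intros) auto
        then show "\<forall>\<^sub>F j in sequentially. \<bar>?W j \<omega> q - ?W j \<omega>0 q\<bar> < \<eta>"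
          using \<eta> by (intro order_tendstoD) auto
      qed
      then show "\<forall>\<^sub>F j in sequentially. dist (d j \<omega>) 0 < e"
        using eventually_ge_at_top[of 1]
      proof eventually_elim
        case (elim j)
        note w = \<open>\<omega> \<in> space M\<close> and j = elim(2)
        have "d j \<omega> \<le> C * (3 * \<eta>)"
          unfolding d_def
        proof (rule stable[OF j w w0(1)])
          fix x assume x: "x \<in> U"
          then obtain q where q: "q \<in> Q" "dist x q < r" using Q(3) by blast
          have qU: "q \<in> U" using q Q(2) D(2) by blast
          have "\<bar>?W j \<omega> q - ?W j \<omega>0 q\<bar> < \<eta>" using elim(1) q(1) by blast
          then show "\<bar>?W j \<omega> x - ?W j \<omega>0 x\<bar> \<le> 3 * \<eta>"
            using r(2)[OF j w x qU q(2)] r(2)[OF j w0(1) x qU q(2)] by linarith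
        qed (use \<eta> in simp)
        also have "\<dots> \<le> (C + 1) * (3 * \<eta>)" using \<eta> by (intro mult_right_mono) auto
        also have "\<dots> < (C + 1) * (4 * \<eta>)" using \<eta> C by (intro mult_strict_left_mono) auto
        also have "\<dots> = e" using C by (simp add: \<eta>_def field_simps)
        finally show ?case by (simp add: dist_real_def d_def Linf_norm_nonneg)
      qed
    qed
  qed
  have d_approx: "Linf_approximable M U (\<lambda>\<omega> x. u j \<omega> x - u j \<omega>0 x)" if "1 \<le> j" for j
    by (intro Linf_approximable_diff Linf_approximable_const approx uL that w0(1))
  have d_int: "integrable M (d j)" if "1 \<le> j" for j
    unfolding d_def[abs_def] by (rule Linf_approximable_norm_integrable[OF d_approx[OF that]])
  have d_bound: "\<bar>d j \<omega>\<bar> \<le> 2 * R" if "1 \<le> j" "\<omega> \<in> space M" for j \<omega>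
    using Linf_norm_triangle[OF uL[OF that] Linf_zero uL[OF that(1) w0(1)]]
      Linf_norm_minus_commute[of U "\<lambda>_. 0" "u j \<omega>0"] uR[OF that] uR[OF that(1) w0(1)]
    by (simp add: d_def Linf_norm_nonneg)
  have a_lim: "a \<longlonglongrightarrow> 0"
  proof -
    \<comment> \<open>Bounds and measurability are known for indices from 1 on, so dominated
      convergence is applied to the shifted sequence.\<close>
    have "(\<lambda>j. expectation (d (Suc j))) \<longlonglongrightarrow> expectation (\<lambda>_. 0)"
    proof (rule integral_dominated_convergence[where w="\<lambda>_. 2 * R"])
      show "AE \<omega> in M. (\<lambda>j. d (Suc j) \<omega>) \<longlonglongrightarrow> 0"
        using d_lim by eventually_elim (rule LIMSEQ_Suc)
      show "AE \<omega> in M. norm (d (Suc j) \<omega>) \<le> 2 * R" for j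
        using d_bound[of "Suc j"] by (intro AE_I2) auto
      show "d (Suc j) \<in> borel_measurable M" for j
        using d_int[of "Suc j"] by auto
    qed auto
    then have "(\<lambda>j. a (Suc j)) \<longlonglongrightarrow> 0" by (simp add: a_def)
    then show ?thesis by (rule LIMSEQ_imp_Suc)
  qed
  \<comment> \<open>\<open>S\<close> dominates both averages: each summand is at most its deviation
    \<open>d j\<close> plus the mean deviation \<open>a j\<close>. Its expectation is twice a Cesaro
    mean of \<open>a\<close>.\<close>
  define S where "S k \<omega> = (\<Sum>j=1..k. (d j \<omega> + a j) / real k)" for k \<omega>
  have S_int: "integrable M (S k)" for k
    unfolding S_def[abs_def] using d_int by (intro Bochner_Integration.integrable_sum integrable_divide
        Bochner_Integration.integrable_add) auto
  have S_lim: "(\<lambda>k. expectation (S k)) \<longlonglongrightarrow> 0"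
  proof -
    have "expectation (S k) = 2 * ((\<Sum>j=1..k. a j) / real k)" for k
    proof -
      have "expectation (S k) = (\<Sum>j=1..k. expectation (\<lambda>\<omega>. (d j \<omega> + a j) / real k))"
        unfolding S_def[abs_def] using d_int by (intro Bochner_Integration.integral_sum integrable_divide
            Bochner_Integration.integrable_add) auto
      also have "\<dots> = (\<Sum>j=1..k. (a j + a j) / real k)"
        using d_int by (intro sum.cong refl) (simp add: prob_space a_def)
      also have "\<dots> = 2 * ((\<Sum>j=1..k. a j) / real k)"
        by (simp add: sum_divide_distrib sum_distrib_left)
      finally show ?thesis .
    qed
    then show ?thesis
      using tendsto_mult_right_zero[OF Cesaro_mean_null[OF a_lim], of 2] by simp
  qed
  \<comment> \<open>Stated for a general \<open>Y\<close> because it serves twice: for the norm of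
    the averaged functions and for the absolute value of the averaged norms.\<close>
  have null: "{\<omega> \<in> space M. \<delta> \<le> Y k \<omega>} \<in> sets M" "(\<lambda>k. prob {\<omega> \<in> space M. \<delta> \<le> Y k \<omega>}) \<longlonglongrightarrow> 0"
    if Y: "\<And>k. Y k \<in> borel_measurable M" "\<And>k \<omega>. \<omega> \<in> space M \<Longrightarrow> 0 \<le> Y k \<omega>"
      "\<And>k \<omega>. \<omega> \<in> space M \<Longrightarrow> Y k \<omega> \<le> S k \<omega>" and \<delta>: "0 < \<delta>" for Y :: "nat \<Rightarrow> 'w \<Rightarrow> real" and \<delta> k
  proof -
    have int: "integrable M (Y k)" for k
    proof (rule Bochner_Integration.integrable_bound[OF S_int[of k] Y(1)], rule AE_I2)
      fix \<omega> assume "\<omega> \<in> space M"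
      then show "norm (Y k \<omega>) \<le> norm (S k \<omega>)" using Y(2)[of \<omega> k] Y(3)[of \<omega> k] by simp
    qed
    have "\<forall>k. norm (expectation (Y k)) \<le> expectation (S k)"
      using Y(2,3) by (auto intro!: integral_mono int S_int simp: integral_nonneg)
    then have lim: "(\<lambda>k. expectation (Y k)) \<longlonglongrightarrow> 0"
      by (rule Lim_null_comparison[OF always_eventually S_lim])
    show "{\<omega> \<in> space M. \<delta> \<le> Y k \<omega>} \<in> sets M" "(\<lambda>k. prob {\<omega> \<in> space M. \<delta> \<le> Y k \<omega>}) \<longlonglongrightarrow> 0"
      using null_in_prob_of_null_in_mean[OF int Y(2) lim \<delta>] by blast+
  qed
  let ?E = "\<lambda>j. Linf_expectation M U (u j)"
  let ?A = "\<lambda>k \<omega> x. \<Sum>j=1..k. (u j \<omega> x - ?E j x) / real k"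
  have EL: "?E j \<in> Linf U" if "1 \<le> j" for j
    by (rule Linf_expectation_in[OF approx[OF that]])
  have A_approx: "Linf_approximable M U (?A k)" for k
  proof (rule Linf_approximable_sum)
    fix j assume "j \<in> {1..k}"
    then have j: "1 \<le> j" by simp
    have "Linf_approximable M U (\<lambda>\<omega> x. 1 / real k * (u j \<omega> x - ?E j x))"
      by (intro Linf_approximable_cmult Linf_approximable_diff Linf_approximable_const approx[OF j] EL[OF j])
    then show "Linf_approximable M U (\<lambda>\<omega> x. (u j \<omega> x - ?E j x) / real k)" by simp
  qed simp
  have A_bound: "Linf_norm U (?A k \<omega>) \<le> S k \<omega>" if w: "\<omega> \<in> space M" for k \<omega>
  proof -
    have L: "(\<lambda>x. u j \<omega> x - ?E j x) \<in> Linf U" if "j \<in> {1..k}" for j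
      using that by (intro Linf_diff uL EL w) auto
    have eq: "?A k \<omega> = (\<lambda>x. \<Sum>j=1..k. 1 / real k * (u j \<omega> x - ?E j x))" by simp
    have "Linf_norm U (?A k \<omega>) \<le> (\<Sum>j=1..k. Linf_norm U (\<lambda>x. 1 / real k * (u j \<omega> x - ?E j x)))"
      unfolding eq by (rule Linf_norm_sum_le[OF finite_atLeastAtMost Linf_cmult[OF L]])
    also have "\<dots> \<le> (\<Sum>j=1..k. (d j \<omega> + a j) / real k)"
    proof (rule sum_mono)
      fix j assume jk: "j \<in> {1..k}"
      then have j: "1 \<le> j" by simp
      \<comment> \<open>The triangle inequality through \<open>u j \<omega>0\<close> splits the
        centred variable; the expectation is compared with this fixed function by the norm estimate
        for the Bochner integral.\<close>
      have "Linf_norm U (\<lambda>x. ?E j x - u j \<omega>0 x) \<le> a j"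
        unfolding a_def d_def[abs_def]
        by (rule Linf_bochner_integral_norm_diff[OF approx[OF j] has_Linf_expectation[OF approx[OF j]] uL[OF j w0(1)]])
      then have "Linf_norm U (\<lambda>x. u j \<omega> x - ?E j x) \<le> d j \<omega> + a j"
        using Linf_norm_triangle[OF uL[OF j w] uL[OF j w0(1)] EL[OF j]]
          Linf_norm_minus_commute[of U "u j \<omega>0" "?E j"] by (simp add: d_def)
      then have "\<bar>1 / real k\<bar> * Linf_norm U (\<lambda>x. u j \<omega> x - ?E j x) \<le> \<bar>1 / real k\<bar> * (d j \<omega> + a j)"
        by (rule mult_left_mono) simp
      then show "Linf_norm U (\<lambda>x. 1 / real k * (u j \<omega> x - ?E j x)) \<le> (d j \<omega> + a j) / real k"
        using Linf_norm_cmult_le[OF L[OF jk], of "1 / real k"] by simp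
    qed
    finally show ?thesis by (simp only: S_def)
  qed
  have first: "Linf_tendsto_in_prob M U ?A (\<lambda>\<omega> x. 0)"
    unfolding Linf_tendsto_in_prob_def
  proof (intro conjI ballI allI impI)
    show "?A k \<omega> \<in> Linf U" if "\<omega> \<in> space M" for k \<omega>
      using A_approx[of k] that by (simp add: Linf_approximable_def)
    fix \<delta> :: real assume \<delta>: "0 < \<delta>"
    note n = null[of "\<lambda>k \<omega>. Linf_norm U (?A k \<omega>)",
        OF Linf_approximable_norm_measurable[OF A_approx] Linf_norm_nonneg A_bound \<delta>]
    show "{\<omega> \<in> space M. \<delta> \<le> Linf_norm U (\<lambda>x. ?A k \<omega> x - 0)} \<in> sets M" for k
      using n(1)[of k] by simp
    show "(\<lambda>k. measure M {\<omega> \<in> space M. \<delta> \<le> Linf_norm U (\<lambda>x. ?A k \<omega> x - 0)}) \<longlonglongrightarrow> 0"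
      using n(2) by simp
  qed (rule Linf_zero)
  let ?n = "\<lambda>j \<omega>. Linf_norm U (u j \<omega>)"
  let ?B = "\<lambda>k \<omega>. \<Sum>j=1..k. (?n j \<omega> - expectation (?n j)) / real k"
  have n_int: "integrable M (?n j)" if "1 \<le> j" for j
    by (rule Linf_approximable_norm_integrable[OF approx[OF that]])
  have B_meas: "(\<lambda>\<omega>. \<bar>?B k \<omega>\<bar>) \<in> borel_measurable M" for k
    using n_int by (intro borel_measurable_abs borel_measurable_sum borel_measurable_divide
        borel_measurable_diff borel_measurable_const borel_measurable_integrable) auto
  have B_bound: "\<bar>?B k \<omega>\<bar> \<le> S k \<omega>" if w: "\<omega> \<in> space M" for k \<omega>
  proof -
    have "\<bar>?B k \<omega>\<bar> \<le> (\<Sum>j=1..k. \<bar>(?n j \<omega> - expectation (?n j)) / real k\<bar>)"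
      by (rule sum_abs)
    also have "\<dots> \<le> (\<Sum>j=1..k. (d j \<omega> + a j) / real k)"
    proof (rule sum_mono)
      fix j assume "j \<in> {1..k}"
      then have j: "1 \<le> j" by simp
      have nd: "\<bar>?n j \<omega> - ?n j \<omega>0\<bar> \<le> d j \<omega>" if "\<omega> \<in> space M" for \<omega>
        unfolding d_def by (rule Linf_norm_diff_abs[OF uL[OF j that] uL[OF j w0(1)]])
      \<comment> \<open>The constant is moved under the integral so that the expected norm, too,
        lies within \<open>a j\<close> of the value at \<open>\<omega>0\<close>.\<close>
      have "expectation (?n j) - ?n j \<omega>0 = expectation (\<lambda>\<omega>. ?n j \<omega> - ?n j \<omega>0)"
        using n_int[OF j] by (simp add: prob_space)
      moreover have "\<bar>expectation (\<lambda>\<omega>. ?n j \<omega> - ?n j \<omega>0)\<bar> \<le> expectation (\<lambda>\<omega>. \<bar>?n j \<omega> - ?n j \<omega>0\<bar>)"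
        by (rule integral_abs_bound)
      moreover have "expectation (\<lambda>\<omega>. \<bar>?n j \<omega> - ?n j \<omega>0\<bar>) \<le> a j"
        unfolding a_def using n_int[OF j] d_int[OF j] nd by (intro integral_mono) auto
      ultimately have "\<bar>?n j \<omega> - expectation (?n j)\<bar> \<le> d j \<omega> + a j"
        using nd[OF w] by linarith
      then show "\<bar>(?n j \<omega> - expectation (?n j)) / real k\<bar> \<le> (d j \<omega> + a j) / real k"
        by (simp add: abs_divide divide_right_mono)
    qed
    finally show ?thesis by (simp only: S_def)
  qed
  have second: "tendsto_in_prob M ?B (\<lambda>\<omega>. 0)"
    unfolding tendsto_in_prob_def
  proof (intro allI impI)
    fix \<delta> :: real assume \<delta>: "0 < \<delta>"
    note n = null[of "\<lambda>k \<omega>. \<bar>?B k \<omega>\<bar>", OF B_meas abs_ge_zero B_bound \<delta>]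
    show "(\<forall>k. {\<omega> \<in> space M. \<delta> \<le> \<bar>?B k \<omega> - 0\<bar>} \<in> sets M) \<and>
        (\<lambda>k. measure M {\<omega> \<in> space M. \<delta> \<le> \<bar>?B k \<omega> - 0\<bar>}) \<longlonglongrightarrow> 0"
      using n by simp
  qed
  show ?thesis using first second by blast
qed

end
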